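(* Let $r$ be a rational number and let $n>1$ be an integer or a half-integer. For $s\in\hat{\mathbb Q}=\mathbb Q\cup\{\infty\}$, if $s$ or $s+1$ belongs to the $\Gamma(r;n)$-orbit of $\infty$, then there is an upper-meridian-pair-preserving epimorphism from the 2-bridge link group $G(K(s))$ to the Heckoid group $G(r;n)$.
   Context: **Loops.** Let $H$ be the group of isometries of $\mathbb R^2$ generated by the $\pi$-rotations about the points of $\mathbb Z^2$, and $\hat H\supset H$ the group generated by the $\pi$-rotations about the points of $(\frac12\mathbb Z)^2$. The Conway sphere is $(\boldsymbol S^2,\boldsymbol P)=(\mathbb R^2,\mathbb Z^2)/H$; $\boldsymbol S=(\mathbb R^2-\mathbb Z^2)/H$ is a 4-punctured sphere, $\boldsymbol T=(\mathbb R^2-\mathbb Z^2)/\mathbb Z^2$ is a once-punctured torus, and $\boldsymbol O=(\mathbb R^2-\mathbb Z^2)/\hat H$ is an orbifold (a once-punctured sphere with three cone points of angle $\pi$). $\boldsymbol S$ and $\boldsymbol T$ are coverings of $\boldsymbol O$ with groups $(\mathbb Z/2)^2$ and $\mathbb Z/2$, so $\pi_1(\boldsymbol S),\pi_1(\boldsymbol T)\subset\pi_1(\boldsymbol O)$. For $s\in\hat{\mathbb Q}$, $\alpha_s$ and $\beta_s$ denote the unoriented simple loops in $\boldsymbol S$ and $\boldsymbol T$, respectively, that are images of a line of slope $s$ in $\mathbb R^2-\mathbb Z^2$, and also the corresponding conjugacy classes (up to inversion); in $\pi_1(\boldsymbol O)$ one has $\alpha_s=\beta_s^2$. **2-bridge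 links.** A rational tangle $(B^3,t(r))$ of slope $r\in\hat{\mathbb Q}$ is a 3-ball with a pair of trivial properly embedded arcs, with boundary identified with $(\boldsymbol S^2,\boldsymbol P)$ so that $\alpha_r$ bounds a disk in $B^3-t(r)$ separating the two arcs. The 2-bridge link of slope $s$ is $(S^3,K(s))=(B^3,t(\infty))\cup(B^3,t(s))$, and its link group is $G(K(s))=\pi_1(S^3-K(s))\cong\pi_1(\boldsymbol S)/\langle\langle\alpha_\infty,\alpha_s\rangle\rangle\cong\pi_1(B^3-t(\infty))/\langle\langle\alpha_s\rangle\rangle$. **Heckoid groups.** Let $r\in\mathbb Q$. For an integer $n\ge2$, the even Heckoid group is $G(r;n)=\pi_1(\boldsymbol S)/\langle\langle\alpha_\infty,\alpha_r^n\rangle\rangle\cong\pi_1(B^3-t(\infty))/\langle\langle\alpha_r^n\rangle\rangle$. For a non-integral half-integer $n>1$, put $m=2n$ (odd); the odd Heckoid group $G(r;n)$ is the image of $\pi_1(\boldsymbol S)$ in $\pi_1(\boldsymbol O)/\langle\langle\beta_\infty^2,\beta_r^m\rangle\rangle$. In all cases the natural epimorphism $\pi_1(\boldsymbol S)\to G(r;n)$ factors through $\pi_1(B^3-t(\infty))=\pi_1(\boldsymbol S)/\langle\langle\alpha_\infty\rangle\rangle$. **Upper meridian pairs.** The group $\pi_1(B^3-t(\infty))$ is free on a standard meridian pair $\{a,b\}$ ($a$, $b$ meridians of the two strings of $t(\infty)$). The image of $\{a,b\}$ in $G(K(s))$, respectively $G(r;n)$, is the upper meridian pair of that group; it is regarded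 as an unordered pair up to simultaneous conjugation and up to replacing one or both members by their inverses. An epimorphism $G(K(s))\to G(r;n)$ is upper-meridian-pair-preserving if it carries the upper meridian pair of $G(K(s))$ to that of $G(r;n)$. **Groups acting on the Farey tessellation.** Let $\mathcal D$ be the Farey tessellation of $\mathbb H^2$ (ideal triangles obtained from the one with vertices $0,1,\infty$ by repeated reflection in edges); its ideal vertex set is $\hat{\mathbb Q}$. $\Gamma_\infty$ is the group generated by the reflections in the edges of $\mathcal D$ with endpoint $\infty$. For an integer $m$, $C_r(m)$ is the infinite cyclic group generated by the parabolic automorphism of $\mathcal D$ fixing $r$ that shifts the edges of $\mathcal D$ with endpoint $r$ by $m$ units (clockwise). $\Gamma(r;n)$ is the group generated by $\Gamma_\infty$ and $C_r(2n)$. *)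

theory Defs
  imports "HOL-Analysis.Analysis" "HOL-Algebra.Bij" "HOL-Algebra.Generated_Groups"
begin

section \<open>Slopes\<close>

datatype slope = Slope rat | Slope_Infty

fun slope_plus_one :: "slope \<Rightarrow> slope" where
  "slope_plus_one (Slope q) = Slope (q + 1)"
| "slope_plus_one Slope_Infty = Slope_Infty"

text \<open>The slope \<open>q/p\<close> is represented by the primitive integer vector \<open>(p, q)\<close> with \<open>p > 0\<close>,
  and the slope \<open>\<infinity> = 1/0\<close> by \<open>(0, 1)\<close>.\<close>

fun slope_vec :: "slope \<Rightarrow> int \<times> int" where
  "slope_vec (Slope x) = (case quotient_of x of (q, p) \<Rightarrow> (p, q))"
| "slope_vec Slope_Infty = (0, 1)"

fun slope_of :: "int \<times> int \<Rightarrow> slope" where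
  "slope_of (p, q) = (if p = 0 then Slope_Infty else Slope (of_int q / of_int p))"

fun det2 :: "int \<times> int \<Rightarrow> int \<times> int \<Rightarrow> int" where
  "det2 (a, b) (c, d) = a * d - b * c"

fun lincomb :: "int \<Rightarrow> int \<times> int \<Rightarrow> int \<Rightarrow> int \<times> int \<Rightarrow> int \<times> int" where
  "lincomb k (a, b) l (c, d) = (k * a + l * c, k * b + l * d)"


section \<open>The Farey tessellation and the orbit of \<open>\<infinity>\<close>\<close>

text \<open>Isometries of the hyperbolic plane that preserve the tessellation are represented by their
  action on its set of ideal vertices, on which they act faithfully.

  The reflection in the geodesic with ideal endpoints \<open>u \<noteq> v\<close> acts on the circle at infinity, that
  is, on the projective line, as the map induced by the linear map fixing \<open>u\<close> and negating \<open>v\<close>.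
  Since \<open>det(u,v) w = det(w,v) u + det(u,w) v\<close>, it sends the class of \<open>w\<close> to that of
  \<open>det(w,v) u - det(u,w) v\<close>. For \<open>u = \<infinity>\<close> and an integer \<open>v = k\<close> this is \<open>x \<mapsto> 2k - x\<close>.\<close>

definition geodesic_reflection :: "slope \<Rightarrow> slope \<Rightarrow> slope \<Rightarrow> slope" where
  "geodesic_reflection u v w =
     slope_of (lincomb (det2 (slope_vec w) (slope_vec v)) (slope_vec u)
                       (- det2 (slope_vec u) (slope_vec w)) (slope_vec v))"

text \<open>An ideal triangle is identified with its set of ideal vertices.\<close>

inductive farey_triangle :: "slope set \<Rightarrow> bool" where
  "farey_triangle {Slope 0, Slope 1, Slope_Infty}"
| "\<lbrakk>farey_triangle T; u \<in> T; v \<in> T; u \<noteq> v\<rbrakk> \<Longrightarrow> farey_triangle (geodesic_reflection u v ` T)"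

definition farey_edge :: "slope \<Rightarrow> slope \<Rightarrow> bool" where
  "farey_edge u v \<longleftrightarrow> u \<noteq> v \<and> (\<exists>T. farey_triangle T \<and> u \<in> T \<and> v \<in> T)"

text \<open>The parabolic automorphism fixing \<open>r\<close> and shifting the edges at \<open>r\<close> by \<open>m\<close> units is induced
  by the transvection \<open>w \<mapsto> w + m det(r,w) r\<close>: the edges at \<open>r\<close> are those joining \<open>r\<close> to
  \<open>v + k r\<close>, for an integer \<open>k\<close> and a fixed \<open>v\<close> with \<open>det(r,v) = 1\<close>, and \<open>v + k r\<close> is sent to
  \<open>v + (k + m) r\<close>. The sense of the shift does not affect the cyclic group generated.\<close>

definition parabolic_shift :: "slope \<Rightarrow> int \<Rightarrow> slope \<Rightarrow> slope" where
  "parabolic_shift r m w =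
     slope_of (lincomb 1 (slope_vec w) (m * det2 (slope_vec r) (slope_vec w)) (slope_vec r))"

definition Gamma_infty :: "(slope \<Rightarrow> slope) set" where
  "Gamma_infty =
     generate (BijGroup UNIV) {geodesic_reflection Slope_Infty v | v. farey_edge Slope_Infty v}"

definition C_shift :: "slope \<Rightarrow> int \<Rightarrow> (slope \<Rightarrow> slope) set" where
  "C_shift r m = generate (BijGroup UNIV) {parabolic_shift r m}"

text \<open>Here \<open>n\<close> is meant to be an integer or a half-integer, so that \<open>\<lfloor>2 * n\<rfloor> = 2 * n\<close>.\<close>

definition Gamma :: "rat \<Rightarrow> rat \<Rightarrow> (slope \<Rightarrow> slope) set" where
  "Gamma r n = generate (BijGroup UNIV) (Gamma_infty \<union> C_shift (Slope r) \<lfloor>2 * n\<rfloor>)"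

definition orbit_infty :: "rat \<Rightarrow> rat \<Rightarrow> slope set" where
  "orbit_infty r n = {g Slope_Infty | g. g \<in> Gamma r n}"


section \<open>Fundamental groups of \<open>S\<close> and \<open>O\<close>\<close>

text \<open>Let the group \<open>G\<close> of homeomorphisms act properly discontinuously on \<open>X\<close>. The (orbifold)
  fundamental group of \<open>X / G\<close> consists of the pairs of an element \<open>f\<close> of \<open>G\<close> and the homotopy
  class, relative to the endpoints, of a path in \<open>X\<close> from the base point \<open>x\<^sub>0\<close> to \<open>f x\<^sub>0\<close>. The product
  follows the first path and then the translate of the second one. If \<open>G\<close> acts freely, path
  lifting identifies this with the fundamental group of the quotient space. For a subgroup of \<open>G\<close>
  one obtains the subgroup of the elements whose first component lies in it.\<close>

definition orb_class :: "'a::topological_space set \<Rightarrow> ('a \<Rightarrow> 'a) \<Rightarrow> (real \<Rightarrow> 'a)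
    \<Rightarrow> ('a \<Rightarrow> 'a) \<times> (real \<Rightarrow> 'a) set" where
  "orb_class X f \<gamma> = (f, {\<delta>. homotopic_paths X \<gamma> \<delta>})"

definition orb_pi1 :: "'a::topological_space set \<Rightarrow> ('a \<Rightarrow> 'a) set \<Rightarrow> 'a
    \<Rightarrow> (('a \<Rightarrow> 'a) \<times> (real \<Rightarrow> 'a) set) monoid" where
  "orb_pi1 X G x\<^sub>0 =
     \<lparr>carrier = {orb_class X f \<gamma> | f \<gamma>. f \<in> G \<and> path \<gamma> \<and> path_image \<gamma> \<subseteq> X \<and>
                    pathstart \<gamma> = x\<^sub>0 \<and> pathfinish \<gamma> = f x\<^sub>0},
      mult = \<lambda>(f, C) (g, D).
        (f \<circ> g, {\<epsilon>. \<exists>\<gamma>\<in>C. \<exists>\<delta>\<in>D. homotopic_paths X (\<gamma> +++ (f \<circ> \<delta>)) \<epsilon>}),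
      one = orb_class X id (\<lambda>t. x\<^sub>0)\<rparr>"

type_synonym plane = "real \<times> real"
type_synonym loop = "(plane \<Rightarrow> plane) \<times> (real \<Rightarrow> plane) set"

definition integer_points :: "plane set" where
  "integer_points = \<int> \<times> \<int>"

definition punctured_plane :: "plane set" where
  "punctured_plane = - integer_points"

definition half_turn :: "plane \<Rightarrow> plane \<Rightarrow> plane" where
  "half_turn c = (\<lambda>x. 2 *\<^sub>R c - x)"

definition H_group :: "(plane \<Rightarrow> plane) set" where
  "H_group = generate (BijGroup UNIV) {half_turn c | c. c \<in> integer_points}"

definition H_hat_group :: "(plane \<Rightarrow> plane) set" where
  "H_hat_group = generate (BijGroup UNIV) {half_turn c | c. 2 *\<^sub>R c \<in> integer_points}"

text \<open>A base point outside \<open>(1/2 \<int>)\<^sup>2\<close>, hence with trivial stabiliser in both groups.\<close>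

definition base :: plane where
  "base = (1/2, 1/4)"

definition pi1_S :: "loop monoid" where
  "pi1_S = orb_pi1 punctured_plane H_group base"

definition pi1_O :: "loop monoid" where
  "pi1_O = orb_pi1 punctured_plane H_hat_group base"


section \<open>The loops \<open>\<alpha>\<^sub>s\<close> and \<open>\<beta>\<^sub>s\<close>\<close>

definition slope_dir :: "slope \<Rightarrow> plane" where
  "slope_dir s = (case slope_vec s of (p, q) \<Rightarrow> (of_int p, of_int q))"

text \<open>All elements represented by the closed loop that is the image of a segment from \<open>y\<close> to
  \<open>y + k v\<close> on a line in the punctured plane, where \<open>v\<close> is plus or minus the primitive integer
  vector of slope \<open>s\<close>, joined to the base point by an arbitrary path \<open>\<delta>\<close>.\<close>

definition line_loops :: "real \<Rightarrow> slope \<Rightarrow> loop set" where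
  "line_loops k s =
     {orb_class punctured_plane (\<lambda>x. x + k *\<^sub>R v)
        (\<delta> +++ linepath y (y + k *\<^sub>R v) +++ reversepath (\<lambda>t. \<delta> t + k *\<^sub>R v)) | v y \<delta>.
      (v = slope_dir s \<or> v = - slope_dir s) \<and>
      (\<forall>t. y + t *\<^sub>R v \<in> punctured_plane) \<and>
      path \<delta> \<and> path_image \<delta> \<subseteq> punctured_plane \<and> pathstart \<delta> = base \<and> pathfinish \<delta> = y}"

text \<open>The translations in \<open>H\<close> are those by vectors in \<open>2\<int>\<^sup>2\<close>, whereas the once-punctured torus is
  the quotient by the translations by \<open>\<int>\<^sup>2\<close>. Hence the simple loop in \<open>S\<close> closes up
  after \<open>2 v\<close>, and the one in \<open>T\<close> after \<open>v\<close>. Each set is the union of a conjugacy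
  class, in the group of \<open>S\<close> and of \<open>O\<close> respectively, and its inverse.\<close>

definition alpha :: "slope \<Rightarrow> loop set" where
  "alpha s = line_loops 2 s"

definition beta :: "slope \<Rightarrow> loop set" where
  "beta s = line_loops 1 s"


section \<open>Link groups and Heckoid groups\<close>

definition normal_closure :: "('a, 'b) monoid_scheme \<Rightarrow> 'a set \<Rightarrow> 'a set" where
  "normal_closure G A = \<Inter>{N. N \<lhd> G \<and> A \<subseteq> N}"

definition powers_in :: "('a, 'b) monoid_scheme \<Rightarrow> 'a set \<Rightarrow> nat \<Rightarrow> 'a set" where
  "powers_in G A k = {a [^]\<^bsub>G\<^esub> k | a. a \<in> A}"

definition link_kernel :: "slope \<Rightarrow> loop set" where
  "link_kernel s = normal_closure pi1_S (alpha Slope_Infty \<union> alpha s)"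

definition link_group :: "slope \<Rightarrow> loop set monoid" where
  "link_group s = pi1_S Mod link_kernel s"

definition link_proj :: "slope \<Rightarrow> loop \<Rightarrow> loop set" where
  "link_proj s x = link_kernel s #>\<^bsub>pi1_S\<^esub> x"

definition even_heckoid_kernel :: "rat \<Rightarrow> nat \<Rightarrow> loop set" where
  "even_heckoid_kernel r k =
     normal_closure pi1_S (alpha Slope_Infty \<union> powers_in pi1_S (alpha (Slope r)) k)"

definition odd_heckoid_kernel :: "rat \<Rightarrow> nat \<Rightarrow> loop set" where
  "odd_heckoid_kernel r m =
     normal_closure pi1_O
       (powers_in pi1_O (beta Slope_Infty) 2 \<union> powers_in pi1_O (beta (Slope r)) m)"

definition heckoid_proj :: "rat \<Rightarrow> rat \<Rightarrow> loop \<Rightarrow> loop set" where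
  "heckoid_proj r n x =
     (if n \<in> \<int> then even_heckoid_kernel r (nat \<lfloor>n\<rfloor>) #>\<^bsub>pi1_S\<^esub> x
      else odd_heckoid_kernel r (nat \<lfloor>2 * n\<rfloor>) #>\<^bsub>pi1_O\<^esub> x)"

definition heckoid_group :: "rat \<Rightarrow> rat \<Rightarrow> loop set monoid" where
  "heckoid_group r n =
     (if n \<in> \<int> then pi1_S Mod even_heckoid_kernel r (nat \<lfloor>n\<rfloor>)
      else (pi1_O Mod odd_heckoid_kernel r (nat \<lfloor>2 * n\<rfloor>))
             \<lparr>carrier := heckoid_proj r n ` carrier pi1_S\<rparr>)"


section \<open>Upper meridian pairs\<close>

text \<open>The punctures \<open>(0,0)\<close> and \<open>(0,1)\<close> of \<open>S\<close> are the endpoints of one string of \<open>t(\<infinity>)\<close>, and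
  \<open>(1,0)\<close> and \<open>(1,1)\<close> those of the other: the vertical line through \<open>base\<close> covers the loop
  \<open>\<alpha>\<^sub>\<infinity>\<close>, which separates these two pairs of punctures. The two loops below run half-way around
  \<open>(0,0)\<close> and \<open>(1,0)\<close>. They cross the preimages \<open>x \<in> \<int>\<close> of the two arcs joining the paired
  punctures exactly once, in \<open>x = 0\<close> and in \<open>x = 1\<close> respectively; as the complement of these arcs
  in \<open>S\<close> is an annulus with core \<open>\<alpha>\<^sub>\<infinity>\<close>, they freely generate the quotient of the fundamental
  group of \<open>S\<close> by the normal closure of \<open>\<alpha>\<^sub>\<infinity>\<close>.\<close>

definition meridian_a :: loop where
  "meridian_a = orb_class punctured_plane (half_turn (0, 0))
     (linepath base (1/2, -1/4) +++ linepath (1/2, -1/4) (-1/2, -1/4))"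

definition meridian_b :: loop where
  "meridian_b = orb_class punctured_plane (half_turn (1, 0))
     (linepath base (1/2, -1/4) +++ linepath (1/2, -1/4) (3/2, -1/4))"

text \<open>The set of all unordered pairs obtained from \<open>{x, y}\<close> by inverting one or both members and
  conjugating simultaneously.\<close>

definition pair_class :: "('a, 'b) monoid_scheme \<Rightarrow> 'a \<Rightarrow> 'a \<Rightarrow> 'a set set" where
  "pair_class G x y =
     {{g \<otimes>\<^bsub>G\<^esub> x' \<otimes>\<^bsub>G\<^esub> inv\<^bsub>G\<^esub> g, g \<otimes>\<^bsub>G\<^esub> y' \<otimes>\<^bsub>G\<^esub> inv\<^bsub>G\<^esub> g} | g x' y'.
        g \<in> carrier G \<and> x' \<in> {x, inv\<^bsub>G\<^esub> x} \<and> y' \<in> {y, inv\<^bsub>G\<^esub> y}}"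

definition link_upper_meridian_pair :: "slope \<Rightarrow> loop set set set" where
  "link_upper_meridian_pair s =
     pair_class (link_group s) (link_proj s meridian_a) (link_proj s meridian_b)"

definition heckoid_upper_meridian_pair :: "rat \<Rightarrow> rat \<Rightarrow> loop set set set" where
  "heckoid_upper_meridian_pair r n =
     pair_class (heckoid_group r n) (heckoid_proj r n meridian_a) (heckoid_proj r n meridian_b)"

definition upper_meridian_pair_preserving ::
    "slope \<Rightarrow> rat \<Rightarrow> rat \<Rightarrow> (loop set \<Rightarrow> loop set) \<Rightarrow> bool" where
  "upper_meridian_pair_preserving s r n \<phi> \<longleftrightarrow>
     (\<lambda>P. \<phi> ` P) ` link_upper_meridian_pair s = heckoid_upper_meridian_pair r n"

end

theory Submission
  imports Defs
begin

text \<open>The group of pairs \<open>(f, [\<gamma>])\<close>, where \<open>f\<close> is an affine map preserving \<open>\<int>\<^sup>2\<close> and \<open>\<gamma>\<close> a path from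
  the base point to its image under \<open>f\<close>, contains the fundamental groups of \<open>S\<close> and \<open>O\<close> as normal
  subgroups, and its elements act on slopes through their linear parts. Conjugation by an element
  carrying \<open>s\<close> to \<open>t\<close> takes the line loops of slope \<open>s\<close> to those of slope \<open>t\<close>. In both parities
  the Heckoid group is the image of the group of \<open>S\<close> in the quotient of the group of \<open>O\<close> by the
  normal closure \<open>N\<close> of \<open>\<beta>\<^sub>\<infinity>\<^sup>2\<close> and \<open>\<beta>\<^sub>r\<^sup>m\<close> with \<open>m = 2n\<close>, since \<open>\<alpha>\<^sub>s = \<beta>\<^sub>s\<^sup>2\<close>.

  Let \<open>\<rho>\<^sub>j\<close> and \<open>\<sigma>\<close> be the half-turns about \<open>(1/2, j/2)\<close> and \<open>(0, 1/2)\<close>; then \<open>\<rho>\<^sub>i \<rho>\<^sub>j\<close> is the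
  vertical loop \<open>\<beta>\<^sub>\<infinity>\<close> to the power \<open>i - j\<close>. The reflections of the Farey tessellation fixing
  \<open>\<infinity>\<close> lift to elements that fix \<open>\<sigma>\<close> and take \<open>\<rho>\<^sub>j\<close> to \<open>\<rho>\<^sub>2\<^sub>k\<^sub>+\<^sub>2\<^sub>-\<^sub>j\<close>, and the shift by \<open>m\<close> at
  \<open>\<infinity>\<close> to one that fixes \<open>\<sigma>\<close> and takes \<open>\<rho>\<^sub>j\<close> to \<open>\<rho>\<^sub>j\<^sub>\<plusminus>\<^sub>m\<close>. Thus the reflections act trivially
  modulo \<open>\<beta>\<^sub>\<infinity>\<^sup>2\<close> on the group generated by \<open>\<sigma>, \<rho>\<^sub>0, \<rho>\<^sub>1\<close>, the shift at \<open>\<infinity>\<close> modulo \<open>\<beta>\<^sub>\<infinity>\<^sup>m\<close>, and,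
  after conjugation by an element carrying \<open>\<infinity>\<close> to \<open>r\<close>, the shift at \<open>r\<close> modulo \<open>\<beta>\<^sub>r\<^sup>m\<close>. So all
  of \<open>\<Gamma>(r;n)\<close> is realised by elements normalising \<open>N\<close>, and \<open>\<alpha>\<^sub>s\<close> lies in \<open>N\<close> for every \<open>s\<close> in the
  orbit of \<open>\<infinity>\<close>. The shear taking \<open>s\<close> to \<open>s + 1\<close> fixes the meridian \<open>a\<close> and inverts \<open>b\<close> modulo \<open>N\<close>.\<close>

section \<open>Paths modulo a group action\<close>

lemma orb_class_eqI:
  assumes "f = g" "homotopic_paths X p q"
  shows "orb_class X f p = orb_class X g q"
  using assms unfolding orb_class_def
  by (auto intro: homotopic_paths_trans homotopic_paths_sym)

text \<open>Interpreted only with the group \<open>Aff\<close> of all affine maps, so that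
  conjugation by elements outside the deck groups of S and O takes place in one group.\<close>

locale orbit_loops =
  fixes X :: "'a::real_normed_vector set" and G :: "('a \<Rightarrow> 'a) set" and x0 :: 'a
  assumes id_in: "id \<in> G"
    and comp_in: "f \<in> G \<Longrightarrow> g \<in> G \<Longrightarrow> f \<circ> g \<in> G"
    and inverse_in: "f \<in> G \<Longrightarrow> \<exists>g\<in>G. g \<circ> f = id \<and> f \<circ> g = id"
    and cont: "f \<in> G \<Longrightarrow> continuous_on X f"
    and maps: "f \<in> G \<Longrightarrow> f ` X \<subseteq> X"
    and base_in: "x0 \<in> X"
begin

abbreviation "\<Omega> \<equiv> orb_pi1 X G x0"

definition joins :: "('a \<Rightarrow> 'a) \<Rightarrow> (real \<Rightarrow> 'a) \<Rightarrow> bool" where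
  "joins f p \<longleftrightarrow> path p \<and> path_image p \<subseteq> X \<and> pathstart p = x0 \<and> pathfinish p = f x0"

lemma carrier_orb_pi1: "carrier \<Omega> = {orb_class X f p | f p. f \<in> G \<and> joins f p}"
  by (auto simp: orb_pi1_def joins_def)

lemma orb_class_in: "f \<in> G \<Longrightarrow> joins f p \<Longrightarrow> orb_class X f p \<in> carrier \<Omega>"
  by (auto simp: carrier_orb_pi1)

lemma fst_in: "x \<in> carrier \<Omega> \<Longrightarrow> fst x \<in> G"
  by (auto simp: carrier_orb_pi1 orb_class_def)

lemma path_translate:
  assumes "f \<in> G" "path p" "path_image p \<subseteq> X"
  shows "path (f \<circ> p)" "path_image (f \<circ> p) \<subseteq> X"
proof -
  show "path (f \<circ> p)"
    using assms cont continuous_on_subset path_continuous_image by blast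
  show "path_image (f \<circ> p) \<subseteq> X"
    using assms maps by (fastforce simp: path_image_compose)
qed

lemma joins_mult: "f \<in> G \<Longrightarrow> joins f p \<Longrightarrow> joins g q \<Longrightarrow> joins (f \<circ> g) (p +++ (f \<circ> q))"
  unfolding joins_def using path_translate[of f q]
  by (auto simp: pathstart_compose pathfinish_compose path_image_join)

text \<open>The product of \<open>orb_pi1\<close> quantifies over representatives. Since
  \<open>f\<close> maps homotopies in \<open>X\<close> to homotopies in \<open>X\<close>, all of
  them give the class of one concatenation.\<close>

lemma orb_class_mult:
  assumes "f \<in> G" "joins f p" "joins g q"
  shows "orb_class X f p \<otimes>\<^bsub>\<Omega>\<^esub> orb_class X g q = orb_class X (f \<circ> g) (p +++ (f \<circ> q))"
proof -
  have "(\<exists>\<gamma>\<in>{\<delta>. homotopic_paths X p \<delta>}. \<exists>\<delta>\<in>{\<delta>. homotopic_paths X q \<delta>}.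
           homotopic_paths X (\<gamma> +++ (f \<circ> \<delta>)) e)
        \<longleftrightarrow> homotopic_paths X (p +++ (f \<circ> q)) e" (is "?L \<longleftrightarrow> ?R") for e
  proof
    assume ?L
    then obtain c d where c: "homotopic_paths X p c" and d: "homotopic_paths X q d"
      and e: "homotopic_paths X (c +++ (f \<circ> d)) e" by auto
    have "homotopic_paths X (f \<circ> q) (f \<circ> d)"
      using homotopic_paths_continuous_image[OF d cont] assms(1) maps by blast
    then have "homotopic_paths X (p +++ (f \<circ> q)) (c +++ (f \<circ> d))"
      using assms by (intro homotopic_paths_join c) (auto simp: joins_def pathstart_compose)
    then show ?R using e by (rule homotopic_paths_trans)
  next
    assume ?R
    moreover have "homotopic_paths X p p" "homotopic_paths X q q"
      using assms by (auto simp: joins_def)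
    ultimately show ?L by blast
  qed
  then show ?thesis by (simp add: orb_class_def orb_pi1_def)
qed

text \<open>Going back along \<open>p\<close> and applying \<open>g\<close> gives a path from
  \<open>g (f x0) = x0\<close> to \<open>g x0\<close>. Followed by \<open>g \<circ> p\<close> it is
  the \<open>g\<close>-image of \<open>reversepath p +++ p\<close>, which contracts to
  \<open>f x0\<close>.\<close>

lemma orb_class_inverse:
  assumes "f \<in> G" "joins f p" "g \<in> G" "g \<circ> f = id"
  shows "joins g (g \<circ> reversepath p)"
    "orb_class X g (g \<circ> reversepath p) \<otimes>\<^bsub>\<Omega>\<^esub> orb_class X f p = \<one>\<^bsub>\<Omega>\<^esub>"
proof -
  have gf: "g (f x) = x" for x using assms(4) by (metis comp_apply id_apply)
  show 1: "joins g (g \<circ> reversepath p)"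
    using path_translate[of g "reversepath p"] assms gf
    by (auto simp: joins_def pathstart_compose pathfinish_compose)
  have "homotopic_paths X (reversepath p +++ p) (linepath (pathfinish p) (pathfinish p))"
    using assms(2) by (intro homotopic_paths_linv) (auto simp: joins_def)
  from homotopic_paths_continuous_image[OF this cont[OF assms(3)], of X]
  have "homotopic_paths X ((g \<circ> reversepath p) +++ (g \<circ> p)) (g \<circ> linepath (f x0) (f x0))"
    using maps[OF assms(3)] assms(2)
    by (simp add: path_compose_join[symmetric] joins_def image_subset_iff_funcset)
  moreover have "g \<circ> linepath (f x0) (f x0) = (\<lambda>t. x0)"
    using gf by (auto simp: linepath_refl)
  ultimately have "homotopic_paths X ((g \<circ> reversepath p) +++ (g \<circ> p)) (\<lambda>t. x0)"
    by simp
  then show "orb_class X g (g \<circ> reversepath p) \<otimes>\<^bsub>\<Omega>\<^esub> orb_class X f p = \<one>\<^bsub>\<Omega>\<^esub>"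
    using orb_class_mult[OF assms(3) 1 assms(2)] assms(4)
    by (simp add: orb_class_eqI orb_pi1_def)
qed

lemma joins_id: "joins id (\<lambda>t. x0)"
  using base_in by (auto simp: joins_def path_def path_image_def pathstart_def pathfinish_def)

sublocale loops: group \<Omega>
proof (rule groupI)
  show one: "\<one>\<^bsub>\<Omega>\<^esub> \<in> carrier \<Omega>"
    using orb_class_in[OF id_in joins_id] by (simp add: orb_pi1_def)
  fix x assume "x \<in> carrier \<Omega>"
  then obtain f p where x: "x = orb_class X f p" "f \<in> G" "joins f p" by (auto simp: carrier_orb_pi1)
  have "homotopic_paths X (linepath (pathstart p) (pathstart p) +++ p) p"
    using x by (intro homotopic_paths_lid) (auto simp: joins_def)
  then show "\<one>\<^bsub>\<Omega>\<^esub> \<otimes>\<^bsub>\<Omega>\<^esub> x = x"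
    using orb_class_mult[OF id_in joins_id x(3)] x
    by (simp add: orb_pi1_def joins_def linepath_refl orb_class_eqI)
  from inverse_in[OF x(2)] obtain g where g: "g \<in> G" "g \<circ> f = id" by auto
  show "\<exists>y\<in>carrier \<Omega>. y \<otimes>\<^bsub>\<Omega>\<^esub> x = \<one>\<^bsub>\<Omega>\<^esub>"
    using orb_class_inverse[OF x(2,3) g] orb_class_in[OF g(1)] x(1) by blast
  fix y assume "y \<in> carrier \<Omega>"
  then obtain g q where y: "y = orb_class X g q" "g \<in> G" "joins g q" by (auto simp: carrier_orb_pi1)
  show "x \<otimes>\<^bsub>\<Omega>\<^esub> y \<in> carrier \<Omega>"
    using x y orb_class_mult joins_mult orb_class_in comp_in by simp
  fix z assume "z \<in> carrier \<Omega>"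
  then obtain h r where z: "z = orb_class X h r" "h \<in> G" "joins h r" by (auto simp: carrier_orb_pi1)
  have "homotopic_paths X (p +++ (f \<circ> q) +++ (f \<circ> (g \<circ> r))) ((p +++ (f \<circ> q)) +++ (f \<circ> (g \<circ> r)))"
    using x y z path_translate comp_in
    by (intro homotopic_paths_assoc)
       (auto simp: joins_def pathstart_compose pathfinish_compose simp flip: o_assoc)
  then show "x \<otimes>\<^bsub>\<Omega>\<^esub> y \<otimes>\<^bsub>\<Omega>\<^esub> z = x \<otimes>\<^bsub>\<Omega>\<^esub> (y \<otimes>\<^bsub>\<Omega>\<^esub> z)"
    using x y z by (simp add: orb_class_mult joins_mult comp_in path_compose_join o_assoc
        orb_class_eqI homotopic_paths_sym)
qed

lemma orb_class_inv:
  assumes "f \<in> G" "joins f p" "g \<in> G" "g \<circ> f = id"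
  shows "inv\<^bsub>\<Omega>\<^esub> (orb_class X f p) = orb_class X g (g \<circ> reversepath p)"
  by (rule loops.inv_equality[OF orb_class_inverse(2)[OF assms] orb_class_in[OF assms(1,2)]
        orb_class_in[OF assms(3) orb_class_inverse(1)[OF assms]]])

lemma fst_mult: "fst (x \<otimes>\<^bsub>\<Omega>\<^esub> y) = fst x \<circ> fst y"
  by (cases x; cases y) (simp add: orb_pi1_def)

lemma fst_one: "fst \<one>\<^bsub>\<Omega>\<^esub> = id"
  by (simp add: orb_pi1_def orb_class_def)

lemma fst_inv:
  assumes "x \<in> carrier \<Omega>"
  shows "fst (inv\<^bsub>\<Omega>\<^esub> x) \<circ> fst x = id" "fst x \<circ> fst (inv\<^bsub>\<Omega>\<^esub> x) = id"
  using fst_mult[of "inv\<^bsub>\<Omega>\<^esub> x" x] fst_mult[of x "inv\<^bsub>\<Omega>\<^esub> x"] assms by (simp_all add: fst_one)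

text \<open>A simply connected set around the base point determines the class of the path from the
  base point to its image under \<open>f\<close>, so that products can be computed on maps alone.\<close>

definition domain_at_base :: "'a set \<Rightarrow> bool" where
  "domain_at_base W \<longleftrightarrow> simply_connected W \<and> W \<subseteq> X \<and> x0 \<in> W"

definition elt :: "'a set \<Rightarrow> ('a \<Rightarrow> 'a) \<Rightarrow> ('a \<Rightarrow> 'a) \<times> (real \<Rightarrow> 'a) set" where
  "elt W f = orb_class X f
     (SOME p. path p \<and> path_image p \<subseteq> W \<and> pathstart p = x0 \<and> pathfinish p = f x0)"

lemma elt_eq:
  assumes "domain_at_base W" "path p" "path_image p \<subseteq> W" "pathstart p = x0" "pathfinish p = f x0"
  shows "elt W f = orb_class X f p"
proof -
  let ?P = "\<lambda>p. path p \<and> path_image p \<subseteq> W \<and> pathstart p = x0 \<and> pathfinish p = f x0"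
  define q where "q = (SOME p. ?P p)"
  have "?P q" unfolding q_def by (rule someI[of ?P p]) (use assms in auto)
  moreover have "simply_connected W" using assms(1) by (simp add: domain_at_base_def)
  ultimately have "homotopic_paths W q p"
    using assms(2-5) by (simp add: simply_connected_eq_homotopic_paths)
  then show ?thesis
    unfolding elt_def q_def[symmetric] using assms(1) homotopic_paths_subset
    by (intro orb_class_eqI) (auto simp: domain_at_base_def)
qed

lemma elt_path:
  assumes "domain_at_base W" "f x0 \<in> W"
  obtains p where "path p" "path_image p \<subseteq> W" "pathstart p = x0" "pathfinish p = f x0"
    "elt W f = orb_class X f p" "joins f p"
proof -
  have "path_connected W" using assms simply_connected_imp_path_connected
    by (auto simp: domain_at_base_def)
  then obtain p where p: "path p" "path_image p \<subseteq> W" "pathstart p = x0" "pathfinish p = f x0"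
    using assms unfolding path_connected_def domain_at_base_def by metis
  show thesis using that[OF p elt_eq[OF assms(1) p(1-3), of f, OF p(4)]] p assms(1)
    by (auto simp: joins_def domain_at_base_def)
qed

text \<open>A path inside \<open>W\<close> also serves in \<open>W'\<close>. This moves a factor to
  the domain in which a product is to be computed.\<close>

lemma elt_mono:
  assumes "domain_at_base W" "domain_at_base W'" "W \<subseteq> W'" "f x0 \<in> W"
  shows "elt W f = elt W' f"
  using elt_path[of W f] elt_eq[of W' _ f] assms by (metis subset_trans)

lemma elt_in: "domain_at_base W \<Longrightarrow> f \<in> G \<Longrightarrow> f x0 \<in> W \<Longrightarrow> elt W f \<in> carrier \<Omega>"
  by (metis elt_path orb_class_in)

lemma fst_elt [simp]: "fst (elt W f) = f"
  by (simp add: elt_def orb_class_def)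

text \<open>Because \<open>f\<close> maps \<open>W'\<close> into \<open>W\<close>, the translated
  second path stays in \<open>W\<close>. Products below thus reduce to an inclusion of regions and a
  composition of maps.\<close>

lemma elt_mult:
  assumes "domain_at_base W" "domain_at_base W'" "f \<in> G" "g \<in> G" "f x0 \<in> W" "g x0 \<in> W'"
    "f ` W' \<subseteq> W"
  shows "elt W f \<otimes>\<^bsub>\<Omega>\<^esub> elt W' g = elt W (f \<circ> g)"
proof -
  obtain p where p: "path p" "path_image p \<subseteq> W" "pathstart p = x0" "pathfinish p = f x0"
    "elt W f = orb_class X f p" "joins f p" using elt_path assms by blast
  obtain q where q: "path q" "path_image q \<subseteq> W'" "pathstart q = x0" "pathfinish q = g x0"
    "elt W' g = orb_class X g q" "joins g q" using elt_path assms by blast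
  have "elt W (f \<circ> g) = orb_class X (f \<circ> g) (p +++ (f \<circ> q))"
    using joins_mult[OF assms(3) p(6) q(6)] p(1-4) q(1-4) image_mono[OF q(2), of f] assms(7)
    by (intro elt_eq assms) (auto simp: joins_def path_image_join pathstart_compose path_image_compose)
  then show ?thesis using p q orb_class_mult[OF assms(3) p(6) q(6)] by simp
qed

lemma elt_id: "domain_at_base W \<Longrightarrow> elt W id = \<one>\<^bsub>\<Omega>\<^esub>"
  using elt_eq[of W "\<lambda>t. x0" id]
  by (auto simp: orb_pi1_def domain_at_base_def path_def path_image_def pathstart_def pathfinish_def)

end

section \<open>Affine maps preserving the integer points\<close>

definition affine_map :: "int \<Rightarrow> int \<Rightarrow> int \<Rightarrow> int \<Rightarrow> int \<Rightarrow> int \<Rightarrow> plane \<Rightarrow> plane" where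
  "affine_map a b c d i j = (\<lambda>(x, y). (of_int a * x + of_int b * y + of_int i,
                                       of_int c * x + of_int d * y + of_int j))"

lemma affine_map_apply [simp]:
  "affine_map a b c d i j (x, y) = (of_int a * x + of_int b * y + of_int i,
                                    of_int c * x + of_int d * y + of_int j)"
  by (simp add: affine_map_def)

text \<open>Both signs of the determinant are allowed: the lifts of Farey reflections and the swap
  of the coordinates reverse orientation.\<close>

definition Aff :: "(plane \<Rightarrow> plane) set" where
  "Aff = {affine_map a b c d i j | a b c d i j. \<bar>a * d - b * c\<bar> = 1}"

lemma affine_map_in_Aff: "\<bar>a * d - b * c\<bar> = 1 \<Longrightarrow> affine_map a b c d i j \<in> Aff"
  unfolding Aff_def by blast

lemma affine_map_comp:
  "affine_map a b c d i j \<circ> affine_map a' b' c' d' i' j' =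
     affine_map (a * a' + b * c') (a * b' + b * d') (c * a' + d * c') (c * b' + d * d')
       (a * i' + b * j' + i) (c * i' + d * j' + j)"
  by (auto simp: fun_eq_iff algebra_simps)

lemma affine_map_id: "affine_map 1 0 0 1 0 0 = id"
  by (auto simp: fun_eq_iff)

lemma affine_map_inverse:
  assumes "\<bar>a * d - b * c\<bar> = 1"
  shows "\<exists>g\<in>Aff. g \<circ> affine_map a b c d i j = id \<and> affine_map a b c d i j \<circ> g = id"
proof -
  define D where "D = a * d - b * c"
  \<comment> \<open>As \<open>D\<close> is 1 or -1, \<open>D\<close> times the adjugate is the
    inverse matrix.\<close>
  define g where "g = affine_map (D * d) (- (D * b)) (- (D * c)) (D * a)
                        (D * (b * j - d * i)) (D * (c * i - a * j))"
  have D: "D = 1 \<or> D = -1" using assms by (auto simp: D_def)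
  have "\<bar>(D * d) * (D * a) - (- (D * b)) * (- (D * c))\<bar> = 1"
    using D assms by (auto simp: algebra_simps)
  then have "g \<in> Aff" unfolding g_def by (rule affine_map_in_Aff)
  moreover have "D * (a * d) = 1 + D * (b * c)"
    using D by (auto simp: D_def)
  then have r: "real_of_int D * (real_of_int a * real_of_int d) =
      1 + real_of_int D * (real_of_int b * real_of_int c)"
    by (metis of_int_1 of_int_add of_int_mult)
  have "g \<circ> affine_map a b c d i j = id" "affine_map a b c d i j \<circ> g = id"
    using r by (auto simp: g_def fun_eq_iff) algebra+
  ultimately show ?thesis by blast
qed

lemma id_in_Aff: "id \<in> Aff"
  unfolding Aff_def affine_map_id[symmetric] by force

lemma comp_in_Aff:
  assumes "f \<in> Aff" "g \<in> Aff"
  shows "f \<circ> g \<in> Aff"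
proof -
  obtain a b c d i j where f: "f = affine_map a b c d i j" "\<bar>a * d - b * c\<bar> = 1"
    using assms by (auto simp: Aff_def)
  obtain a' b' c' d' i' j' where g: "g = affine_map a' b' c' d' i' j'" "\<bar>a' * d' - b' * c'\<bar> = 1"
    using assms by (auto simp: Aff_def)
  have "(a * a' + b * c') * (c * b' + d * d') - (a * b' + b * d') * (c * a' + d * c')
      = (a * d - b * c) * (a' * d' - b' * c')" by algebra
  then show ?thesis unfolding f g affine_map_comp
    using f(2) g(2) by (intro affine_map_in_Aff) (simp add: abs_mult)
qed

lemma continuous_on_Aff: "f \<in> Aff \<Longrightarrow> continuous_on S f"
  by (auto simp: Aff_def affine_map_def case_prod_unfold intro!: continuous_intros)

lemma Aff_maps_integer_points: "f \<in> Aff \<Longrightarrow> z \<in> integer_points \<Longrightarrow> f z \<in> integer_points"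
  by (auto simp: Aff_def integer_points_def)

lemma Aff_inverse: "f \<in> Aff \<Longrightarrow> \<exists>g\<in>Aff. g \<circ> f = id \<and> f \<circ> g = id"
  using affine_map_inverse by (auto simp: Aff_def)

lemma Aff_maps: "f \<in> Aff \<Longrightarrow> f ` punctured_plane \<subseteq> punctured_plane"
  using Aff_inverse[of f] Aff_maps_integer_points
  by (fastforce simp: punctured_plane_def fun_eq_iff)

lemma half_not_Ints: "(1 / 2 :: real) \<notin> \<int>"
proof
  assume "(1 / 2 :: real) \<in> \<int>"
  then obtain k :: int where "1 / 2 = real_of_int k" by (auto elim: Ints_cases)
  then have "(1 :: int) = 2 * k" by linarith
  then show False by presburger
qed

interpretation plane: orbit_loops punctured_plane Aff base
proof
  show "base \<in> punctured_plane"
    using half_not_Ints by (auto simp: punctured_plane_def integer_points_def base_def)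
qed (use id_in_Aff comp_in_Aff Aff_inverse continuous_on_Aff Aff_maps in auto)

abbreviation \<A> :: "loop monoid" where
  "\<A> \<equiv> orb_pi1 punctured_plane Aff base"

abbreviation translation :: "int \<Rightarrow> int \<Rightarrow> plane \<Rightarrow> plane" where
  "translation i j \<equiv> affine_map 1 0 0 1 i j"

abbreviation rotation :: "int \<Rightarrow> int \<Rightarrow> plane \<Rightarrow> plane" where
  "rotation i j \<equiv> affine_map (-1) 0 0 (-1) i j"

lemma half_turn_eq: "half_turn (of_int i / 2, of_int j / 2) = rotation i j"
  by (auto simp: half_turn_def fun_eq_iff)

lemma Aff_bij: "f \<in> Aff \<Longrightarrow> bij f"
  by (metis Aff_inverse o_bij)

lemma Aff_inv_eqI: "f \<in> Aff \<Longrightarrow> g \<circ> f = id \<Longrightarrow> inv_into UNIV f = g"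
  by (metis Aff_bij bij_is_surj inv_unique_comp surj_iff comp_id o_assoc id_comp)

text \<open>In \<open>generate\<close> only generators are inverted explicitly, so inverses are
  checked on \<open>S\<close> alone; on bijections the product of \<open>BijGroup UNIV\<close> is
  plain composition.\<close>

lemma generate_BijGroup_Aff:
  assumes "S \<subseteq> U" "U \<subseteq> Aff" "id \<in> U"
    and comp: "\<And>f g. f \<in> U \<Longrightarrow> g \<in> U \<Longrightarrow> f \<circ> g \<in> U"
    and invU: "\<And>f. f \<in> S \<Longrightarrow> inv_into UNIV f \<in> U"
  shows "generate (BijGroup UNIV) S \<subseteq> U"
proof
  have mult: "f \<otimes>\<^bsub>BijGroup UNIV\<^esub> g = f \<circ> g" if "f \<in> U" "g \<in> U" for f g
    using that assms(2) Aff_bij by (auto simp: BijGroup_def Bij_def restrict_def compose_def o_def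
        extensional_def)
  fix f assume "f \<in> generate (BijGroup UNIV) S"
  then show "f \<in> U"
  proof (induction rule: generate.induct)
    case one
    then show ?case using assms(3) by (simp add: BijGroup_def restrict_def id_def)
  next
    case (incl h)
    then show ?case using assms(1) by auto
  next
    case (inv h)
    then have "h \<in> Bij UNIV" using assms(1,2) Aff_bij by (auto simp: Bij_def extensional_def)
    then show ?case using inv_BijGroup[of h UNIV] invU[OF inv] by (simp add: restrict_def)
  next
    case (eng h1 h2)
    show ?case unfolding mult[OF eng.IH] by (rule comp[OF eng.IH])
  qed
qed

text \<open>The deck groups of \<open>O\<close> and \<open>S\<close> are the cases \<open>k = 1\<close> and \<open>k = 2\<close>.\<close>

definition signed_translations :: "int \<Rightarrow> (plane \<Rightarrow> plane) set" where
  "signed_translations k = {affine_map e 0 0 e (k * i) (k * j) | e i j. e = 1 \<or> e = -1}"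

lemma signed_translations_subset: "signed_translations k \<subseteq> Aff"
  by (auto simp: signed_translations_def intro!: affine_map_in_Aff)

lemma id_in_signed_translations: "id \<in> signed_translations k"
  unfolding signed_translations_def affine_map_id[symmetric] by force

lemma signed_translations_comp:
  "f \<in> signed_translations k \<Longrightarrow> g \<in> signed_translations k \<Longrightarrow> f \<circ> g \<in> signed_translations k"
proof -
  assume "f \<in> signed_translations k" "g \<in> signed_translations k"
  then obtain e i j e' i' j' where "f = affine_map e 0 0 e (k * i) (k * j)" "e = 1 \<or> e = -1"
    "g = affine_map e' 0 0 e' (k * i') (k * j')" "e' = 1 \<or> e' = -1"
    by (auto simp: signed_translations_def)
  moreover from this have "f \<circ> g = affine_map (e * e') 0 0 (e * e') (k * (e * i' + i)) (k * (e * j' + j))"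
    by (simp add: affine_map_comp algebra_simps)
  ultimately show ?thesis unfolding signed_translations_def by fastforce
qed

lemma inv_rotation: "inv_into UNIV (rotation i j) = rotation i j"
  by (rule Aff_inv_eqI) (auto simp: affine_map_comp affine_map_id intro!: affine_map_in_Aff)

lemma signed_translations_generated:
  assumes "range (\<lambda>(i, j). rotation (k * i) (k * j)) = S"
  shows "generate (BijGroup UNIV) S = signed_translations k"
proof
  have S: "S \<subseteq> signed_translations k"
    unfolding assms[symmetric] signed_translations_def by fastforce
  show "generate (BijGroup UNIV) S \<subseteq> signed_translations k"
    using S by (intro generate_BijGroup_Aff)
      (auto simp: signed_translations_comp id_in_signed_translations inv_rotation simp flip: assms
        intro: subsetD[OF signed_translations_subset])
  show "signed_translations k \<subseteq> generate (BijGroup UNIV) S"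
  proof
    fix f assume "f \<in> signed_translations k"
    then obtain e i j where f: "f = affine_map e 0 0 e (k * i) (k * j)" "e = 1 \<or> e = -1"
      by (auto simp: signed_translations_def)
    have R: "rotation (k * i) (k * j) \<in> S" for i j
      using assms by fastforce
    \<comment> \<open>The half-turn about the origin turns every other half-turn of \<open>S\<close>
      into a translation, which yields the maps with \<open>e = 1\<close>.\<close>
    have "rotation (k * i) (k * j) \<otimes>\<^bsub>BijGroup UNIV\<^esub> rotation (k * 0) (k * 0)
        = rotation (k * i) (k * j) \<circ> rotation (k * 0) (k * 0)"
      using Aff_bij[OF affine_map_in_Aff, of "-1" "-1" 0 0]
      by (simp add: BijGroup_def Bij_def extensional_def restrict_def compose_def fun_eq_iff)
    also have "\<dots> = translation (k * i) (k * j)" by (simp add: affine_map_comp)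
    finally have "translation (k * i) (k * j) \<in> generate (BijGroup UNIV) S"
      using generate.eng[OF generate.incl[OF R] generate.incl[OF R]] by metis
    then show "f \<in> generate (BijGroup UNIV) S"
      using f generate.incl[OF R] by fastforce
  qed
qed

lemma H_hat_group_eq: "H_hat_group = signed_translations 1"
proof -
  have "range (\<lambda>(i, j). rotation (1 * i) (1 * j)) = {half_turn c | c. 2 *\<^sub>R c \<in> integer_points}"
    (is "?L = ?R")
  proof
    have "2 *\<^sub>R (real_of_int i / 2, real_of_int j / 2) \<in> integer_points" for i j
      by (auto simp: integer_points_def)
    then show "?L \<subseteq> ?R" by (force simp flip: half_turn_eq)
    show "?R \<subseteq> ?L"
    proof clarify
      fix a b :: real assume "2 *\<^sub>R (a, b) \<in> integer_points"
      then obtain i j where "2 * a = of_int i" "2 * b = of_int j"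
        by (auto simp: integer_points_def elim!: Ints_cases)
      then have "half_turn (a, b) = rotation i j" by (auto simp: half_turn_def fun_eq_iff)
      then show "half_turn (a, b) \<in> ?L" by auto
    qed
  qed
  from signed_translations_generated[OF this] show ?thesis by (simp add: H_hat_group_def)
qed

lemma H_group_eq: "H_group = signed_translations 2"
proof -
  have "range (\<lambda>(i, j). rotation (2 * i) (2 * j)) = {half_turn c | c. c \<in> integer_points}"
    (is "?L = ?R")
  proof
    have *: "rotation (2 * i) (2 * j) = half_turn (of_int i, of_int j)" for i j
      by (auto simp: half_turn_def fun_eq_iff)
    show "?L \<subseteq> ?R" by (force simp: * integer_points_def)
    show "?R \<subseteq> ?L"
      using * by (force simp: integer_points_def elim!: Ints_cases)
  qed
  from signed_translations_generated[OF this] show ?thesis by (simp add: H_group_def)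
qed

lemma H_group_subset: "H_group \<subseteq> H_hat_group" "H_hat_group \<subseteq> Aff"
proof -
  show "H_group \<subseteq> H_hat_group"
    unfolding H_group_eq H_hat_group_eq signed_translations_def by fastforce
  show "H_hat_group \<subseteq> Aff" using signed_translations_subset by (simp add: H_hat_group_eq)
qed

section \<open>Line loops as conjugates of vertical loops\<close>

definition vertical_strip :: "plane set" where
  "vertical_strip = {z. 0 < fst z \<and> fst z < 1}"

lemma convex_vertical_strip: "convex vertical_strip"
proof -
  have "vertical_strip = fst -` {0<..<1}" by (auto simp: vertical_strip_def)
  then show ?thesis using convex_linear_vimage[OF linear_fst] by (metis convex_real_interval(8))
qed

lemma not_Ints_unit: "0 < x \<Longrightarrow> x < 1 \<Longrightarrow> (x :: real) \<notin> \<int>"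
  by (auto elim!: Ints_cases)

lemma vertical_strip_subset: "vertical_strip \<subseteq> punctured_plane"
  using not_Ints_unit by (auto simp: vertical_strip_def punctured_plane_def integer_points_def)

lemma domain_vertical_strip: "plane.domain_at_base vertical_strip"
  using vertical_strip_subset
  by (auto simp: plane.domain_at_base_def convex_imp_simply_connected convex_vertical_strip)
     (simp add: base_def vertical_strip_def)

definition lin :: "(plane \<Rightarrow> plane) \<Rightarrow> plane \<Rightarrow> plane" where
  "lin f v = f v - f 0"

lemma lin_affine_map: "lin (affine_map a b c d i j) (x, y) =
    (of_int a * x + of_int b * y, of_int c * x + of_int d * y)"
  by (simp add: lin_def zero_prod_def)

lemma Aff_add: "f \<in> Aff \<Longrightarrow> f (x + k *\<^sub>R v) = f x + k *\<^sub>R lin f v"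
  by (cases x; cases v) (auto simp: Aff_def lin_affine_map algebra_simps)

lemma lin_scaleR: "f \<in> Aff \<Longrightarrow> lin f (k *\<^sub>R v) = k *\<^sub>R lin f v"
  using Aff_add[of f 0 k v] by (simp add: lin_def)

lemma lin_minus: "f \<in> Aff \<Longrightarrow> lin f (- v) = - lin f v"
  using lin_scaleR[of f "-1" v] by simp

lemma lin_comp: "f \<in> Aff \<Longrightarrow> lin (f \<circ> g) v = lin f (lin g v)"
  using Aff_add[of f "g 0" 1 "g v - g 0"] by (simp add: lin_def)

lemma lin_id: "lin id v = v"
  by (simp add: lin_def)

text \<open>The two signs reflect that a line has two primitive vectors, of which
  \<open>slope_dir\<close> selects one.\<close>

definition carries :: "(plane \<Rightarrow> plane) \<Rightarrow> slope \<Rightarrow> slope \<Rightarrow> bool" where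
  "carries f s t \<longleftrightarrow> lin f (slope_dir s) = slope_dir t \<or> lin f (slope_dir s) = - slope_dir t"

lemma carries_comp: "f \<in> Aff \<Longrightarrow> carries g s t \<Longrightarrow> carries f t u \<Longrightarrow> carries (f \<circ> g) s u"
  by (auto simp: carries_def lin_comp lin_minus)

lemma carries_inverse: "g \<in> Aff \<Longrightarrow> g \<circ> f = id \<Longrightarrow> carries f s t \<Longrightarrow> carries g t s"
  unfolding carries_def by (metis lin_comp lin_id lin_minus minus_minus)

lemma slope_dir_infty: "slope_dir Slope_Infty = (0, 1)"
  by (simp add: slope_dir_def)

text \<open>\<open>vertical_loop 1\<close> is a based representative of
  \<open>\<beta>\<^sub>\<infinity>\<close>, and \<open>vertical_loop k\<close> is its k-th
  power.\<close>

definition vertical_loop :: "int \<Rightarrow> loop" where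
  "vertical_loop k = plane.elt vertical_strip (translation 0 k)"

lemma translation_vertical: "translation 0 k = (\<lambda>x. x + of_int k *\<^sub>R (0, 1))"
  by (auto simp: fun_eq_iff)

lemma vertical_segment:
  assumes "z \<in> vertical_strip"
  shows "path_image (linepath z (z + k *\<^sub>R (0, 1))) \<subseteq> vertical_strip"
proof -
  have "z + k *\<^sub>R (0, 1) \<in> vertical_strip" using assms by (simp add: vertical_strip_def)
  then show ?thesis using convex_vertical_strip assms by (simp add: closed_segment_subset)
qed

lemma base_in_strip: "base \<in> vertical_strip"
  by (simp add: base_def vertical_strip_def)

lemma vertical_loop_eq:
  "vertical_loop k = orb_class punctured_plane (translation 0 k)
     (linepath base (base + of_int k *\<^sub>R (0, 1)))"
  unfolding vertical_loop_def
  by (intro plane.elt_eq domain_vertical_strip vertical_segment base_in_strip)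
     (auto simp: translation_vertical)

lemma Aff_linepath: "f \<in> Aff \<Longrightarrow> f \<circ> linepath x (x + v) = linepath (f x) (f x + lin f v)"
proof
  fix t assume f: "f \<in> Aff"
  have "linepath x (x + v) t = x + t *\<^sub>R v" by (simp add: linepath_def algebra_simps)
  then show "(f \<circ> linepath x (x + v)) t = linepath (f x) (f x + lin f v) t"
    using Aff_add[OF f] by (simp add: linepath_def algebra_simps)
qed

lemma pathfinish_shift: "pathfinish (\<lambda>t. p t + w) = pathfinish p + w"
  by (simp add: pathfinish_def)

text \<open>The conjugate goes along \<open>\<gamma>\<close> to \<open>f base\<close>, follows the
  \<open>f\<close>-image of the vertical segment and returns along the shifted
  \<open>\<gamma>\<close>, because conjugation by \<open>f\<close> turns the vertical translation
  into the translation by \<open>w\<close>.\<close>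

lemma vertical_loop_conj:
  fixes k :: int
  assumes f: "f \<in> Aff" "plane.joins f \<gamma>"
  defines "w \<equiv> of_int k *\<^sub>R lin f (0, 1)" and "h \<equiv> orb_class punctured_plane f \<gamma>"
  shows "h \<otimes>\<^bsub>\<A>\<^esub> vertical_loop k \<otimes>\<^bsub>\<A>\<^esub> inv\<^bsub>\<A>\<^esub> h =
    orb_class punctured_plane (\<lambda>x. x + w)
      (\<gamma> +++ linepath (f base) (f base + w) +++ reversepath (\<lambda>t. \<gamma> t + w))"
proof -
  let ?T = "translation 0 k" and ?p = "linepath base (base + of_int k *\<^sub>R (0, 1))"
  obtain g where g: "g \<in> Aff" "g \<circ> f = id" "f \<circ> g = id" using Aff_inverse[OF f(1)] by blast
  have T: "?T \<in> Aff" by (rule affine_map_in_Aff) simp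
  have jT: "plane.joins ?T ?p"
    using vertical_segment[OF base_in_strip, of "of_int k"] vertical_strip_subset
    unfolding plane.joins_def by (auto simp: translation_vertical)
  note j1 = plane.joins_mult[OF f jT]
  note j2 = plane.orb_class_inverse(1)[OF f g(1,2)]
  have fT: "f \<circ> ?T = (\<lambda>x. f x + w)"
    unfolding translation_vertical w_def using Aff_add[OF f(1)] by (simp only: o_def)
  then have fTg: "f \<circ> ?T \<circ> g = (\<lambda>x. x + w)"
    using g(3) by (metis (no_types, lifting) comp_apply fun_eq_iff id_apply)
  have tail: "(f \<circ> ?T) \<circ> (g \<circ> reversepath \<gamma>) = reversepath (\<lambda>t. \<gamma> t + w)"
    using fun_cong[OF fTg] by (simp add: fun_eq_iff reversepath_def)
  have fp: "f \<circ> ?p = linepath (f base) (f base + w)"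
    unfolding Aff_linepath[OF f(1)] lin_scaleR[OF f(1)] w_def ..
  have "h \<otimes>\<^bsub>\<A>\<^esub> vertical_loop k \<otimes>\<^bsub>\<A>\<^esub> inv\<^bsub>\<A>\<^esub> h =
      orb_class punctured_plane (f \<circ> ?T \<circ> g)
        ((\<gamma> +++ (f \<circ> ?p)) +++ ((f \<circ> ?T) \<circ> (g \<circ> reversepath \<gamma>)))"
    unfolding h_def vertical_loop_eq plane.orb_class_mult[OF f jT]
      plane.orb_class_inv[OF f g(1,2)]
    by (rule plane.orb_class_mult[OF comp_in_Aff[OF f(1) T] j1 j2])
  also have "\<dots> = orb_class punctured_plane (\<lambda>x. x + w)
      (\<gamma> +++ (f \<circ> ?p) +++ ((f \<circ> ?T) \<circ> (g \<circ> reversepath \<gamma>)))"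
  proof (rule orb_class_eqI[OF fTg], rule homotopic_paths_sym, rule homotopic_paths_assoc)
    show "path (f \<circ> ?p)" "path_image (f \<circ> ?p) \<subseteq> punctured_plane"
      using jT plane.path_translate[OF f(1), of ?p] unfolding plane.joins_def by blast+
    show "path ((f \<circ> ?T) \<circ> (g \<circ> reversepath \<gamma>))"
      "path_image ((f \<circ> ?T) \<circ> (g \<circ> reversepath \<gamma>)) \<subseteq> punctured_plane"
      using j2 plane.path_translate[OF comp_in_Aff[OF f(1) T]] by (auto simp: plane.joins_def)
    show "pathfinish (f \<circ> ?p) = pathstart ((f \<circ> ?T) \<circ> (g \<circ> reversepath \<gamma>))"
      unfolding tail fp using f(2) by (simp add: pathfinish_shift plane.joins_def)
  qed (use f(2) in \<open>auto simp: plane.joins_def pathstart_compose\<close>)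
  finally show ?thesis unfolding fp tail .
qed

text \<open>Serves to replace the segment of a line loop by another one, reached through detours
  \<open>e\<close> and \<open>e'\<close> that are absorbed into the connecting paths.\<close>

lemma homotopic_paths_insert:
  assumes "homotopic_paths S l (e +++ m +++ e')" "path d" "path_image d \<subseteq> S"
    "path e" "path_image e \<subseteq> S" "path m" "path_image m \<subseteq> S" "path e'" "path_image e' \<subseteq> S"
    "path r" "path_image r \<subseteq> S" "pathfinish d = pathstart e" "pathfinish e = pathstart m"
    "pathfinish m = pathstart e'" "pathfinish e' = pathstart r"
  shows "homotopic_paths S (d +++ l +++ r) ((d +++ e) +++ m +++ (e' +++ r))"
proof -
  have l: "pathstart l = pathstart e" "pathfinish l = pathfinish e'"
    using homotopic_paths_imp_pathstart[OF assms(1)] homotopic_paths_imp_pathfinish[OF assms(1)]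
    by auto
  have "homotopic_paths S (l +++ r) ((e +++ m +++ e') +++ r)"
    using assms l by (intro homotopic_paths_join) auto
  also have "homotopic_paths S \<dots> (e +++ ((m +++ e') +++ r))"
    using assms by (intro homotopic_paths_sym[OF homotopic_paths_assoc])
      (auto simp: path_image_join)
  also (homotopic_paths_trans) have "homotopic_paths S (e +++ ((m +++ e') +++ r)) (e +++ (m +++ (e' +++ r)))"
    using assms by (intro homotopic_paths_join homotopic_paths_sym[OF homotopic_paths_assoc])
      (auto simp: path_image_join)
  finally (homotopic_paths_trans) have lr: "homotopic_paths S (l +++ r) (e +++ (m +++ (e' +++ r)))" .
  have "homotopic_paths S (d +++ l +++ r) (d +++ (e +++ (m +++ (e' +++ r))))"
    using assms l by (intro homotopic_paths_join[OF _ lr]) auto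
  moreover have "homotopic_paths S (d +++ (e +++ (m +++ (e' +++ r)))) ((d +++ e) +++ m +++ (e' +++ r))"
    using assms by (intro homotopic_paths_assoc) (auto simp: path_image_join)
  ultimately show ?thesis by (rule homotopic_paths_trans)
qed

lemma coprime_slope_vec: "slope_vec s = (p, q) \<Longrightarrow> coprime p q"
proof (cases s)
  case (Slope x)
  assume "slope_vec s = (p, q)"
  then have "quotient_of x = (q, p)" using Slope by (auto split: prod.splits)
  then show ?thesis using quotient_of_coprime coprime_commute by blast
qed auto

text \<open>By Bezout a primitive vector is the second column of a unimodular matrix, that is, the
  image of (0, 1).\<close>

lemma Aff_carrying_infty:
  assumes "coprime p q"
  obtains a c where "affine_map a p c q 0 0 \<in> Aff"
proof -
  obtain u v where "u * q + v * p = gcd q p" using bezout_int by blast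
  then have "u * q - p * (- v) = 1" using assms by (simp add: coprime_commute algebra_simps)
  then have "affine_map u p (- v) q 0 0 \<in> Aff" by (intro affine_map_in_Aff) simp
  then show thesis by (rule that)
qed

text \<open>From right to left this is \<open>vertical_loop_conj\<close>. Conversely a unimodular
  map and an integer translation pull the line back to a vertical line in the strip, where the
  segment can be slid to the one through \<open>base\<close>.\<close>

lemma line_loops_eq:
  "line_loops (of_int k) s = {h \<otimes>\<^bsub>\<A>\<^esub> vertical_loop k \<otimes>\<^bsub>\<A>\<^esub> inv\<^bsub>\<A>\<^esub> h | h.
     h \<in> carrier \<A> \<and> carries (fst h) Slope_Infty s}" (is "?L = ?R")
proof
  show "?R \<subseteq> ?L"
  proof
    fix x assume "x \<in> ?R"
    then obtain f \<gamma> where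
      x: "x = orb_class punctured_plane f \<gamma> \<otimes>\<^bsub>\<A>\<^esub> vertical_loop k \<otimes>\<^bsub>\<A>\<^esub> inv\<^bsub>\<A>\<^esub> orb_class punctured_plane f \<gamma>"
      and c: "carries f Slope_Infty s" and h: "f \<in> Aff" "plane.joins f \<gamma>"
      by (auto simp: plane.carrier_orb_pi1 orb_class_def)
    define v where "v = lin f (0, 1)"
    have "f base + t *\<^sub>R v \<in> punctured_plane" for t
    proof -
      have "base + t *\<^sub>R (0, 1) \<in> punctured_plane"
        using vertical_strip_subset by (auto simp: base_def vertical_strip_def)
      then have "f (base + t *\<^sub>R (0, 1)) \<in> punctured_plane" using Aff_maps[OF h(1)] by blast
      then show ?thesis unfolding Aff_add[OF h(1)] v_def .
    qed
    moreover have "v = slope_dir s \<or> v = - slope_dir s"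
      using c by (simp add: carries_def slope_dir_infty v_def)
    ultimately show "x \<in> ?L"
      unfolding x vertical_loop_conj[OF h] v_def[symmetric] line_loops_def
      using h(2) unfolding plane.joins_def by blast
  qed
  show "?L \<subseteq> ?R"
  proof
    fix x assume "x \<in> ?L"
    then obtain v y \<delta> where x: "x = orb_class punctured_plane (\<lambda>x. x + of_int k *\<^sub>R v)
          (\<delta> +++ linepath y (y + of_int k *\<^sub>R v) +++ reversepath (\<lambda>t. \<delta> t + of_int k *\<^sub>R v))"
      and v: "v = slope_dir s \<or> v = - slope_dir s"
      and y: "\<And>t. y + t *\<^sub>R v \<in> punctured_plane"
      and \<delta>: "path \<delta>" "path_image \<delta> \<subseteq> punctured_plane" "pathstart \<delta> = base" "pathfinish \<delta> = y"
      unfolding line_loops_def by blast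
    obtain p q where pq: "slope_vec s = (p, q)" by fastforce
    have "slope_dir s = (of_int p, of_int q)" by (simp add: slope_dir_def pq)
    then obtain p' q' where v': "v = (of_int p', of_int q')" "coprime p' q'"
    proof (cases "v = slope_dir s")
      case False
      then show ?thesis using that[of "-p" "-q"] v coprime_slope_vec[OF pq]
        by (simp add: slope_dir_def pq)
    qed (use that coprime_slope_vec[OF pq] in auto)
    from Aff_carrying_infty[OF v'(2)] obtain a c where A: "affine_map a p' c q' 0 0 \<in> Aff" .
    define A' where "A' = affine_map a p' c q' 0 0"
    have linA: "lin A' (0, 1) = v" by (simp add: A'_def lin_affine_map v')
    obtain B where B: "B \<in> Aff" "B \<circ> A' = id" "A' \<circ> B = id"
      using Aff_inverse[OF A] by (auto simp: A'_def)
    have AB: "A' (B z) = z" for z using B(3) by (metis comp_apply id_apply)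
    \<comment> \<open>Otherwise an integer point would lie on the vertical line through
      \<open>B y\<close>, and its image under \<open>A'\<close> on the given line.\<close>
    have "fst (B y) \<notin> \<int>"
    proof
      assume I: "fst (B y) \<in> \<int>"
      have "A' (B y + (- snd (B y)) *\<^sub>R (0, 1)) = y + (- snd (B y)) *\<^sub>R v"
        using Aff_add[OF A[folded A'_def]] linA AB by metis
      moreover have "B y + (- snd (B y)) *\<^sub>R (0, 1) \<in> integer_points"
        using I by (cases "B y") (auto simp: integer_points_def)
      ultimately show False
        using y Aff_maps_integer_points[OF A[folded A'_def]] by (metis ComplD punctured_plane_def)
    qed
    define i where "i = \<lfloor>fst (B y)\<rfloor>"
    define f where "f = A' \<circ> translation i 0"
    define z where "z = B y - (of_int i, 0)"
    have T: "translation i 0 \<in> Aff" by (rule affine_map_in_Aff) simp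
    have f: "f \<in> Aff" unfolding f_def by (rule comp_in_Aff[OF A[folded A'_def] T])
    have "translation i 0 z = B y" by (cases "B y") (simp add: z_def)
    then have fz: "f z = y" by (simp add: f_def AB)
    have z: "z \<in> vertical_strip"
    proof -
      have "of_int i \<noteq> fst (B y)" using \<open>fst (B y) \<notin> \<int>\<close> by (metis Ints_of_int)
      then have "of_int i < fst (B y)" "fst (B y) < of_int i + 1"
        unfolding i_def by linarith+
      then show ?thesis by (simp add: z_def vertical_strip_def)
    qed
    have linf: "lin f (0, 1) = v"
      using lin_comp[OF A[folded A'_def]] linA by (simp add: f_def lin_affine_map)
    define w where "w = of_int k *\<^sub>R v"
    let ?u = "of_int k *\<^sub>R (0, 1) :: plane"
    have fl: "f \<circ> linepath p q = linepath (f p) (f q)" for p q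
      using Aff_linepath[OF f, of p "q - p"] Aff_add[OF f, of p 1 "q - p"] by simp
    have fu: "f (p + ?u) = f p + w" for p
      unfolding Aff_add[OF f] linf w_def ..
    have seg: "path_image (linepath p q) \<subseteq> vertical_strip"
      if "p \<in> vertical_strip" "q \<in> vertical_strip" for p q
      using that convex_vertical_strip by (simp add: closed_segment_subset)
    have u: "p + ?u \<in> vertical_strip" if "p \<in> vertical_strip" for p
      using that by (simp add: vertical_strip_def)
    note in_strip = z base_in_strip u[OF z] u[OF base_in_strip]
    have segX: "path_image (linepath (f p) (f q)) \<subseteq> punctured_plane"
      if "p \<in> vertical_strip" "q \<in> vertical_strip" for p q
      using plane.path_translate(2)[OF f, of "linepath p q"] seg[OF that] vertical_strip_subset
      unfolding fl by auto
    \<comment> \<open>The strip is simply connected, so the segment from \<open>z\<close> can be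
      replaced by the one from \<open>base\<close> with detours at both ends; \<open>f\<close>
      carries the homotopy to the punctured plane.\<close>
    have "homotopic_paths vertical_strip (linepath z (z + ?u))
        (linepath z base +++ linepath base (base + ?u) +++ linepath (base + ?u) (z + ?u))"
      using domain_vertical_strip seg in_strip
      unfolding plane.domain_at_base_def simply_connected_eq_homotopic_paths
      by (simp add: subset_path_image_join)
    then have "homotopic_paths punctured_plane (f \<circ> linepath z (z + ?u))
        (f \<circ> (linepath z base +++ linepath base (base + ?u) +++ linepath (base + ?u) (z + ?u)))"
      using vertical_strip_subset Aff_maps[OF f] continuous_on_Aff[OF f]
      by (intro homotopic_paths_continuous_image) (auto intro: homotopic_paths_subset)
    then have "homotopic_paths punctured_plane (linepath y (y + w)) (linepath y (f base)
        +++ linepath (f base) (f base + w) +++ linepath (f base + w) (y + w))"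
      by (simp only: path_compose_join fl fu fz)
    then have "homotopic_paths punctured_plane
       (\<delta> +++ linepath y (y + w) +++ reversepath (\<lambda>t. \<delta> t + w))
       ((\<delta> +++ linepath y (f base)) +++ linepath (f base) (f base + w)
          +++ (linepath (f base + w) (y + w) +++ reversepath (\<lambda>t. \<delta> t + w)))"
    proof (rule homotopic_paths_insert)
      have Tw: "(\<lambda>x. x + w) = affine_map 1 0 0 1 (k * p') (k * q')"
        by (auto simp: fun_eq_iff w_def v')
      have "(\<lambda>x. x + w) \<in> Aff" unfolding Tw by (rule affine_map_in_Aff) simp
      from plane.path_translate[OF this \<delta>(1,2)]
      show "path (reversepath (\<lambda>t. \<delta> t + w))"
        "path_image (reversepath (\<lambda>t. \<delta> t + w)) \<subseteq> punctured_plane"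
        by (simp_all add: o_def)
      show "path_image (linepath (f base) (f base + w)) \<subseteq> punctured_plane"
        "path_image (linepath y (f base)) \<subseteq> punctured_plane"
        "path_image (linepath (f base + w) (y + w)) \<subseteq> punctured_plane"
        using segX in_strip fu fz by metis+
    qed (use \<delta> in \<open>auto simp: pathfinish_shift\<close>)
    \<comment> \<open>The returning part is the shifted reverse of the new connecting path, so the
      loop has the form found in \<open>vertical_loop_conj\<close>.\<close>
    also have "linepath (f base + w) (y + w) +++ reversepath (\<lambda>t. \<delta> t + w)
        = reversepath (\<lambda>t. (\<delta> +++ linepath y (f base)) t + w)"
    proof -
      have "(\<lambda>t. (\<delta> +++ linepath y (f base)) t + w)
          = (\<lambda>t. \<delta> t + w) +++ linepath (y + w) (f base + w)"
        by (auto simp: joinpaths_def linepath_def algebra_simps)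
      then show ?thesis
        using \<delta>(4) by (simp add: reversepath_joinpaths pathfinish_def)
    qed
    finally have eq: "x = orb_class punctured_plane f (\<delta> +++ linepath y (f base))
        \<otimes>\<^bsub>\<A>\<^esub> vertical_loop k \<otimes>\<^bsub>\<A>\<^esub> inv\<^bsub>\<A>\<^esub> orb_class punctured_plane f (\<delta> +++ linepath y (f base))"
      if "plane.joins f (\<delta> +++ linepath y (f base))"
      unfolding vertical_loop_conj[OF f that] linf x w_def by (intro orb_class_eqI refl)
    have j: "plane.joins f (\<delta> +++ linepath y (f base))"
      using \<delta> segX[OF z base_in_strip] by (simp add: plane.joins_def fz subset_path_image_join)
    have "carries (fst (orb_class punctured_plane f (\<delta> +++ linepath y (f base)))) Slope_Infty s"
      using v by (auto simp: orb_class_def carries_def slope_dir_infty linf)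
    then show "x \<in> ?R" using eq[OF j] plane.orb_class_in[OF f j] by blast
  qed
qed

section \<open>Half-turns, shears and the swap of the coordinates\<close>

lemma domain_image:
  assumes f: "f \<in> Aff" and W: "simply_connected W" "W \<subseteq> punctured_plane" "base \<in> f ` W"
  shows "plane.domain_at_base (f ` W)"
proof -
  obtain g where g: "g \<in> Aff" "g \<circ> f = id" using Aff_inverse[OF f] by blast
  then have gf: "g (f z) = z" for z by (metis comp_apply id_apply)
  have "homeomorphism W (f ` W) f g"
    using gf by (auto simp: homeomorphism_def continuous_on_Aff f g image_image)
  then have "simply_connected (f ` W)"
    using W(1) homeomorphic_simply_connected homeomorphic_def by blast
  then show ?thesis using W Aff_maps[OF f] by (auto simp: plane.domain_at_base_def)
qed

text \<open>The punctures on the line \<open>x = 0\<close> are avoided by crossing it only between \<open>(0, 0)\<close> and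
  \<open>(0, 1)\<close>.\<close>

definition slit_strip :: "plane set" where
  "slit_strip = {z. \<bar>fst z\<bar> < 1 \<and> (fst z = 0 \<longrightarrow> 0 < snd z \<and> snd z < 1)}"

text \<open>The set is starlike about the middle of the gap: a segment from there to a point off the
  line x = 0 leaves that line at once, and one within the line stays in the gap.\<close>

lemma simply_connected_slit_strip: "simply_connected slit_strip"
proof (rule starlike_imp_simply_connected)
  have "closed_segment (0, 1/2) z \<subseteq> slit_strip" if "z \<in> slit_strip" for z
  proof
    fix y assume "y \<in> closed_segment (0, 1/2) z"
    then obtain t where t: "0 \<le> t" "t \<le> 1" "y = (1 - t) *\<^sub>R (0, 1/2) + t *\<^sub>R z"
      by (auto simp: in_segment)
    obtain a b where z: "z = (a, b)" by fastforce
    have ab: "\<bar>a\<bar> < 1" "a = 0 \<Longrightarrow> 0 < b \<and> b < 1" using that by (auto simp: slit_strip_def z)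
    have "\<bar>t * a\<bar> \<le> \<bar>a\<bar>" using t by (simp add: abs_mult mult_left_le_one_le)
    then have "\<bar>t * a\<bar> < 1" using ab by linarith
    moreover have "0 < (1 - t) / 2 + t * b \<and> (1 - t) / 2 + t * b < 1" if "t * a = 0"
    proof (cases "t = 0")
      case False
      then have "0 < b" "b < 1" using that ab by auto
      then have "0 < t * b" "t * b < t" using False t by auto
      then show ?thesis using t by (auto simp: field_simps)
    qed simp
    ultimately show "y \<in> slit_strip" unfolding t(3) slit_strip_def z by simp
  qed
  moreover have "(0, 1/2) \<in> slit_strip" by (simp add: slit_strip_def)
  ultimately show "starlike slit_strip" unfolding starlike_def by blast
qed

lemma slit_strip_subset: "slit_strip \<subseteq> punctured_plane"
proof clarify
  fix x y :: real assume s: "(x, y) \<in> slit_strip"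
  show "(x, y) \<in> punctured_plane"
  proof (rule ccontr)
    assume "(x, y) \<notin> punctured_plane"
    then obtain i j :: int where "x = of_int i" "y = of_int j"
      by (auto simp: punctured_plane_def integer_points_def elim!: Ints_cases)
    then show False using s by (auto simp: slit_strip_def)
  qed
qed

lemma domain_slit_strip: "plane.domain_at_base slit_strip"
  using simply_connected_slit_strip slit_strip_subset
  by (auto simp: plane.domain_at_base_def) (simp add: base_def slit_strip_def)

lemma vertical_in_slit_strip: "vertical_strip \<subseteq> slit_strip"
  by (auto simp: vertical_strip_def slit_strip_def)

section \<open>Elements given by maps that preserve the vertical strip\<close>

definition strip_maps :: "(plane \<Rightarrow> plane) set" where
  "strip_maps = {affine_map 1 0 c e 0 j | c e j. \<bar>e\<bar> = 1} \<union> {affine_map (-1) 0 c e 1 j | c e j. \<bar>e\<bar> = 1}"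

lemma strip_maps_Aff: "f \<in> strip_maps \<Longrightarrow> f \<in> Aff"
  by (auto simp: strip_maps_def intro!: affine_map_in_Aff)

lemma strip_maps_preserve: "f \<in> strip_maps \<Longrightarrow> z \<in> vertical_strip \<Longrightarrow> f z \<in> vertical_strip"
  by (cases z) (auto simp: strip_maps_def vertical_strip_def)

definition strip_elt :: "(plane \<Rightarrow> plane) \<Rightarrow> loop" where
  "strip_elt f = plane.elt vertical_strip f"

lemma fst_strip_elt [simp]: "fst (strip_elt f) = f"
  by (simp add: strip_elt_def)

lemma strip_elt_in: "f \<in> strip_maps \<Longrightarrow> strip_elt f \<in> carrier \<A>"
  unfolding strip_elt_def
  by (simp add: plane.elt_in domain_vertical_strip strip_maps_Aff strip_maps_preserve base_in_strip)

lemma strip_elt_mult: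
  "f \<in> strip_maps \<Longrightarrow> g \<in> strip_maps \<Longrightarrow> strip_elt f \<otimes>\<^bsub>\<A>\<^esub> strip_elt g = strip_elt (f \<circ> g)"
  unfolding strip_elt_def
  by (intro plane.elt_mult domain_vertical_strip)
     (auto simp: strip_maps_Aff strip_maps_preserve base_in_strip)

lemma strip_elt_id: "strip_elt (translation 0 0) = \<one>\<^bsub>\<A>\<^esub>"
  unfolding strip_elt_def affine_map_id by (rule plane.elt_id[OF domain_vertical_strip])

text \<open>A loop of order two around the cone point (1/2, j/2).\<close>

definition turn :: "int \<Rightarrow> loop" where
  "turn j = strip_elt (rotation 1 j)"

text \<open>The half-turn about (0, 1/2). It does not preserve the vertical strip, so its path runs
  through the gap of the slit strip.\<close>

definition side_turn :: loop where
  "side_turn = plane.elt slit_strip (rotation 0 1)"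

lemma strip_mapsI:
  "\<bar>e\<bar> = 1 \<Longrightarrow> affine_map 1 0 c e 0 j \<in> strip_maps"
  "\<bar>e\<bar> = 1 \<Longrightarrow> affine_map (-1) 0 c e 1 j \<in> strip_maps"
  unfolding strip_maps_def by blast+

lemma vertical_loop_strip: "vertical_loop k = strip_elt (translation 0 k)"
  by (simp add: vertical_loop_def strip_elt_def)

lemma vertical_loop_in: "vertical_loop k \<in> carrier \<A>"
  by (simp add: vertical_loop_strip strip_elt_in strip_mapsI)

lemma turn_in: "turn j \<in> carrier \<A>"
  by (simp add: turn_def strip_elt_in strip_mapsI)

lemma rotation_slit_strip: "z \<in> slit_strip \<Longrightarrow> rotation 0 1 z \<in> slit_strip"
  by (cases z) (auto simp: slit_strip_def)

lemma rotation_Aff: "rotation i j \<in> Aff"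
  by (rule affine_map_in_Aff) simp

lemma base_in_slit_strip: "base \<in> slit_strip"
  using base_in_strip vertical_in_slit_strip by blast

lemma side_turn_in: "side_turn \<in> carrier \<A>"
  unfolding side_turn_def
  by (intro plane.elt_in domain_slit_strip rotation_Aff rotation_slit_strip base_in_slit_strip)

lemma vertical_loop_add: "vertical_loop (i + j) = vertical_loop i \<otimes>\<^bsub>\<A>\<^esub> vertical_loop j"
  by (simp add: vertical_loop_strip strip_elt_mult strip_mapsI affine_map_comp add.commute)

lemma vertical_loop_0: "vertical_loop 0 = \<one>\<^bsub>\<A>\<^esub>"
  by (simp add: vertical_loop_strip strip_elt_id)

lemma vertical_loop_minus: "vertical_loop (- i) = inv\<^bsub>\<A>\<^esub> vertical_loop i"
  using vertical_loop_add[of "-i" i]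
  by (metis add.left_inverse plane.loops.inv_equality vertical_loop_0 vertical_loop_in)

lemma vertical_loop_pow: "vertical_loop i [^]\<^bsub>\<A>\<^esub> (n :: nat) = vertical_loop (i * int n)"
proof (induction n)
  case (Suc n)
  have "i * int (Suc n) = i * int n + i" by (simp add: algebra_simps)
  then show ?case unfolding plane.loops.nat_pow_Suc Suc by (simp only: vertical_loop_add)
qed (simp add: vertical_loop_0)

lemma vertical_loop_turn: "vertical_loop i \<otimes>\<^bsub>\<A>\<^esub> turn j = turn (i + j)"
  by (simp add: vertical_loop_strip turn_def strip_elt_mult strip_mapsI affine_map_comp add.commute)

lemma turn_turn: "turn i \<otimes>\<^bsub>\<A>\<^esub> turn j = vertical_loop (i - j)"
  by (simp add: vertical_loop_strip turn_def strip_elt_mult strip_mapsI affine_map_comp)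

text \<open>Conjugating a half-turn gives the half-turn about the image of its centre, and (1/2,
  j/2) goes to the point of height \<open>(c + e * j + 2 * i) / 2\<close> on the same vertical
  line.\<close>

lemma strip_elt_turn:
  assumes "\<bar>e\<bar> = 1"
  shows "strip_elt (affine_map 1 0 c e 0 i) \<otimes>\<^bsub>\<A>\<^esub> turn j
    = turn (c + e * j + 2 * i) \<otimes>\<^bsub>\<A>\<^esub> strip_elt (affine_map 1 0 c e 0 i)"
  using assms by (simp add: turn_def strip_elt_mult strip_mapsI affine_map_comp algebra_simps)

lemma strip_elt_vertical_loop:
  assumes "\<bar>e\<bar> = 1"
  shows "strip_elt (affine_map 1 0 c e 0 i) \<otimes>\<^bsub>\<A>\<^esub> vertical_loop k
    = vertical_loop (e * k) \<otimes>\<^bsub>\<A>\<^esub> strip_elt (affine_map 1 0 c e 0 i)"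
  using assms by (simp add: vertical_loop_strip strip_elt_mult strip_mapsI affine_map_comp add.commute)

text \<open>In these two cases the map fixes the centre \<open>(0, 1/2)\<close> of the half-turn.\<close>

lemma strip_elt_side_turn:
  assumes "i = 0 \<and> e = 1 \<or> i = 1 \<and> e = -1"
  shows "strip_elt (affine_map 1 0 c e 0 i) \<otimes>\<^bsub>\<A>\<^esub> side_turn
    = side_turn \<otimes>\<^bsub>\<A>\<^esub> strip_elt (affine_map 1 0 c e 0 i)"
proof -
  let ?f = "affine_map 1 0 c e 0 i"
  have f: "?f \<in> strip_maps" using assms by (intro strip_mapsI) auto
  have "strip_elt ?f = plane.elt slit_strip ?f"
    unfolding strip_elt_def
    by (rule plane.elt_mono[OF domain_vertical_strip domain_slit_strip vertical_in_slit_strip])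
      (rule strip_maps_preserve[OF f base_in_strip])
  \<comment> \<open>On the line x = 0 the map sends y to y or to 1 - y, so it preserves the
    gap.\<close>
  moreover have "?f z \<in> slit_strip" if "z \<in> slit_strip" for z
    using that assms by (cases z) (auto simp: slit_strip_def)
  moreover have "?f \<circ> rotation 0 1 = rotation 0 1 \<circ> ?f"
    using assms by (auto simp: affine_map_comp)
  ultimately show ?thesis
    unfolding side_turn_def using rotation_slit_strip
    by (auto simp: plane.elt_mult domain_slit_strip base_in_slit_strip image_subset_iff
        strip_maps_Aff[OF f] rotation_Aff)
qed

section \<open>The swap of the two coordinates\<close>

definition swap_map :: "plane \<Rightarrow> plane" where "swap_map = affine_map 0 1 1 0 0 0"

definition swap_elt :: loop where "swap_elt = plane.elt slit_strip swap_map"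

lemma swap_map_apply: "swap_map (x, y) = (y, x)"
  by (simp add: swap_map_def)

lemma swap_Aff: "swap_map \<in> Aff"
  unfolding swap_map_def by (rule affine_map_in_Aff) simp

lemma swap_swap: "swap_map \<circ> swap_map = id"
  by (simp add: swap_map_def affine_map_comp affine_map_id)

definition unit_square :: "plane set" where
  "unit_square = {z. 0 < fst z \<and> fst z < 1 \<and> 0 < snd z \<and> snd z < 1}"

lemma domain_unit_square: "plane.domain_at_base unit_square"
proof -
  have "unit_square = {0<..<1} \<times> {0<..<1}" by (auto simp: unit_square_def)
  then have "convex unit_square" by (metis convex_Times convex_real_interval(8))
  moreover have "unit_square \<subseteq> slit_strip" by (auto simp: unit_square_def slit_strip_def)
  ultimately show ?thesis using slit_strip_subset
    by (auto simp: plane.domain_at_base_def convex_imp_simply_connected)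
       (simp add: base_def unit_square_def)
qed

lemma domain_swapped: "plane.domain_at_base (swap_map ` slit_strip)"
proof (rule domain_image[OF swap_Aff simply_connected_slit_strip slit_strip_subset])
  have "base = swap_map (1/4, 1/2)" "(1/4, 1/2) \<in> slit_strip"
    by (auto simp: base_def swap_map_apply slit_strip_def)
  then show "base \<in> swap_map ` slit_strip" by blast
qed

lemma swap_base_in: "swap_map base \<in> unit_square"
  by (simp add: base_def swap_map_apply unit_square_def)

text \<open>All three regions contain the unit square, which contains \<open>base\<close> and its
  swap. Different products with \<open>swap_elt\<close> need different regions.\<close>

lemma swap_elt_eq:
  "swap_elt = plane.elt unit_square swap_map"
  "swap_elt = plane.elt (swap_map ` slit_strip) swap_map"
proof -
  have "unit_square \<subseteq> slit_strip" by (auto simp: unit_square_def slit_strip_def)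
  moreover have "unit_square \<subseteq> swap_map ` unit_square"
    by (auto simp: unit_square_def swap_map_apply image_iff Bex_def)
  ultimately have "unit_square \<subseteq> slit_strip" "unit_square \<subseteq> swap_map ` slit_strip" by blast+
  then show "swap_elt = plane.elt unit_square swap_map"
    "swap_elt = plane.elt (swap_map ` slit_strip) swap_map"
    unfolding swap_elt_def
    using plane.elt_mono domain_unit_square domain_slit_strip domain_swapped swap_base_in by metis+
qed

lemma swap_in: "swap_elt \<in> carrier \<A>"
  unfolding swap_elt_eq(1) by (intro plane.elt_in domain_unit_square swap_Aff swap_base_in)

lemma fst_swap_elt: "fst swap_elt = swap_map"
  by (simp add: swap_elt_def)

lemma swap_swap_elt: "swap_elt \<otimes>\<^bsub>\<A>\<^esub> swap_elt = \<one>\<^bsub>\<A>\<^esub>"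
proof -
  have "swap_map ` unit_square \<subseteq> unit_square"
    by (auto simp: unit_square_def swap_map_apply)
  then show ?thesis
    unfolding swap_elt_eq(1)
    using plane.elt_mult domain_unit_square swap_Aff swap_base_in swap_swap plane.elt_id by metis
qed

text \<open>The centre (1/2, 1/2) is fixed by the swap, and the unit square is invariant under both
  maps.\<close>

lemma swap_turn_1: "swap_elt \<otimes>\<^bsub>\<A>\<^esub> turn 1 = turn 1 \<otimes>\<^bsub>\<A>\<^esub> swap_elt"
proof -
  have r: "rotation 1 1 z \<in> unit_square" if "z \<in> unit_square" for z
    using that by (cases z) (auto simp: unit_square_def)
  have b: "base \<in> unit_square" by (simp add: base_def unit_square_def)
  have "turn 1 = plane.elt unit_square (rotation 1 1)"
    unfolding turn_def strip_elt_def
    by (intro plane.elt_mono[symmetric] domain_vertical_strip domain_unit_square r b)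
       (auto simp: unit_square_def vertical_strip_def)
  moreover have "swap_map ` unit_square \<subseteq> unit_square"
    by (auto simp: unit_square_def swap_map_apply)
  moreover have "swap_map \<circ> rotation 1 1 = rotation 1 1 \<circ> swap_map"
    by (simp add: swap_map_def affine_map_comp)
  ultimately show ?thesis
    unfolding swap_elt_eq(1) using r b
    by (auto simp: plane.elt_mult domain_unit_square swap_Aff rotation_Aff swap_base_in image_subset_iff)
qed

text \<open>The swap takes the centre (1/2, 0) to (0, 1/2). The path of \<open>turn 0\<close>
  crosses the line y = 0 between (0, 0) and (1, 0), which is the gap of the swapped slit
  strip.\<close>

lemma swap_side_turn: "swap_elt \<otimes>\<^bsub>\<A>\<^esub> turn 0 = side_turn \<otimes>\<^bsub>\<A>\<^esub> swap_elt"
proof -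
  \<comment> \<open>A rectangle in both the strip and the swapped slit strip, containing
    \<open>base\<close> and its image under the half-turn.\<close>
  let ?V = "{z \<in> vertical_strip. \<bar>snd z\<bar> < 1}"
  have dV: "plane.domain_at_base ?V"
  proof -
    have "?V = {0<..<1} \<times> {-1<..<1}" by (auto simp: vertical_strip_def)
    then have "convex ?V" by (metis convex_Times convex_real_interval(8))
    then show ?thesis using vertical_strip_subset base_in_strip
      by (auto simp: plane.domain_at_base_def convex_imp_simply_connected) (simp add: base_def)
  qed
  have "rotation 1 0 base \<in> ?V" by (simp add: base_def vertical_strip_def)
  moreover have "?V \<subseteq> swap_map ` slit_strip"
    by (auto simp: vertical_strip_def slit_strip_def swap_map_apply image_iff Bex_def)
  ultimately have t: "turn 0 = plane.elt (swap_map ` slit_strip) (rotation 1 0)"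
    unfolding turn_def strip_elt_def
    using plane.elt_mono[OF dV] domain_vertical_strip domain_swapped
    by (metis (no_types, lifting) mem_Collect_eq subsetI)
  have b: "rotation 1 0 base \<in> swap_map ` slit_strip"
    using \<open>?V \<subseteq> swap_map ` slit_strip\<close> \<open>rotation 1 0 base \<in> ?V\<close> by blast
  have s: "swap_map base \<in> slit_strip" by (simp add: base_def swap_map_apply slit_strip_def)
  have "swap_map ` swap_map ` slit_strip \<subseteq> slit_strip"
    by (simp add: image_comp swap_swap)
  then have "swap_elt \<otimes>\<^bsub>\<A>\<^esub> turn 0 = plane.elt slit_strip (swap_map \<circ> rotation 1 0)"
    unfolding swap_elt_def t
    by (rule plane.elt_mult[OF domain_slit_strip domain_swapped swap_Aff rotation_Aff s b])
  also have "swap_map \<circ> rotation 1 0 = rotation 0 1 \<circ> swap_map"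
    by (simp add: swap_map_def affine_map_comp)
  also have "plane.elt slit_strip \<dots> = side_turn \<otimes>\<^bsub>\<A>\<^esub> swap_elt"
    unfolding side_turn_def swap_elt_def using rotation_slit_strip
    by (intro plane.elt_mult[OF domain_slit_strip domain_slit_strip rotation_Aff swap_Aff _ s, symmetric]
        base_in_slit_strip) (auto simp: base_in_slit_strip)
  finally show ?thesis .
qed

section \<open>The action on slopes\<close>

lemma slope_vec_Slope:
  assumes "slope_vec (Slope x) = (p, q)"
  shows "p > 0" "x = of_int q / of_int p"
proof -
  have "quotient_of x = (q, p)" using assms by (auto split: prod.splits)
  then show "p > 0" "x = of_int q / of_int p" using quotient_of_denom_pos quotient_of_div by auto
qed

lemma slope_dir_eq: "slope_vec s = (p, q) \<Longrightarrow> slope_dir s = (of_int p, of_int q)"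
  by (simp add: slope_dir_def)

lemma slope_dir_inj:
  assumes "slope_dir s = slope_dir t \<or> slope_dir s = - slope_dir t"
  shows "s = t"
proof -
  obtain p q where s: "slope_vec s = (p, q)" by fastforce
  obtain p' q' where t: "slope_vec t = (p', q')" by fastforce
  have "p = p' \<and> q = q' \<or> p = - p' \<and> q = - q'"
    using assms unfolding slope_dir_eq[OF s] slope_dir_eq[OF t]
    by (simp flip: of_int_minus)
  then show ?thesis
    using s t slope_vec_Slope[of _ p q] slope_vec_Slope[of _ p' q']
    by (cases s; cases t) (fastforce simp del: slope_vec.simps(1))+
qed

lemma slope_dir_slope_of:
  assumes "coprime p q"
  shows "slope_dir (slope_of (p, q)) = (of_int p, of_int q)
    \<or> slope_dir (slope_of (p, q)) = - (of_int p, of_int q)"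
proof -
  have *: "slope_vec (Slope (of_int q / of_int p)) = (p, q)" if "p > 0" "coprime p q" for p q :: int
    using that by (simp add: quotient_of_Fract normalize_stable coprime_commute flip: Fract_of_int_quotient)
  consider "p = 0" | "p > 0" | "p < 0" by linarith
  then show ?thesis
  proof cases
    case 1
    then have "\<bar>q\<bar> = 1" using assms by simp
    then show ?thesis using 1 by (auto simp: slope_dir_def)
  next
    case 2
    then show ?thesis using slope_dir_eq[OF *[OF _ assms]] by simp
  next
    case 3
    have "slope_vec (slope_of (p, q)) = (- p, - q)" using *[of "-p" "-q"] 3 assms by simp
    from slope_dir_eq[OF this] show ?thesis by simp
  qed
qed

lemma coprime_linear_image:
  fixes a b c d :: int
  assumes "\<bar>a * d - b * c\<bar> = 1" "coprime p q"
  shows "coprime (a * p + b * q) (c * p + d * q)"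
proof (rule coprimeI)
  fix k assume k: "k dvd a * p + b * q" "k dvd c * p + d * q"
  have "k dvd d * (a * p + b * q) - b * (c * p + d * q)" "k dvd a * (c * p + d * q) - c * (a * p + b * q)"
    using k by (auto intro: dvd_diff dvd_mult)
  then have "k dvd (a * d - b * c) * p" "k dvd (a * d - b * c) * q"
    by (auto simp: algebra_simps)
  then have "k dvd p" "k dvd q" using assms(1) by (metis abs_dvd_iff abs_mult mult_1 dvd_abs_iff)+
  then show "is_unit k" using assms(2) coprime_common_divisor by blast
qed

lemma carries_slope_of:
  assumes "\<bar>a * d - b * c\<bar> = 1" "slope_vec s = (p, q)"
  shows "carries (affine_map a b c d i j) s (slope_of (a * p + b * q, c * p + d * q))"
  using slope_dir_slope_of[OF coprime_linear_image[OF assms(1) coprime_slope_vec[OF assms(2)]]]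
  by (auto simp: carries_def slope_dir_eq[OF assms(2)] lin_affine_map)

lemma carries_exists:
  assumes "f \<in> Aff"
  shows "\<exists>t. carries f s t"
proof -
  obtain p q where "slope_vec s = (p, q)" by fastforce
  then show ?thesis using assms carries_slope_of unfolding Aff_def by blast
qed

lemma carries_unique_target: "carries f s t \<Longrightarrow> carries f s u \<Longrightarrow> t = u"
  by (intro slope_dir_inj) (auto simp: carries_def)

text \<open>The inverse of \<open>f\<close> carries every slope back, and targets are unique.
  Bijectivity makes \<open>BijGroup UNIV\<close> multiply such maps by composition.\<close>

lemma carries_bij:
  assumes f: "f \<in> Aff" and \<phi>: "\<And>w. carries f w (\<phi> w)"
  shows "bij \<phi>"
proof -
  obtain g where g: "g \<in> Aff" "g \<circ> f = id" "f \<circ> g = id" using Aff_inverse[OF f] by blast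
  have "inj \<phi>"
    using carries_inverse[OF g(1,2) \<phi>] carries_unique_target by (metis injI)
  moreover have "surj \<phi>"
  proof (unfold surj_def, rule allI)
    fix t
    obtain u where "carries g t u" using carries_exists[OF g(1)] by blast
    then have "carries f u t" using carries_inverse[OF f g(3)] by blast
    then show "\<exists>w. t = \<phi> w" using \<phi> carries_unique_target by blast
  qed
  ultimately show ?thesis by (simp add: bij_def)
qed

section \<open>Determinants, Farey reflections and parabolic shifts\<close>

lemma carries_det2:
  assumes "f \<in> Aff" "carries f s s'" "carries f t t'"
  shows "\<bar>det2 (slope_vec s') (slope_vec t')\<bar> = \<bar>det2 (slope_vec s) (slope_vec t)\<bar>"
proof -
  obtain a b c d i j where f: "f = affine_map a b c d i j" "\<bar>a * d - b * c\<bar> = 1"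
    using assms(1) by (auto simp: Aff_def)
  obtain p q where s: "slope_vec s = (p, q)" by fastforce
  obtain x y where t: "slope_vec t = (x, y)" by fastforce
  obtain p' q' where s': "slope_vec s' = (p', q')" by fastforce
  obtain x' y' where t': "slope_vec t' = (x', y')" by fastforce
  have "a * p + b * q = p' \<and> c * p + d * q = q' \<or> a * p + b * q = - p' \<and> c * p + d * q = - q'"
    using assms(2) unfolding carries_def f slope_dir_eq[OF s] slope_dir_eq[OF s'] lin_affine_map
    by (simp flip: of_int_mult of_int_add of_int_minus)
  moreover have "a * x + b * y = x' \<and> c * x + d * y = y' \<or> a * x + b * y = - x' \<and> c * x + d * y = - y'"
    using assms(3) unfolding carries_def f slope_dir_eq[OF t] slope_dir_eq[OF t'] lin_affine_map
    by (simp flip: of_int_mult of_int_add of_int_minus)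
  ultimately have "\<bar>p' * y' - q' * x'\<bar> = \<bar>(a * p + b * q) * (c * x + d * y) - (c * p + d * q) * (a * x + b * y)\<bar>"
    by (elim disjE conjE) (simp_all add: abs_minus_commute)
  also have "(a * p + b * q) * (c * x + d * y) - (c * p + d * q) * (a * x + b * y)
      = (a * d - b * c) * (p * y - q * x)" by algebra
  finally show ?thesis using f(2) by (simp add: s t s' t' abs_mult)
qed

text \<open>The matrix is that of w \<mapsto> det(w,v) u - det(u,w) v for u = (p, q) and v = (x, y).
  Its determinant is minus the square of det(u,v). The translation part does not affect slopes and
  stays free.\<close>

lemma geodesic_reflection_carried:
  assumes "slope_vec u = (p, q)" "slope_vec v = (x, y)" "\<bar>p * y - q * x\<bar> = 1"
  shows "affine_map (y * p + q * x) (- 2 * p * x) (2 * q * y) (- (y * p + q * x)) i j \<in> Aff"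
    "carries (affine_map (y * p + q * x) (- 2 * p * x) (2 * q * y) (- (y * p + q * x)) i j) w
      (geodesic_reflection u v w)"
proof -
  have "(y * p + q * x) * (- (y * p + q * x)) - (- 2 * p * x) * (2 * q * y) = - ((p * y - q * x) * (p * y - q * x))"
    by algebra
  then have d: "\<bar>(y * p + q * x) * (- (y * p + q * x)) - (- 2 * p * x) * (2 * q * y)\<bar> = 1"
    using assms(3) by (metis abs_minus_cancel abs_mult mult_1)
  then show "affine_map (y * p + q * x) (- 2 * p * x) (2 * q * y) (- (y * p + q * x)) i j \<in> Aff"
    by (rule affine_map_in_Aff)
  obtain m n where w: "slope_vec w = (m, n)" by fastforce
  have "geodesic_reflection u v w = slope_of ((y * p + q * x) * m + (- 2 * p * x) * n,
      (2 * q * y) * m + (- (y * p + q * x)) * n)"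
    unfolding geodesic_reflection_def assms(1,2) w by (simp add: algebra_simps del: slope_of.simps)
  then show "carries (affine_map (y * p + q * x) (- 2 * p * x) (2 * q * y) (- (y * p + q * x)) i j) w
      (geodesic_reflection u v w)"
    using carries_slope_of[OF d w] by simp
qed

text \<open>The reflection in an edge of determinant 1 or -1 is induced by an element of
  \<open>Aff\<close>, and these preserve determinants up to sign.\<close>

lemma farey_triangle_det2:
  assumes "farey_triangle T" "u \<in> T" "v \<in> T" "u \<noteq> v"
  shows "\<bar>det2 (slope_vec u) (slope_vec v)\<bar> = 1"
  using assms
proof (induction arbitrary: u v rule: farey_triangle.induct)
  case 1
  then show ?case by auto
next
  case (2 T a b)
  obtain p q where a: "slope_vec a = (p, q)" by fastforce
  obtain x y where b: "slope_vec b = (x, y)" by fastforce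
  have "\<bar>p * y - q * x\<bar> = 1" using 2(5)[OF 2(2,3,4)] by (simp add: a b)
  note r = geodesic_reflection_carried[OF a b this]
  obtain u' v' where "u' \<in> T" "v' \<in> T" "u = geodesic_reflection a b u'" "v = geodesic_reflection a b v'"
    using 2 by auto
  then show ?case using carries_det2[OF r(1) r(2)[of 0 0 u'] r(2)[of 0 0 v']] 2 by metis
qed

lemma farey_edge_infty:
  assumes "farey_edge Slope_Infty v"
  obtains k where "v = Slope (of_int k)" "slope_vec v = (1, k)"
proof -
  have *: "\<bar>det2 (slope_vec Slope_Infty) (slope_vec v)\<bar> = 1" "v \<noteq> Slope_Infty"
    using assms farey_triangle_det2 unfolding farey_edge_def by blast+
  then obtain x where x: "v = Slope x" by (cases v) auto
  obtain p q where pq: "slope_vec v = (p, q)" by fastforce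
  have "p = 1" using *(1) slope_vec_Slope(1)[of x p q] pq x by simp
  then show thesis using that[of q] slope_vec_Slope(2)[of x p q] pq x by simp
qed

text \<open>The translation part (0, 1) is chosen so that the map fixes (0, 1/2), the centre of
  \<open>side_turn\<close>.\<close>

lemma farey_reflection_carried:
  assumes "farey_edge Slope_Infty v"
  obtains k where "\<And>w. carries (affine_map 1 0 (2 * k) (- 1) 0 1) w (geodesic_reflection Slope_Infty v w)"
proof -
  obtain k where k: "slope_vec v = (1, k)" using farey_edge_infty[OF assms] by blast
  show thesis
    using geodesic_reflection_carried(2)[of Slope_Infty 0 1 v 1 k 0 1] k that[of k] by simp
qed

abbreviation shear :: "int \<Rightarrow> plane \<Rightarrow> plane" where
  "shear m \<equiv> affine_map 1 0 m 1 0 0"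

text \<open>The shear by k is w \<mapsto> w - k det((0,1),w) (0,1). Conjugation by \<open>f\<close>
  replaces (0,1) by a vector of slope \<open>r\<close>, whose sign cancels, and multiplies the
  coefficient by the determinant of \<open>f\<close>. So \<open>e\<close> is minus that
  determinant.\<close>

lemma parabolic_shift_carried:
  assumes f: "f \<in> Aff" "carries f Slope_Infty r" and g: "g \<in> Aff" "f \<circ> g = id"
  obtains e :: int where "\<bar>e\<bar> = 1"
    "\<And>m w. carries (f \<circ> shear (e * m) \<circ> g) w (parabolic_shift r m w)"
proof -
  obtain a b c d i j where f': "f = affine_map a b c d i j" "\<bar>a * d - b * c\<bar> = 1"
    using f(1) by (auto simp: Aff_def)
  obtain p q where r: "slope_vec r = (p, q)" by fastforce
  define D where "D = a * d - b * c"
  have bd: "b = p \<and> d = q \<or> b = - p \<and> d = - q"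
    using f(2) unfolding f' carries_def slope_dir_infty slope_dir_eq[OF r] lin_affine_map
    by (simp flip: of_int_minus)
  have "carries (f \<circ> shear (- D * m) \<circ> g) w (parabolic_shift r m w)" for m w
  proof -
    obtain x y where w: "slope_vec w = (x, y)" by fastforce
    obtain x' y' where z: "lin g (of_int x, of_int y) = (x', y')" by fastforce
    have sh: "shear k \<in> Aff" for k by (rule affine_map_in_Aff) simp
    have "lin f (lin g (of_int x, of_int y)) = (of_int x, of_int y)"
      using lin_comp[OF f(1), of g] g(2) lin_id by metis
    then have xy: "real_of_int x = of_int a * x' + of_int b * y'" "real_of_int y = of_int c * x' + of_int d * y'"
      unfolding z f' lin_affine_map by auto
    \<comment> \<open>The matrix of the transvection w \<mapsto> w + m det(r,w) r for r = (p,
      q).\<close>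
    let ?A = "1 - m * p * q" and ?B = "m * p * p" and ?C = "- m * q * q" and ?D = "1 + m * p * q"
    have "lin (f \<circ> shear (- D * m) \<circ> g) (of_int x, of_int y)
        = lin f (lin (shear (- D * m)) (x', y'))"
      using lin_comp[OF comp_in_Aff[OF f(1) sh]] lin_comp[OF f(1)] z by simp
    also have "\<dots> = lin (affine_map ?A ?B ?C ?D 0 0) (of_int x, of_int y)"
      unfolding f' lin_affine_map xy D_def using bd
      by (elim disjE conjE) (simp_all add: algebra_simps)
    finally have "carries (f \<circ> shear (- D * m) \<circ> g) w t \<longleftrightarrow> carries (affine_map ?A ?B ?C ?D 0 0) w t" for t
      unfolding carries_def slope_dir_eq[OF w] by simp
    moreover have "?A * ?D - ?B * ?C = 1" by algebra
    then have "carries (affine_map ?A ?B ?C ?D 0 0) w (slope_of (?A * x + ?B * y, ?C * x + ?D * y))"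
      by (intro carries_slope_of w) simp
    moreover have "parabolic_shift r m w = slope_of (?A * x + ?B * y, ?C * x + ?D * y)"
      unfolding parabolic_shift_def r w by (simp add: algebra_simps del: slope_of.simps)
    ultimately show ?thesis by simp
  qed
  then show thesis using that[of "- D"] f'(2) by (simp add: D_def)
qed

section \<open>The fundamental groups inside the group of affine loops\<close>

context group
begin

lemma inv_mult_cancel_left: "a \<in> carrier G \<Longrightarrow> b \<in> carrier G \<Longrightarrow> inv a \<otimes> (a \<otimes> b) = b"
  by (simp flip: m_assoc)

lemma mult_inv_cancel_left: "a \<in> carrier G \<Longrightarrow> b \<in> carrier G \<Longrightarrow> a \<otimes> (inv a \<otimes> b) = b"
  by (simp flip: m_assoc)

lemmas word_simps = m_assoc inv_mult_group inv_mult_cancel_left mult_inv_cancel_left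

lemma conj_eqI: "x \<in> carrier G \<Longrightarrow> s \<in> carrier G \<Longrightarrow> s' \<in> carrier G \<Longrightarrow> x \<otimes> s = s' \<otimes> x \<Longrightarrow>
    x \<otimes> s \<otimes> inv x = s'"
  by (simp add: m_assoc)

lemma conj_conj: "x \<in> carrier G \<Longrightarrow> y \<in> carrier G \<Longrightarrow> g \<in> carrier G \<Longrightarrow>
    x \<otimes> (y \<otimes> g \<otimes> inv y) \<otimes> inv x = (x \<otimes> y) \<otimes> g \<otimes> inv (x \<otimes> y)"
  by (simp add: word_simps)

lemma conj_mult: "x \<in> carrier G \<Longrightarrow> y \<in> carrier G \<Longrightarrow> z \<in> carrier G \<Longrightarrow>
    x \<otimes> (y \<otimes> z) \<otimes> inv x = (x \<otimes> y \<otimes> inv x) \<otimes> (x \<otimes> z \<otimes> inv x)"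
  by (simp add: word_simps)

lemma conj_pow: "x \<in> carrier G \<Longrightarrow> g \<in> carrier G \<Longrightarrow>
    (x \<otimes> g \<otimes> inv x) [^] (n :: nat) = x \<otimes> g [^] n \<otimes> inv x"
  by (induction n) (simp_all add: word_simps)

lemma subgroup_conj_preimage:
  assumes "subgroup H G" "subgroup K G" "x \<in> carrier G"
  shows "subgroup {g \<in> K. x \<otimes> g \<otimes> inv x \<in> H} G"
proof (rule subgroupI)
  interpret K: subgroup K G by fact
  interpret H: subgroup H G by fact
  show "{g \<in> K. x \<otimes> g \<otimes> inv x \<in> H} \<subseteq> carrier G" using K.subset by auto
  have "\<one> \<in> {g \<in> K. x \<otimes> g \<otimes> inv x \<in> H}" using assms(3) by simp
  then show "{g \<in> K. x \<otimes> g \<otimes> inv x \<in> H} \<noteq> {}" by (metis empty_iff)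
  fix a assume a: "a \<in> {g \<in> K. x \<otimes> g \<otimes> inv x \<in> H}"
  then have "inv (x \<otimes> a \<otimes> inv x) \<in> H" by simp
  then show "inv a \<in> {g \<in> K. x \<otimes> g \<otimes> inv x \<in> H}"
    using a assms(3) K.mem_carrier by (simp add: word_simps)
  fix b assume b: "b \<in> {g \<in> K. x \<otimes> g \<otimes> inv x \<in> H}"
  then have "(x \<otimes> a \<otimes> inv x) \<otimes> (x \<otimes> b \<otimes> inv x) \<in> H" using a by simp
  then show "a \<otimes> b \<in> {g \<in> K. x \<otimes> g \<otimes> inv x \<in> H}"
    using a b assms(3) K.mem_carrier by (simp add: word_simps)
qed

lemma generate_subset_subgroup: "subgroup H G \<Longrightarrow> S \<subseteq> H \<Longrightarrow> generate G S \<subseteq> H"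
  using generate_subgroup_incl by blast

lemma conj_generate:
  assumes "S \<subseteq> carrier G" "x \<in> carrier G" "subgroup H G" "\<And>s. s \<in> S \<Longrightarrow> x \<otimes> s \<otimes> inv x \<in> H"
    "g \<in> generate G S"
  shows "x \<otimes> g \<otimes> inv x \<in> H"
  using generate_subset_subgroup[OF subgroup_conj_preimage[OF assms(3) subgroup_self assms(2)], of S]
    assms by auto

text \<open>Writing [x,g] for x g x^-1 g^-1, one has [x,ab] = [x,a] (a [x,b] a^-1), and
  \<open>N\<close> is stable under conjugation by \<open>P\<close>. Hence trivial action modulo
  \<open>N\<close> can be tested on generators of a subgroup.\<close>

lemma subgroup_commutators:
  assumes N: "subgroup N G" and P: "subgroup P G"
    and PN: "\<And>g n. g \<in> P \<Longrightarrow> n \<in> N \<Longrightarrow> g \<otimes> n \<otimes> inv g \<in> N" and x: "x \<in> carrier G"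
  shows "subgroup {g \<in> P. x \<otimes> g \<otimes> inv x \<otimes> inv g \<in> N} G"
proof (rule subgroupI)
  interpret P: subgroup P G by fact
  interpret N: subgroup N G by fact
  let ?C = "{g \<in> P. x \<otimes> g \<otimes> inv x \<otimes> inv g \<in> N}"
  show "?C \<subseteq> carrier G" using P.subset by auto
  have "\<one> \<in> ?C" using x by simp
  then show "?C \<noteq> {}" by (metis empty_iff)
  fix a assume a: "a \<in> ?C"
  then have "inv a \<otimes> inv (x \<otimes> a \<otimes> inv x \<otimes> inv a) \<otimes> inv (inv a) \<in> N"
    by (intro PN) auto
  then show "inv a \<in> ?C"
    using a x P.mem_carrier by (simp add: word_simps)
  fix b assume b: "b \<in> ?C"
  then have "(x \<otimes> a \<otimes> inv x \<otimes> inv a) \<otimes> (a \<otimes> (x \<otimes> b \<otimes> inv x \<otimes> inv b) \<otimes> inv a) \<in> N"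
    using a PN[of a "x \<otimes> b \<otimes> inv x \<otimes> inv b"] by simp
  then show "a \<otimes> b \<in> ?C"
    using a b x P.mem_carrier by (simp add: word_simps)
qed

lemma normal_closure_normal:
  assumes "A \<subseteq> carrier G"
  shows "normal_closure G A \<lhd> G" "A \<subseteq> normal_closure G A"
proof -
  let ?F = "{N. N \<lhd> G \<and> A \<subseteq> N}"
  have "carrier G \<lhd> G" using normal_inv_iff subgroup_self by auto
  then have ne: "?F \<noteq> {}" using assms by auto
  show "normal_closure G A \<lhd> G"
    unfolding normal_closure_def
  proof (rule normal_invI)
    show "subgroup (\<Inter> ?F) G" using ne by (intro subgroups_Inter) (auto simp: normal_imp_subgroup)
    fix x h assume "x \<in> carrier G" "h \<in> \<Inter> ?F"
    then show "x \<otimes> h \<otimes> inv x \<in> \<Inter> ?F" using normal.inv_op_closed2 by fastforce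
  qed
  show "A \<subseteq> normal_closure G A" unfolding normal_closure_def by blast
qed

lemma normal_closure_least: "N \<lhd> G \<Longrightarrow> A \<subseteq> N \<Longrightarrow> normal_closure G A \<subseteq> N"
  unfolding normal_closure_def by blast

text \<open>Restating normality with the operations of the ambient group allows it to be combined
  with conjugation by elements outside \<open>P\<close>.\<close>

lemma normal_in_subgroup_iff:
  assumes "subgroup P G"
  shows "N \<lhd> G\<lparr>carrier := P\<rparr> \<longleftrightarrow>
    subgroup N G \<and> N \<subseteq> P \<and> (\<forall>x\<in>P. \<forall>n\<in>N. x \<otimes> n \<otimes> inv x \<in> N)"
proof -
  interpret P: group "G\<lparr>carrier := P\<rparr>" using assms by (rule subgroup_imp_group)
  have "subgroup N (G\<lparr>carrier := P\<rparr>) \<longleftrightarrow> subgroup N G \<and> N \<subseteq> P"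
  proof
    assume N: "subgroup N (G\<lparr>carrier := P\<rparr>)"
    then show "subgroup N G \<and> N \<subseteq> P" using incl_subgroup[OF assms N] subgroup.subset[OF N] by simp
  next
    assume "subgroup N G \<and> N \<subseteq> P"
    then show "subgroup N (G\<lparr>carrier := P\<rparr>)" using subgroup_incl assms by blast
  qed
  then show ?thesis
    unfolding P.normal_inv_iff using m_inv_consistent[OF assms] by auto
qed

end

text \<open>For \<open>e = 1\<close> the linear part of \<open>f\<close> acts on the translation
  vector. For \<open>e = -1\<close> twice the translation part of \<open>f\<close> is added, and
  \<open>k dvd 2\<close> keeps the sum a multiple of \<open>k\<close>.\<close>

lemma signed_translations_conj:
  assumes f: "f \<in> Aff" and g: "f \<circ> g = id" and h: "h \<in> signed_translations k" and k: "k dvd 2"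
  shows "f \<circ> h \<circ> g \<in> signed_translations k"
proof -
  obtain a b c d i j where f': "f = affine_map a b c d i j" using f by (auto simp: Aff_def)
  obtain e v w where h': "h = affine_map e 0 0 e (k * v) (k * w)" "e = 1 \<or> e = -1"
    using h by (auto simp: signed_translations_def)
  obtain l where l: "2 = k * l" using k by blast
  have "\<exists>i' j'. f \<circ> h = affine_map e 0 0 e (k * i') (k * j') \<circ> f"
  proof (cases "e = 1")
    case True
    have "f \<circ> h = affine_map e 0 0 e (k * (a * v + b * w)) (k * (c * v + d * w)) \<circ> f"
      unfolding f' h' affine_map_comp by (simp add: True algebra_simps)
    then show ?thesis by blast
  next
    case False
    then have e: "e = -1" using h' by simp
    have "k * (a * v + b * w + l * i) = a * (k * v) + b * (k * w) + (k * l) * i"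
      "k * (c * v + d * w + l * j) = c * (k * v) + d * (k * w) + (k * l) * j"
      by (simp_all add: algebra_simps)
    note eqs = this[folded l]
    have "f \<circ> h = affine_map e 0 0 e (k * (a * v + b * w + l * i)) (k * (c * v + d * w + l * j)) \<circ> f"
      unfolding f' h' affine_map_comp eqs by (simp add: e algebra_simps)
    then show ?thesis by blast
  qed
  then obtain i' j' where "f \<circ> h = affine_map e 0 0 e (k * i') (k * j') \<circ> f" by blast
  then have "f \<circ> h \<circ> g = affine_map e 0 0 e (k * i') (k * j')"
    using g by (metis comp_assoc comp_id)
  then show ?thesis unfolding signed_translations_def using h'(2) by blast
qed

definition signed_loops :: "int \<Rightarrow> loop set" where
  "signed_loops k = {x \<in> carrier \<A>. fst x \<in> signed_translations k}"

lemma pi1_eq: "pi1_O = \<A>\<lparr>carrier := signed_loops 1\<rparr>" "pi1_S = \<A>\<lparr>carrier := signed_loops 2\<rparr>"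
proof -
  have "orb_pi1 punctured_plane (signed_translations k) base = \<A>\<lparr>carrier := signed_loops k\<rparr>" for k
    using signed_translations_subset[of k] unfolding orb_pi1_def signed_loops_def
    by (fastforce simp: orb_class_def)
  then show "pi1_O = \<A>\<lparr>carrier := signed_loops 1\<rparr>" "pi1_S = \<A>\<lparr>carrier := signed_loops 2\<rparr>"
    unfolding pi1_O_def pi1_S_def H_hat_group_eq H_group_eq by auto
qed

lemma signed_loops_subset: "signed_loops k \<subseteq> carrier \<A>"
  by (auto simp: signed_loops_def)

lemma signed_loops_conj:
  assumes "k dvd 2" "x \<in> carrier \<A>" "g \<in> signed_loops k"
  shows "x \<otimes>\<^bsub>\<A>\<^esub> g \<otimes>\<^bsub>\<A>\<^esub> inv\<^bsub>\<A>\<^esub> x \<in> signed_loops k"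
  using assms signed_translations_conj[OF plane.fst_in[OF assms(2)] plane.fst_inv(2)[OF assms(2)], of "fst g" k]
  by (auto simp: signed_loops_def plane.fst_mult)

lemma subgroup_signed_loops: "subgroup (signed_loops k) \<A>"
proof (rule plane.loops.subgroupI)
  show "signed_loops k \<noteq> {}"
  proof -
    have "\<one>\<^bsub>\<A>\<^esub> \<in> signed_loops k"
      by (simp add: signed_loops_def plane.fst_one id_in_signed_translations)
    then show ?thesis by (metis empty_iff)
  qed
  fix a assume a: "a \<in> signed_loops k"
  then obtain e i j where f: "fst a = affine_map e 0 0 e (k * i) (k * j)" "e = 1 \<or> e = -1"
    by (auto simp: signed_loops_def signed_translations_def)
  define g where "g = affine_map e 0 0 e (k * (- e * i)) (k * (- e * j))"
  have "fst a \<circ> g = id" using f by (auto simp: g_def affine_map_comp affine_map_id)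
  moreover have "fst (inv\<^bsub>\<A>\<^esub> a) \<circ> fst a = id"
    using a by (intro plane.fst_inv) (auto simp: signed_loops_def)
  ultimately have "fst (inv\<^bsub>\<A>\<^esub> a) = g" by (metis comp_assoc comp_id id_comp)
  then show "inv\<^bsub>\<A>\<^esub> a \<in> signed_loops k"
    using a f(2) unfolding signed_loops_def signed_translations_def g_def by blast
  fix b assume "b \<in> signed_loops k"
  then show "a \<otimes>\<^bsub>\<A>\<^esub> b \<in> signed_loops k"
    using a by (auto simp: signed_loops_def plane.fst_mult signed_translations_comp)
qed (rule signed_loops_subset)

lemma signed_loops_2_subset: "signed_loops 2 \<subseteq> signed_loops 1"
  using H_group_subset by (auto simp: signed_loops_def H_group_eq H_hat_group_eq)

lemma group_pi1: "group pi1_O" "group pi1_S"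
  unfolding pi1_eq by (intro plane.loops.subgroup_imp_group subgroup_signed_loops)+

lemma inv_pi1:
  "x \<in> signed_loops 1 \<Longrightarrow> inv\<^bsub>pi1_O\<^esub> x = inv\<^bsub>\<A>\<^esub> x"
  "x \<in> signed_loops 2 \<Longrightarrow> inv\<^bsub>pi1_S\<^esub> x = inv\<^bsub>\<A>\<^esub> x"
  unfolding pi1_eq by (auto intro: plane.loops.m_inv_consistent subgroup_signed_loops)

lemma line_loops_in: "line_loops (of_int k) s \<subseteq> carrier \<A>"
  unfolding line_loops_eq using vertical_loop_in by auto

text \<open>By \<open>line_loops_eq\<close> the line loops of slope \<open>s\<close> are conjugates
  of a vertical loop under elements carrying infinity to \<open>s\<close>, and these compose with
  \<open>x\<close>.\<close>

lemma line_loops_conj: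
  assumes "x \<in> carrier \<A>" "carries (fst x) s t" "y \<in> line_loops (of_int k) s"
  shows "x \<otimes>\<^bsub>\<A>\<^esub> y \<otimes>\<^bsub>\<A>\<^esub> inv\<^bsub>\<A>\<^esub> x \<in> line_loops (of_int k) t"
proof -
  obtain h where h: "y = h \<otimes>\<^bsub>\<A>\<^esub> vertical_loop k \<otimes>\<^bsub>\<A>\<^esub> inv\<^bsub>\<A>\<^esub> h" "h \<in> carrier \<A>" "carries (fst h) Slope_Infty s"
    using assms(3) unfolding line_loops_eq by blast
  have "carries (fst (x \<otimes>\<^bsub>\<A>\<^esub> h)) Slope_Infty t"
    using carries_comp[OF plane.fst_in[OF assms(1)] h(3) assms(2)] by (simp add: plane.fst_mult)
  moreover have "x \<otimes>\<^bsub>\<A>\<^esub> h \<in> carrier \<A>" using assms(1) h(2) by simp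
  ultimately show ?thesis
    unfolding h(1) plane.loops.conj_conj[OF assms(1) h(2) vertical_loop_in] line_loops_eq by blast
qed

lemma signed_loops_carries: "x \<in> signed_loops k \<Longrightarrow> carries (fst x) s s"
  by (cases "slope_dir s") (auto simp: signed_loops_def signed_translations_def carries_def lin_affine_map)

text \<open>The case \<open>k = 1\<close>, \<open>n = 2\<close> is
  \<open>\<alpha>\<^sub>s = \<beta>\<^sub>s\<^sup>2\<close>. The relators of both kinds of Heckoid
  groups thus become line loops.\<close>

lemma line_loops_pow:
  "{a [^]\<^bsub>\<A>\<^esub> n | a. a \<in> line_loops (of_int k) s} = line_loops (of_int (k * int n)) s"
proof -
  have "(h \<otimes>\<^bsub>\<A>\<^esub> vertical_loop k \<otimes>\<^bsub>\<A>\<^esub> inv\<^bsub>\<A>\<^esub> h) [^]\<^bsub>\<A>\<^esub> n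
      = h \<otimes>\<^bsub>\<A>\<^esub> vertical_loop (k * int n) \<otimes>\<^bsub>\<A>\<^esub> inv\<^bsub>\<A>\<^esub> h" if "h \<in> carrier \<A>" for h
    using that by (simp add: plane.loops.conj_pow vertical_loop_in vertical_loop_pow)
  note pow = this
  show ?thesis
  proof (intro subset_antisym subsetI)
    fix x assume "x \<in> {a [^]\<^bsub>\<A>\<^esub> n | a. a \<in> line_loops (of_int k) s}"
    then show "x \<in> line_loops (of_int (k * int n)) s"
      unfolding line_loops_eq using pow by blast
  next
    fix x assume "x \<in> line_loops (of_int (k * int n)) s"
    then show "x \<in> {a [^]\<^bsub>\<A>\<^esub> n | a. a \<in> line_loops (of_int k) s}"
      unfolding line_loops_eq using pow[symmetric] by blast
  qed
qed

lemma powers_in_pi1: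
  "powers_in pi1_O (beta s) n = line_loops (of_int (int n)) s"
  "powers_in pi1_S (alpha s) n = line_loops (of_int (2 * int n)) s"
  "alpha s = line_loops (of_int 2) s"
  using line_loops_pow[where k=1] line_loops_pow[where k=2]
  by (simp_all add: powers_in_def pi1_eq beta_def alpha_def nat_pow_def)

lemma line_loops_signed:
  assumes "k dvd j"
  shows "line_loops (of_int j) s \<subseteq> signed_loops k"
proof
  fix y assume "y \<in> line_loops (of_int j) s"
  then obtain f where f: "fst y = (\<lambda>x. x + of_int j *\<^sub>R f)" "f = slope_dir s \<or> f = - slope_dir s"
    unfolding line_loops_def orb_class_def by (smt (verit) fst_conv mem_Collect_eq)
  obtain p q where pq: "slope_vec s = (p, q)" by fastforce
  obtain l where l: "j = k * l" using assms by blast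
  have "fst y \<in> signed_translations k"
    using f(2)
  proof
    assume "f = slope_dir s"
    then have "fst y = affine_map 1 0 0 1 (k * (l * p)) (k * (l * q))"
      unfolding f by (auto simp: slope_dir_eq[OF pq] l)
    then show ?thesis unfolding signed_translations_def by blast
  next
    assume "f = - slope_dir s"
    then have "fst y = affine_map 1 0 0 1 (k * (- l * p)) (k * (- l * q))"
      unfolding f by (auto simp: slope_dir_eq[OF pq] l)
    then show ?thesis unfolding signed_translations_def by blast
  qed
  then show "y \<in> signed_loops k"
    using \<open>y \<in> line_loops (of_int j) s\<close> line_loops_in by (auto simp: signed_loops_def)
qed

lemma normal_signed_loops_iff:
  "N \<lhd> \<A>\<lparr>carrier := signed_loops k\<rparr> \<longleftrightarrow> subgroup N \<A> \<and> N \<subseteq> signed_loops k \<and>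
    (\<forall>x\<in>signed_loops k. \<forall>n\<in>N. x \<otimes>\<^bsub>\<A>\<^esub> n \<otimes>\<^bsub>\<A>\<^esub> inv\<^bsub>\<A>\<^esub> x \<in> N)"
  by (rule plane.loops.normal_in_subgroup_iff[OF subgroup_signed_loops])

lemmas normal_pi1_O_iff = normal_signed_loops_iff[where k=1, folded pi1_eq]
  and normal_pi1_S_iff = normal_signed_loops_iff[where k=2, folded pi1_eq]

lemma signed_loopsD: "x \<in> signed_loops k \<Longrightarrow> x \<in> carrier \<A>"
  using signed_loops_subset by blast

text \<open>For \<open>k dvd 2\<close>, conjugation by \<open>h\<close> is an automorphism of
  \<open>signed_loops k\<close>, so \<open>N\<close> pulls back to a normal subgroup. To show that
  conjugation by \<open>h\<close> maps a normal closure into \<open>N\<close>, it then suffices to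
  check its generators.\<close>

lemma normal_transport:
  assumes k: "k dvd 2" and N: "N \<lhd> \<A>\<lparr>carrier := signed_loops k\<rparr>" and h: "h \<in> carrier \<A>"
  shows "{y \<in> signed_loops k. h \<otimes>\<^bsub>\<A>\<^esub> y \<otimes>\<^bsub>\<A>\<^esub> inv\<^bsub>\<A>\<^esub> h \<in> N} \<lhd> \<A>\<lparr>carrier := signed_loops k\<rparr>"
    (is "?N \<lhd> _")
  unfolding normal_signed_loops_iff
proof (intro conjI ballI)
  note N' = N[unfolded normal_signed_loops_iff]
  show "subgroup ?N \<A>"
    using plane.loops.subgroup_conj_preimage[OF _ subgroup_signed_loops h] N' by blast
  show "?N \<subseteq> signed_loops k" by blast
  fix x y assume x: "x \<in> signed_loops k" and y: "y \<in> ?N"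
  have xc: "x \<in> carrier \<A>" and yc: "y \<in> carrier \<A>"
    using x y signed_loops_subset by blast+
  have "(h \<otimes>\<^bsub>\<A>\<^esub> x \<otimes>\<^bsub>\<A>\<^esub> inv\<^bsub>\<A>\<^esub> h) \<otimes>\<^bsub>\<A>\<^esub> (h \<otimes>\<^bsub>\<A>\<^esub> y \<otimes>\<^bsub>\<A>\<^esub> inv\<^bsub>\<A>\<^esub> h)
      \<otimes>\<^bsub>\<A>\<^esub> inv\<^bsub>\<A>\<^esub> (h \<otimes>\<^bsub>\<A>\<^esub> x \<otimes>\<^bsub>\<A>\<^esub> inv\<^bsub>\<A>\<^esub> h) \<in> N"
    using N' y signed_loops_conj[OF k h x] by blast
  then have "h \<otimes>\<^bsub>\<A>\<^esub> (x \<otimes>\<^bsub>\<A>\<^esub> y \<otimes>\<^bsub>\<A>\<^esub> inv\<^bsub>\<A>\<^esub> x) \<otimes>\<^bsub>\<A>\<^esub> inv\<^bsub>\<A>\<^esub> h \<in> N"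
    using h xc yc by (simp add: plane.loops.word_simps)
  moreover have "x \<otimes>\<^bsub>\<A>\<^esub> y \<otimes>\<^bsub>\<A>\<^esub> inv\<^bsub>\<A>\<^esub> x \<in> signed_loops k"
    using signed_loops_conj[OF k xc] y by blast
  ultimately show "x \<otimes>\<^bsub>\<A>\<^esub> y \<otimes>\<^bsub>\<A>\<^esub> inv\<^bsub>\<A>\<^esub> x \<in> ?N" by simp
qed

lemmas normal_transport_pi1_O = normal_transport[where k=1, folded pi1_eq, OF one_dvd]
  and normal_transport_pi1_S = normal_transport[where k=2, folded pi1_eq, OF dvd_refl]

section \<open>Elements normalising the Heckoid kernel\<close>

text \<open>The generators are loops of order two around the three cone points of O.\<close>

definition turn_group :: "loop set" where
  "turn_group = generate \<A> {side_turn, turn 0, turn 1}"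

lemma turns_in: "{side_turn, turn 0, turn 1} \<subseteq> carrier \<A>"
  using side_turn_in turn_in by auto

lemma subgroup_turn_group: "subgroup turn_group \<A>"
  unfolding turn_group_def by (rule plane.loops.generate_is_subgroup[OF turns_in])

lemma turn_group_in: "g \<in> turn_group \<Longrightarrow> g \<in> carrier \<A>"
  using subgroup.subset[OF subgroup_turn_group] by blast

lemma turn_signed: "turn j \<in> signed_loops 1" "side_turn \<in> signed_loops 1"
proof -
  have "rotation i j \<in> signed_translations 1" for i j
    unfolding signed_translations_def by force
  then show "turn j \<in> signed_loops 1" "side_turn \<in> signed_loops 1"
    using turn_in side_turn_in by (auto simp: signed_loops_def turn_def side_turn_def)
qed

lemma vertical_loop_turn_group: "vertical_loop k \<in> turn_group"
proof (induction k rule: int_induct[of _ 0])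
  interpret T: subgroup turn_group \<A> by (rule subgroup_turn_group)
  have "turn 1 \<in> turn_group" "turn 0 \<in> turn_group"
    unfolding turn_group_def by (auto intro: generate.incl)
  from T.m_closed[OF this] have 1: "vertical_loop 1 \<in> turn_group" by (simp add: turn_turn)
  show "vertical_loop 0 \<in> turn_group" by (simp add: vertical_loop_0)
  show "vertical_loop (i + 1) \<in> turn_group" if "vertical_loop i \<in> turn_group" for i
    using that 1 by (simp add: vertical_loop_add)
  show "vertical_loop (i - 1) \<in> turn_group" if "vertical_loop i \<in> turn_group" for i
    using that 1 vertical_loop_add[of i "-1"] by (simp add: vertical_loop_minus)
qed

lemma turn_turn_group: "turn j \<in> turn_group" "side_turn \<in> turn_group"
proof -
  have "turn 0 \<in> turn_group" unfolding turn_group_def by (auto intro: generate.incl)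
  then show "turn j \<in> turn_group"
    using vertical_loop_turn[of j 0] vertical_loop_turn_group subgroup.m_closed[OF subgroup_turn_group]
    by (metis add.right_neutral)
  show "side_turn \<in> turn_group" unfolding turn_group_def by (auto intro: generate.incl)
qed

lemma turn_inv: "inv\<^bsub>\<A>\<^esub> turn j = turn j"
  using turn_turn[of j j] by (simp add: vertical_loop_0 plane.loops.inv_equality turn_in)

text \<open>By \<open>subgroup_commutators\<close> three generators suffice.
  \<open>side_turn\<close> is fixed, and \<open>turn j\<close> goes to
  \<open>turn (c + e * j + 2 * i)\<close>, which differs from it by a vertical loop; the two loops
  assumed in \<open>N\<close> are the cases j = 0 and j = 1.\<close>

lemma strip_elt_acts_trivially:
  assumes N: "N \<lhd> pi1_O" and e: "i = 0 \<and> e = 1 \<or> i = 1 \<and> e = -1"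
    and v: "vertical_loop (c + 2 * i) \<in> N" "vertical_loop (c + e - 1 + 2 * i) \<in> N"
    and g: "g \<in> turn_group"
  defines "x \<equiv> strip_elt (affine_map 1 0 c e 0 i)"
  shows "x \<otimes>\<^bsub>\<A>\<^esub> g \<otimes>\<^bsub>\<A>\<^esub> inv\<^bsub>\<A>\<^esub> x \<otimes>\<^bsub>\<A>\<^esub> inv\<^bsub>\<A>\<^esub> g \<in> N"
proof -
  have e1: "\<bar>e\<bar> = 1" using e by auto
  have x: "x \<in> carrier \<A>" unfolding x_def using e1 by (intro strip_elt_in strip_mapsI)
  note N' = N[unfolded normal_pi1_O_iff]
  interpret N: subgroup N \<A> using N' by blast
  let ?C = "{g \<in> signed_loops 1. x \<otimes>\<^bsub>\<A>\<^esub> g \<otimes>\<^bsub>\<A>\<^esub> inv\<^bsub>\<A>\<^esub> x \<otimes>\<^bsub>\<A>\<^esub> inv\<^bsub>\<A>\<^esub> g \<in> N}"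
  have C: "subgroup ?C \<A>"
    using N' x by (intro plane.loops.subgroup_commutators subgroup_signed_loops) auto
  have "x \<otimes>\<^bsub>\<A>\<^esub> turn j \<otimes>\<^bsub>\<A>\<^esub> inv\<^bsub>\<A>\<^esub> x = turn (c + e * j + 2 * i)" for j
    using strip_elt_turn[OF e1, of c i j] x unfolding x_def[symmetric]
    by (intro plane.loops.conj_eqI turn_in) auto
  then have "turn 0 \<in> ?C" "turn 1 \<in> ?C"
    using v by (simp_all add: turn_signed turn_inv turn_turn algebra_simps)
  moreover have "x \<otimes>\<^bsub>\<A>\<^esub> side_turn \<otimes>\<^bsub>\<A>\<^esub> inv\<^bsub>\<A>\<^esub> x = side_turn"
    using strip_elt_side_turn[OF e, of c] x unfolding x_def[symmetric]
    by (intro plane.loops.conj_eqI side_turn_in) auto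
  then have "side_turn \<in> ?C" by (simp add: turn_signed side_turn_in)
  ultimately have "turn_group \<subseteq> ?C"
    unfolding turn_group_def by (intro plane.loops.generate_subset_subgroup[OF C]) auto
  then show ?thesis using g by blast
qed

section \<open>The normaliser of \<open>turn_group\<close> and its action on slopes\<close>

definition turn_normalizer :: "loop set" where
  "turn_normalizer = {x \<in> carrier \<A>. \<forall>g\<in>turn_group.
     x \<otimes>\<^bsub>\<A>\<^esub> g \<otimes>\<^bsub>\<A>\<^esub> inv\<^bsub>\<A>\<^esub> x \<in> turn_group \<and> inv\<^bsub>\<A>\<^esub> x \<otimes>\<^bsub>\<A>\<^esub> g \<otimes>\<^bsub>\<A>\<^esub> x \<in> turn_group}"

lemma turn_normalizer_mult:
  assumes "x \<in> turn_normalizer" "y \<in> turn_normalizer"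
  shows "x \<otimes>\<^bsub>\<A>\<^esub> y \<in> turn_normalizer"
proof -
  have xy: "x \<in> carrier \<A>" "y \<in> carrier \<A>" using assms by (auto simp: turn_normalizer_def)
  have "x \<otimes>\<^bsub>\<A>\<^esub> (y \<otimes>\<^bsub>\<A>\<^esub> g \<otimes>\<^bsub>\<A>\<^esub> inv\<^bsub>\<A>\<^esub> y) \<otimes>\<^bsub>\<A>\<^esub> inv\<^bsub>\<A>\<^esub> x \<in> turn_group
     \<and> inv\<^bsub>\<A>\<^esub> y \<otimes>\<^bsub>\<A>\<^esub> (inv\<^bsub>\<A>\<^esub> x \<otimes>\<^bsub>\<A>\<^esub> g \<otimes>\<^bsub>\<A>\<^esub> x) \<otimes>\<^bsub>\<A>\<^esub> y \<in> turn_group" if "g \<in> turn_group" for g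
    using assms that unfolding turn_normalizer_def by blast
  then show ?thesis
    using xy by (simp add: turn_normalizer_def plane.loops.word_simps turn_group_in)
qed

lemma turn_normalizerI:
  assumes "x \<in> carrier \<A>" "y \<in> carrier \<A>" "y \<otimes>\<^bsub>\<A>\<^esub> x = \<one>\<^bsub>\<A>\<^esub>"
    "\<And>s. s \<in> {side_turn, turn 0, turn 1} \<Longrightarrow> \<exists>s'\<in>turn_group. x \<otimes>\<^bsub>\<A>\<^esub> s = s' \<otimes>\<^bsub>\<A>\<^esub> x"
    "\<And>s. s \<in> {side_turn, turn 0, turn 1} \<Longrightarrow> \<exists>s'\<in>turn_group. y \<otimes>\<^bsub>\<A>\<^esub> s = s' \<otimes>\<^bsub>\<A>\<^esub> y"
  shows "x \<in> turn_normalizer"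
proof -
  have y: "y = inv\<^bsub>\<A>\<^esub> x" using assms plane.loops.inv_equality by metis
  have *: "z \<otimes>\<^bsub>\<A>\<^esub> g \<otimes>\<^bsub>\<A>\<^esub> inv\<^bsub>\<A>\<^esub> z \<in> turn_group" if g: "g \<in> turn_group" and z: "z \<in> {x, y}" for g z
  proof (rule plane.loops.conj_generate[OF turns_in _ subgroup_turn_group _ g[unfolded turn_group_def]])
    show zc: "z \<in> carrier \<A>" using z assms by auto
    fix s assume s: "s \<in> {side_turn, turn 0, turn 1}"
    then obtain s' where s': "s' \<in> turn_group" "z \<otimes>\<^bsub>\<A>\<^esub> s = s' \<otimes>\<^bsub>\<A>\<^esub> z" using assms z by blast
    have "s \<in> carrier \<A>" using s turns_in by blast
    from plane.loops.conj_eqI[OF zc this turn_group_in[OF s'(1)] s'(2)]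
    show "z \<otimes>\<^bsub>\<A>\<^esub> s \<otimes>\<^bsub>\<A>\<^esub> inv\<^bsub>\<A>\<^esub> z \<in> turn_group" using s'(1) by simp
  qed
  have "inv\<^bsub>\<A>\<^esub> x \<otimes>\<^bsub>\<A>\<^esub> g \<otimes>\<^bsub>\<A>\<^esub> x \<in> turn_group" if "g \<in> turn_group" for g
    using *[OF that, of "inv\<^bsub>\<A>\<^esub> x"] assms(1) by (simp add: y)
  then show ?thesis using assms(1) * unfolding turn_normalizer_def by blast
qed

lemma strip_elt_shear_mult: "strip_elt (shear i) \<otimes>\<^bsub>\<A>\<^esub> strip_elt (shear j) = strip_elt (shear (i + j))"
  by (simp add: strip_elt_mult strip_mapsI affine_map_comp add.commute)

lemma shear_in: "strip_elt (shear i) \<in> carrier \<A>"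
  by (simp add: strip_elt_in strip_mapsI)

lemma shear_normalizer: "strip_elt (shear m) \<in> turn_normalizer"
proof (rule turn_normalizerI[OF shear_in shear_in])
  show "strip_elt (shear (- m)) \<otimes>\<^bsub>\<A>\<^esub> strip_elt (shear m) = \<one>\<^bsub>\<A>\<^esub>"
    by (simp add: strip_elt_shear_mult strip_elt_id)
  have *: "\<exists>s'\<in>turn_group. strip_elt (shear m) \<otimes>\<^bsub>\<A>\<^esub> s = s' \<otimes>\<^bsub>\<A>\<^esub> strip_elt (shear m)"
    if "s \<in> {side_turn, turn 0, turn 1}" for s m
    using that strip_elt_turn[of 1 m 0] strip_elt_side_turn[of 0 1 m] turn_turn_group by force
  show "\<exists>s'\<in>turn_group. strip_elt (shear m) \<otimes>\<^bsub>\<A>\<^esub> s = s' \<otimes>\<^bsub>\<A>\<^esub> strip_elt (shear m)"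
    if "s \<in> {side_turn, turn 0, turn 1}" for s using *[OF that] .
  show "\<exists>s'\<in>turn_group. strip_elt (shear (- m)) \<otimes>\<^bsub>\<A>\<^esub> s = s' \<otimes>\<^bsub>\<A>\<^esub> strip_elt (shear (- m))"
    if "s \<in> {side_turn, turn 0, turn 1}" for s using *[OF that] .
qed

text \<open>Conjugation by the swap exchanges \<open>side_turn\<close> and \<open>turn 0\<close> and
  fixes \<open>turn 1\<close>.\<close>

lemma swap_normalizer: "swap_elt \<in> turn_normalizer"
proof -
  have "swap_elt \<otimes>\<^bsub>\<A>\<^esub> side_turn = turn 0 \<otimes>\<^bsub>\<A>\<^esub> swap_elt"
  proof -
    have "swap_elt \<otimes>\<^bsub>\<A>\<^esub> side_turn = swap_elt \<otimes>\<^bsub>\<A>\<^esub> (side_turn \<otimes>\<^bsub>\<A>\<^esub> swap_elt) \<otimes>\<^bsub>\<A>\<^esub> swap_elt"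
      by (simp add: plane.loops.m_assoc swap_in side_turn_in swap_swap_elt)
    also have "\<dots> = (swap_elt \<otimes>\<^bsub>\<A>\<^esub> swap_elt) \<otimes>\<^bsub>\<A>\<^esub> turn 0 \<otimes>\<^bsub>\<A>\<^esub> swap_elt"
      unfolding swap_side_turn[symmetric] by (simp add: plane.loops.m_assoc swap_in turn_in)
    finally show ?thesis by (simp add: swap_swap_elt turn_in)
  qed
  then have sw: "\<exists>s'\<in>turn_group. swap_elt \<otimes>\<^bsub>\<A>\<^esub> s = s' \<otimes>\<^bsub>\<A>\<^esub> swap_elt"
    if "s \<in> {side_turn, turn 0, turn 1}" for s
    using that swap_turn_1 swap_side_turn turn_turn_group by auto
  show ?thesis by (rule turn_normalizerI[OF swap_in swap_in swap_swap_elt sw sw])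
qed

text \<open>This is the Euclidean algorithm: from an element for (q mod p, p) the swap yields (p, q
  mod p), and the shear by \<open>q div p\<close> then yields (p, q).\<close>

lemma normalizer_primitive:
  assumes "coprime p q"
  shows "\<exists>h\<in>turn_normalizer. lin (fst h) (0, 1) = (of_int p, of_int q)
    \<or> lin (fst h) (0, 1) = - (of_int p, of_int q)"
  using assms
proof (induction "nat \<bar>p\<bar>" arbitrary: p q rule: less_induct)
  case less
  show ?case
  proof (cases "p = 0")
    case True
    then have "\<bar>q\<bar> = 1" using less.prems by simp
    moreover have "strip_elt (shear 0) \<in> turn_normalizer" by (rule shear_normalizer)
    ultimately show ?thesis using True
      by (intro bexI[of _ "strip_elt (shear 0)"]) (auto simp: lin_affine_map)
  next
    case False
    have "nat \<bar>q mod p\<bar> < nat \<bar>p\<bar>" using False abs_mod_less by simp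
    moreover have "coprime (q mod p) p"
      using less.prems coprime_mod_left_iff[OF False] coprime_commute by metis
    ultimately obtain h where h: "h \<in> turn_normalizer"
      "lin (fst h) (0, 1) = (of_int (q mod p), of_int p) \<or> lin (fst h) (0, 1) = - (of_int (q mod p), of_int p)"
      using less.hyps[of "q mod p" p] by blast
    let ?x = "strip_elt (shear (q div p))"
    have "(?x \<otimes>\<^bsub>\<A>\<^esub> swap_elt) \<otimes>\<^bsub>\<A>\<^esub> h \<in> turn_normalizer"
      by (intro turn_normalizer_mult shear_normalizer swap_normalizer h)
    moreover have sh: "shear (q div p) \<in> Aff" by (rule affine_map_in_Aff) simp
    have "real_of_int (q div p) * real_of_int p + real_of_int (q mod p) = real_of_int q"
      by (metis div_mult_mod_eq of_int_add of_int_mult)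
    then have "lin (fst ((?x \<otimes>\<^bsub>\<A>\<^esub> swap_elt) \<otimes>\<^bsub>\<A>\<^esub> h)) (0, 1) = (of_int p, of_int q)
       \<or> lin (fst ((?x \<otimes>\<^bsub>\<A>\<^esub> swap_elt) \<otimes>\<^bsub>\<A>\<^esub> h)) (0, 1) = - (of_int p, of_int q)"
      using h(2) unfolding plane.fst_mult fst_strip_elt fst_swap_elt
        lin_comp[OF comp_in_Aff[OF sh swap_Aff]] lin_comp[OF sh]
      by (auto simp: swap_map_def lin_affine_map)
    ultimately show ?thesis by blast
  qed
qed

lemma normalizer_slope: obtains h where "h \<in> turn_normalizer" "carries (fst h) Slope_Infty t"
proof -
  obtain p q where "slope_vec t = (p, q)" by fastforce
  then show thesis
    using normalizer_primitive[OF coprime_slope_vec] that slope_dir_eq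
    unfolding carries_def slope_dir_infty by metis
qed

text \<open>A line loop of slope \<open>t\<close> is determined up to inversion and conjugation in the fundamental
  group of \<open>O\<close>: two maps carrying \<open>\<infinity>\<close> to \<open>t\<close> differ by a map commuting, up to sign, with the
  vertical translations.\<close>

lemma line_loops_conjugate:
  assumes y: "y \<in> line_loops (of_int k) t" and h: "h \<in> carrier \<A>" "carries (fst h) Slope_Infty t"
  obtains g e where "g \<in> signed_loops 1"
    "y = g \<otimes>\<^bsub>\<A>\<^esub> (h \<otimes>\<^bsub>\<A>\<^esub> vertical_loop e \<otimes>\<^bsub>\<A>\<^esub> inv\<^bsub>\<A>\<^esub> h) \<otimes>\<^bsub>\<A>\<^esub> inv\<^bsub>\<A>\<^esub> g"
proof -
  obtain h1 where h1: "y = h1 \<otimes>\<^bsub>\<A>\<^esub> vertical_loop k \<otimes>\<^bsub>\<A>\<^esub> inv\<^bsub>\<A>\<^esub> h1" "h1 \<in> carrier \<A>"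
    "carries (fst h1) Slope_Infty t"
    using y unfolding line_loops_eq by blast
  \<comment> \<open>\<open>z\<close> fixes the slope infinity, so its linear part is lower
    triangular with diagonal entries 1 or -1.\<close>
  define z where "z = inv\<^bsub>\<A>\<^esub> h \<otimes>\<^bsub>\<A>\<^esub> h1"
  have z: "z \<in> carrier \<A>" using h h1 by (simp add: z_def)
  have "carries (fst (inv\<^bsub>\<A>\<^esub> h)) t Slope_Infty"
    using carries_inverse[OF plane.fst_in plane.fst_inv(1)[OF h(1)] h(2)] h(1) by simp
  then have "carries (fst z) Slope_Infty Slope_Infty"
    using carries_comp[OF plane.fst_in h1(3)] h(1) by (simp add: z_def plane.fst_mult)
  moreover obtain a b c d i j where f: "fst z = affine_map a b c d i j" "\<bar>a * d - b * c\<bar> = 1"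
    using plane.fst_in[OF z] by (auto simp: Aff_def)
  ultimately have "b = 0" by (auto simp: carries_def slope_dir_infty lin_affine_map)
  then have "\<bar>a\<bar> * \<bar>d\<bar> = 1" using f(2) by (simp add: abs_mult)
  then have a: "\<bar>a\<bar> = 1" "\<bar>d\<bar> = 1" by (metis abs_ge_zero zmult_eq_1_iff not_numeral_le_zero
    abs_abs abs_eq_iff' abs_one)+
  then have aa: "a * a = 1" by (metis abs_mult_self_eq mult_1)
  \<comment> \<open>Factoring the sign \<open>a\<close> out of the linear part leaves a strip map,
    which conjugates vertical loops to vertical loops; the other factor \<open>w\<close> lies in the
    group of O.\<close>
  define u where "u = strip_elt (affine_map 1 0 (c * a) (a * d) 0 0)"
  have e: "\<bar>a * d\<bar> = 1" using a by (simp add: abs_mult)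
  have u: "u \<in> carrier \<A>" using e by (simp add: u_def strip_elt_in strip_mapsI)
  define w where "w = z \<otimes>\<^bsub>\<A>\<^esub> inv\<^bsub>\<A>\<^esub> u"
  have "fst z = affine_map a 0 0 a i j \<circ> fst u"
    by (simp add: f(1) \<open>b = 0\<close> u_def affine_map_comp aa mult.commute[of c] flip: mult.assoc)
  then have "fst w = affine_map a 0 0 a i j"
    using plane.fst_inv(2)[OF u] by (simp add: w_def plane.fst_mult comp_assoc)
  then have w: "w \<in> signed_loops 1"
    using a z u unfolding signed_loops_def signed_translations_def
    by (auto simp: w_def abs_if split: if_splits)
  have zw: "z = w \<otimes>\<^bsub>\<A>\<^esub> u" using z u by (simp add: w_def plane.loops.m_assoc)
  have "u \<otimes>\<^bsub>\<A>\<^esub> vertical_loop k \<otimes>\<^bsub>\<A>\<^esub> inv\<^bsub>\<A>\<^esub> u = vertical_loop (a * d * k)"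
    using strip_elt_vertical_loop[OF e] u unfolding u_def
    by (intro plane.loops.conj_eqI vertical_loop_in) auto
  then have zv: "z \<otimes>\<^bsub>\<A>\<^esub> vertical_loop k \<otimes>\<^bsub>\<A>\<^esub> inv\<^bsub>\<A>\<^esub> z = w \<otimes>\<^bsub>\<A>\<^esub> vertical_loop (a * d * k) \<otimes>\<^bsub>\<A>\<^esub> inv\<^bsub>\<A>\<^esub> w"
    using plane.loops.conj_conj[OF signed_loopsD[OF w] u vertical_loop_in, of k] by (simp add: zw)
  have "h1 = h \<otimes>\<^bsub>\<A>\<^esub> z" using h h1 by (simp add: z_def plane.loops.mult_inv_cancel_left)
  then have "y = h \<otimes>\<^bsub>\<A>\<^esub> (w \<otimes>\<^bsub>\<A>\<^esub> vertical_loop (a * d * k) \<otimes>\<^bsub>\<A>\<^esub> inv\<^bsub>\<A>\<^esub> w) \<otimes>\<^bsub>\<A>\<^esub> inv\<^bsub>\<A>\<^esub> h"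
    using plane.loops.conj_conj[OF h(1) z vertical_loop_in, of k] by (simp add: h1(1) flip: zv)
  \<comment> \<open>Moving \<open>h\<close> past \<open>w\<close> replaces \<open>w\<close> by h w
    h^-1, which is still in the group of O by normality.\<close>
  also have "\<dots> = (h \<otimes>\<^bsub>\<A>\<^esub> w \<otimes>\<^bsub>\<A>\<^esub> inv\<^bsub>\<A>\<^esub> h) \<otimes>\<^bsub>\<A>\<^esub> (h \<otimes>\<^bsub>\<A>\<^esub> vertical_loop (a * d * k) \<otimes>\<^bsub>\<A>\<^esub> inv\<^bsub>\<A>\<^esub> h)
      \<otimes>\<^bsub>\<A>\<^esub> inv\<^bsub>\<A>\<^esub> (h \<otimes>\<^bsub>\<A>\<^esub> w \<otimes>\<^bsub>\<A>\<^esub> inv\<^bsub>\<A>\<^esub> h)"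
    using h signed_loopsD[OF w] by (simp add: plane.loops.word_simps vertical_loop_in)
  finally show thesis using that signed_loops_conj[OF _ h(1) w] by simp
qed

section \<open>The Heckoid kernel and the elements normalising it\<close>

definition loop_kernel :: "slope \<Rightarrow> int \<Rightarrow> loop set" where
  "loop_kernel r m = normal_closure pi1_O (line_loops (of_int 2) Slope_Infty \<union> line_loops (of_int m) r)"

lemma loop_kernel:
  shows loop_kernel_normal: "loop_kernel r m \<lhd> pi1_O"
    and line_loops_kernel: "line_loops (of_int 2) Slope_Infty \<subseteq> loop_kernel r m"
      "line_loops (of_int m) r \<subseteq> loop_kernel r m"
proof -
  interpret O: group pi1_O by (rule group_pi1)
  have "line_loops (of_int 2) Slope_Infty \<union> line_loops (of_int m) r \<subseteq> carrier pi1_O"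
    using line_loops_signed[of 1] by (auto simp: pi1_eq simp del: of_int_numeral)
  from O.normal_closure_normal[OF this]
  show "loop_kernel r m \<lhd> pi1_O" "line_loops (of_int 2) Slope_Infty \<subseteq> loop_kernel r m"
      "line_loops (of_int m) r \<subseteq> loop_kernel r m"
    unfolding loop_kernel_def by auto
qed

lemma loop_kernel_least:
  "N \<lhd> pi1_O \<Longrightarrow> line_loops (of_int 2) Slope_Infty \<subseteq> N \<Longrightarrow> line_loops (of_int m) r \<subseteq> N \<Longrightarrow>
    loop_kernel r m \<subseteq> N"
  unfolding loop_kernel_def using group.normal_closure_least[OF group_pi1(1)] by simp

text \<open>It suffices to know the action on \<open>turn_group\<close>, since this group contains representatives
  of the line loops of every slope.\<close>

lemma trivial_action_preserves_kernel:
  assumes x: "x \<in> carrier \<A>"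
    and triv: "\<And>g. g \<in> turn_group \<Longrightarrow>
      x \<otimes>\<^bsub>\<A>\<^esub> g \<otimes>\<^bsub>\<A>\<^esub> inv\<^bsub>\<A>\<^esub> x \<otimes>\<^bsub>\<A>\<^esub> inv\<^bsub>\<A>\<^esub> g \<in> loop_kernel r m"
    and y: "y \<in> loop_kernel r m"
  shows "x \<otimes>\<^bsub>\<A>\<^esub> y \<otimes>\<^bsub>\<A>\<^esub> inv\<^bsub>\<A>\<^esub> x \<in> loop_kernel r m"
proof -
  let ?N = "loop_kernel r m"
  note N' = loop_kernel_normal[of r m, unfolded normal_pi1_O_iff]
  interpret N: subgroup ?N \<A> using N' by blast
  have "x \<otimes>\<^bsub>\<A>\<^esub> y \<otimes>\<^bsub>\<A>\<^esub> inv\<^bsub>\<A>\<^esub> x \<in> ?N"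
    if yN: "y \<in> ?N" and y: "y \<in> line_loops (of_int k) t" for y k t
  proof -
    obtain h where h: "h \<in> turn_normalizer" "carries (fst h) Slope_Infty t" by (rule normalizer_slope)
    then have hc: "h \<in> carrier \<A>" by (simp add: turn_normalizer_def)
    obtain g e where g: "g \<in> signed_loops 1"
      "y = g \<otimes>\<^bsub>\<A>\<^esub> (h \<otimes>\<^bsub>\<A>\<^esub> vertical_loop e \<otimes>\<^bsub>\<A>\<^esub> inv\<^bsub>\<A>\<^esub> h) \<otimes>\<^bsub>\<A>\<^esub> inv\<^bsub>\<A>\<^esub> g"
      using line_loops_conjugate[OF y hc h(2)] by blast
    \<comment> \<open>The part of \<open>y\<close> inside \<open>turn_group\<close>, where
      \<open>triv\<close> applies. The remaining conjugator \<open>g\<close> lies in the group of O,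
      in which the kernel is normal.\<close>
    define w where "w = h \<otimes>\<^bsub>\<A>\<^esub> vertical_loop e \<otimes>\<^bsub>\<A>\<^esub> inv\<^bsub>\<A>\<^esub> h"
    have wT: "w \<in> turn_group"
      using h(1) vertical_loop_turn_group by (auto simp: w_def turn_normalizer_def)
    note wc = turn_group_in[OF wT]
    note gc = signed_loopsD[OF g(1)]
    have "inv\<^bsub>\<A>\<^esub> g \<in> signed_loops 1" using g(1) subgroup.m_inv_closed[OF subgroup_signed_loops] by blast
    then have "inv\<^bsub>\<A>\<^esub> g \<otimes>\<^bsub>\<A>\<^esub> y \<otimes>\<^bsub>\<A>\<^esub> inv\<^bsub>\<A>\<^esub> (inv\<^bsub>\<A>\<^esub> g) \<in> ?N" using N' yN by blast
    then have "w \<in> ?N" unfolding g(2) w_def[symmetric] using wc gc by (simp add: plane.loops.word_simps)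
    \<comment> \<open>Multiplying the commutator of \<open>x\<close> and \<open>w\<close> by
      \<open>w\<close> gives x w x^-1.\<close>
    then have "(x \<otimes>\<^bsub>\<A>\<^esub> w \<otimes>\<^bsub>\<A>\<^esub> inv\<^bsub>\<A>\<^esub> x \<otimes>\<^bsub>\<A>\<^esub> inv\<^bsub>\<A>\<^esub> w) \<otimes>\<^bsub>\<A>\<^esub> w \<in> ?N"
      using triv[OF wT] by simp
    then have "x \<otimes>\<^bsub>\<A>\<^esub> w \<otimes>\<^bsub>\<A>\<^esub> inv\<^bsub>\<A>\<^esub> x \<in> ?N" using wc x by (simp add: plane.loops.m_assoc)
    moreover have "x \<otimes>\<^bsub>\<A>\<^esub> g \<otimes>\<^bsub>\<A>\<^esub> inv\<^bsub>\<A>\<^esub> x \<in> signed_loops 1"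
      using signed_loops_conj[OF _ x g(1)] by simp
    ultimately have "(x \<otimes>\<^bsub>\<A>\<^esub> g \<otimes>\<^bsub>\<A>\<^esub> inv\<^bsub>\<A>\<^esub> x) \<otimes>\<^bsub>\<A>\<^esub> (x \<otimes>\<^bsub>\<A>\<^esub> w \<otimes>\<^bsub>\<A>\<^esub> inv\<^bsub>\<A>\<^esub> x)
        \<otimes>\<^bsub>\<A>\<^esub> inv\<^bsub>\<A>\<^esub> (x \<otimes>\<^bsub>\<A>\<^esub> g \<otimes>\<^bsub>\<A>\<^esub> inv\<^bsub>\<A>\<^esub> x) \<in> ?N"
      using N' by blast
    then show ?thesis unfolding g(2) w_def[symmetric] using x wc gc by (simp add: plane.loops.word_simps)
  qed
  then have sub: "line_loops (of_int k) t \<subseteq> {y \<in> signed_loops 1. x \<otimes>\<^bsub>\<A>\<^esub> y \<otimes>\<^bsub>\<A>\<^esub> inv\<^bsub>\<A>\<^esub> x \<in> ?N}"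
    if "line_loops (of_int k) t \<subseteq> ?N" for k t
    using that N' by blast
  have "loop_kernel r m \<subseteq> {y \<in> signed_loops 1. x \<otimes>\<^bsub>\<A>\<^esub> y \<otimes>\<^bsub>\<A>\<^esub> inv\<^bsub>\<A>\<^esub> x \<in> ?N}"
    by (rule loop_kernel_least[OF normal_transport_pi1_O[OF loop_kernel_normal x]
          sub[OF line_loops_kernel(1)] sub[OF line_loops_kernel(2)]])
  then show ?thesis using y by blast
qed

lemma vertical_loop_line_loop: "vertical_loop k \<in> line_loops (of_int k) Slope_Infty"
proof -
  have "carries (fst \<one>\<^bsub>\<A>\<^esub>) Slope_Infty Slope_Infty" by (simp add: plane.fst_one carries_def lin_id)
  moreover have "vertical_loop k = \<one>\<^bsub>\<A>\<^esub> \<otimes>\<^bsub>\<A>\<^esub> vertical_loop k \<otimes>\<^bsub>\<A>\<^esub> inv\<^bsub>\<A>\<^esub> \<one>\<^bsub>\<A>\<^esub>"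
    by (simp add: vertical_loop_in)
  ultimately show ?thesis unfolding line_loops_eq by blast
qed

lemma vertical_loop_multiple:
  assumes "subgroup N \<A>" "vertical_loop j \<in> N"
  shows "vertical_loop (j * l) \<in> N"
proof (induction l rule: int_induct[of _ 0])
  interpret N: subgroup N \<A> by fact
  show "vertical_loop (j * 0) \<in> N" by (simp add: vertical_loop_0)
  show "vertical_loop (j * (i + 1)) \<in> N" if "vertical_loop (j * i) \<in> N" for i
    using that assms(2) by (simp add: distrib_left vertical_loop_add)
  show "vertical_loop (j * (i - 1)) \<in> N" if "vertical_loop (j * i) \<in> N" for i
    using that assms(2) vertical_loop_add[of "j * i" "- j"]
    by (simp add: right_diff_distrib vertical_loop_minus)
qed

text \<open>Both directions of conjugation are demanded, so that inverses of stabilising elements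
  stabilise as well.\<close>

definition kernel_stabilizer :: "slope \<Rightarrow> int \<Rightarrow> loop set" where
  "kernel_stabilizer r m = {x \<in> carrier \<A>. \<forall>y\<in>loop_kernel r m.
     x \<otimes>\<^bsub>\<A>\<^esub> y \<otimes>\<^bsub>\<A>\<^esub> inv\<^bsub>\<A>\<^esub> x \<in> loop_kernel r m \<and> inv\<^bsub>\<A>\<^esub> x \<otimes>\<^bsub>\<A>\<^esub> y \<otimes>\<^bsub>\<A>\<^esub> x \<in> loop_kernel r m}"

lemma loop_kernel_in: "y \<in> loop_kernel r m \<Longrightarrow> y \<in> carrier \<A>"
  using loop_kernel_normal[of r m] signed_loops_subset unfolding normal_pi1_O_iff by blast

lemma kernel_stabilizerI:
  assumes x: "x \<in> carrier \<A>"
    and "\<And>g. g \<in> turn_group \<Longrightarrow> x \<otimes>\<^bsub>\<A>\<^esub> g \<otimes>\<^bsub>\<A>\<^esub> inv\<^bsub>\<A>\<^esub> x \<otimes>\<^bsub>\<A>\<^esub> inv\<^bsub>\<A>\<^esub> g \<in> loop_kernel r m"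
    and "\<And>g. g \<in> turn_group \<Longrightarrow> inv\<^bsub>\<A>\<^esub> x \<otimes>\<^bsub>\<A>\<^esub> g \<otimes>\<^bsub>\<A>\<^esub> x \<otimes>\<^bsub>\<A>\<^esub> inv\<^bsub>\<A>\<^esub> g \<in> loop_kernel r m"
  shows "x \<in> kernel_stabilizer r m"
  using trivial_action_preserves_kernel[of x r m] trivial_action_preserves_kernel[of "inv\<^bsub>\<A>\<^esub> x" r m] assms
  by (simp add: kernel_stabilizer_def)

lemma kernel_stabilizer_mult:
  assumes "x \<in> kernel_stabilizer r m" "y \<in> kernel_stabilizer r m"
  shows "x \<otimes>\<^bsub>\<A>\<^esub> y \<in> kernel_stabilizer r m"
proof -
  have xy: "x \<in> carrier \<A>" "y \<in> carrier \<A>" using assms by (auto simp: kernel_stabilizer_def)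
  have "x \<otimes>\<^bsub>\<A>\<^esub> (y \<otimes>\<^bsub>\<A>\<^esub> g \<otimes>\<^bsub>\<A>\<^esub> inv\<^bsub>\<A>\<^esub> y) \<otimes>\<^bsub>\<A>\<^esub> inv\<^bsub>\<A>\<^esub> x \<in> loop_kernel r m
     \<and> inv\<^bsub>\<A>\<^esub> y \<otimes>\<^bsub>\<A>\<^esub> (inv\<^bsub>\<A>\<^esub> x \<otimes>\<^bsub>\<A>\<^esub> g \<otimes>\<^bsub>\<A>\<^esub> x) \<otimes>\<^bsub>\<A>\<^esub> y \<in> loop_kernel r m" if "g \<in> loop_kernel r m" for g
    using assms that unfolding kernel_stabilizer_def by blast
  then show ?thesis
    using xy by (simp add: kernel_stabilizer_def plane.loops.word_simps loop_kernel_in)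
qed

lemma kernel_stabilizer_inv: "x \<in> kernel_stabilizer r m \<Longrightarrow> inv\<^bsub>\<A>\<^esub> x \<in> kernel_stabilizer r m"
  by (simp add: kernel_stabilizer_def)

text \<open>With \<open>c = 2 * k\<close>, \<open>e = -1\<close> and \<open>i = 1\<close> the
  vertical loops in \<open>strip_elt_acts_trivially\<close> have the exponents 2k + 2 and 2k, so
  both are powers of \<open>\<beta>\<^sub>\<infinity>\<^sup>2\<close>. The element is an involution,
  which settles its inverse.\<close>

lemma reflection_stabilizes:
  "strip_elt (affine_map 1 0 (2 * k) (- 1) 0 1) \<in> kernel_stabilizer r m" (is "?x \<in> _")
proof -
  note N' = loop_kernel_normal[of r m, unfolded normal_pi1_O_iff]
  have x: "?x \<in> carrier \<A>" by (intro strip_elt_in strip_mapsI) simp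
  have "?x \<otimes>\<^bsub>\<A>\<^esub> ?x = \<one>\<^bsub>\<A>\<^esub>"
    by (simp add: strip_elt_mult strip_mapsI affine_map_comp strip_elt_id)
  then have inv: "inv\<^bsub>\<A>\<^esub> ?x = ?x" using x by (intro plane.loops.inv_equality)
  have v: "vertical_loop (2 * l) \<in> loop_kernel r m" for l
    using vertical_loop_multiple[of _ 2 l] N' vertical_loop_line_loop[of 2] line_loops_kernel(1) by blast
  have "?x \<otimes>\<^bsub>\<A>\<^esub> g \<otimes>\<^bsub>\<A>\<^esub> inv\<^bsub>\<A>\<^esub> ?x \<otimes>\<^bsub>\<A>\<^esub> inv\<^bsub>\<A>\<^esub> g \<in> loop_kernel r m" if "g \<in> turn_group" for g
    using strip_elt_acts_trivially[OF loop_kernel_normal, of 1 "-1" "2 * k"] v[of "k + 1"] v[of k] that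
    by (simp add: algebra_simps)
  then show ?thesis using x by (intro kernel_stabilizerI) (auto simp: inv)
qed

text \<open>With N the kernel, h^-1 N h is normal in the group of O and contains
  \<open>\<beta>\<^sub>\<infinity>\<^sup>m\<close>, so the shear acts trivially modulo it on
  \<open>turn_group\<close>. As \<open>h\<close> normalises \<open>turn_group\<close>, conjugating
  by \<open>h\<close> gives a trivial action modulo N.\<close>

lemma shear_conj_stabilizes:
  assumes h: "h \<in> turn_normalizer" "carries (fst h) Slope_Infty r" and m: "m dvd l"
  shows "h \<otimes>\<^bsub>\<A>\<^esub> strip_elt (shear l) \<otimes>\<^bsub>\<A>\<^esub> inv\<^bsub>\<A>\<^esub> h \<in> kernel_stabilizer r m"
proof -
  let ?x = "\<lambda>l. h \<otimes>\<^bsub>\<A>\<^esub> strip_elt (shear l) \<otimes>\<^bsub>\<A>\<^esub> inv\<^bsub>\<A>\<^esub> h"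
  have hc: "h \<in> carrier \<A>" using h by (simp add: turn_normalizer_def)
  note N = normal_transport_pi1_O[OF loop_kernel_normal[of r m] hc]
  note N' = N[unfolded normal_pi1_O_iff]
  have "vertical_loop m \<in> signed_loops 1"
    using line_loops_signed[of 1] vertical_loop_line_loop by (metis one_dvd subsetD)
  moreover have "h \<otimes>\<^bsub>\<A>\<^esub> vertical_loop m \<otimes>\<^bsub>\<A>\<^esub> inv\<^bsub>\<A>\<^esub> h \<in> loop_kernel r m"
    using line_loops_conj[OF hc h(2) vertical_loop_line_loop] line_loops_kernel(2) by blast
  ultimately have v: "vertical_loop (m * j) \<in> {y \<in> signed_loops 1.
      h \<otimes>\<^bsub>\<A>\<^esub> y \<otimes>\<^bsub>\<A>\<^esub> inv\<^bsub>\<A>\<^esub> h \<in> loop_kernel r m}" for j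
    using vertical_loop_multiple[of _ m j] N' by blast
  have triv: "?x l \<otimes>\<^bsub>\<A>\<^esub> g \<otimes>\<^bsub>\<A>\<^esub> inv\<^bsub>\<A>\<^esub> ?x l \<otimes>\<^bsub>\<A>\<^esub> inv\<^bsub>\<A>\<^esub> g \<in> loop_kernel r m"
    if g: "g \<in> turn_group" and l: "m dvd l" for g l
  proof -
    obtain j where "l = m * j" using l by blast
    then have vl: "vertical_loop l \<in> {y \<in> signed_loops 1. h \<otimes>\<^bsub>\<A>\<^esub> y \<otimes>\<^bsub>\<A>\<^esub> inv\<^bsub>\<A>\<^esub> h \<in> loop_kernel r m}"
      using v by simp
    define g' where "g' = inv\<^bsub>\<A>\<^esub> h \<otimes>\<^bsub>\<A>\<^esub> g \<otimes>\<^bsub>\<A>\<^esub> h"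
    have g': "g' \<in> turn_group" using g h(1) by (simp add: g'_def turn_normalizer_def)
    have "h \<otimes>\<^bsub>\<A>\<^esub> (strip_elt (shear l) \<otimes>\<^bsub>\<A>\<^esub> g' \<otimes>\<^bsub>\<A>\<^esub> inv\<^bsub>\<A>\<^esub> strip_elt (shear l) \<otimes>\<^bsub>\<A>\<^esub> inv\<^bsub>\<A>\<^esub> g') \<otimes>\<^bsub>\<A>\<^esub> inv\<^bsub>\<A>\<^esub> h
        \<in> loop_kernel r m"
      using strip_elt_acts_trivially[OF N, of 0 1 l, OF _ _ _ g'] vl by simp
    then show ?thesis
      unfolding g'_def using hc turn_group_in[OF g] shear_in[of l] by (simp add: plane.loops.word_simps)
  qed
  have "inv\<^bsub>\<A>\<^esub> strip_elt (shear l) = strip_elt (shear (- l))"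
    by (intro plane.loops.inv_equality shear_in) (simp add: strip_elt_shear_mult strip_elt_id)
  then have "inv\<^bsub>\<A>\<^esub> ?x l = ?x (- l)" "inv\<^bsub>\<A>\<^esub> ?x (- l) = ?x l"
    using hc shear_in plane.loops.inv_inv[OF shear_in, of l]
    by (simp_all add: plane.loops.word_simps)
  then show ?thesis
    using triv[OF _ m] triv[of _ "- l"] m hc shear_in
    by (intro kernel_stabilizerI) auto
qed

section \<open>Realising \<open>Gamma r n\<close> by elements that normalise the kernel\<close>

definition realized :: "slope \<Rightarrow> int \<Rightarrow> (slope \<Rightarrow> slope) \<Rightarrow> bool" where
  "realized r m \<phi> \<longleftrightarrow> (\<exists>x\<in>kernel_stabilizer r m. \<forall>w. carries (fst x) w (\<phi> w))"

lemma realized_bij: "realized r m \<phi> \<Longrightarrow> bij \<phi>"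
  unfolding realized_def kernel_stabilizer_def using carries_bij plane.fst_in by blast

text \<open>\<open>kernel_stabilizer\<close> is closed under products and inverses, and
  \<open>carries\<close> is compatible with both.\<close>

lemma realized_generate:
  assumes "\<And>\<phi>. \<phi> \<in> S \<Longrightarrow> realized r m \<phi>" "\<psi> \<in> generate (BijGroup UNIV) S"
  shows "realized r m \<psi>"
  using assms(2)
proof (induction rule: generate.induct)
  case one
  have "\<one>\<^bsub>\<A>\<^esub> \<in> kernel_stabilizer r m" by (simp add: kernel_stabilizer_def loop_kernel_in)
  moreover have "carries (fst \<one>\<^bsub>\<A>\<^esub>) w (\<one>\<^bsub>BijGroup UNIV\<^esub> w)" for w
    by (simp add: plane.fst_one carries_def lin_id BijGroup_def)
  ultimately show ?case unfolding realized_def by blast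
next
  case (incl \<phi>)
  then show ?case by (rule assms(1))
next
  case (inv \<phi>)
  note r = assms(1)[OF inv]
  then obtain x where x: "x \<in> kernel_stabilizer r m" "\<And>w. carries (fst x) w (\<phi> w)"
    unfolding realized_def by blast
  then have xc: "x \<in> carrier \<A>" by (simp add: kernel_stabilizer_def)
  have b: "bij \<phi>" by (rule realized_bij[OF r])
  then have "\<phi> \<in> Bij UNIV" by (simp add: Bij_def extensional_def)
  then have i: "inv\<^bsub>BijGroup UNIV\<^esub> \<phi> = inv_into UNIV \<phi>" by (simp add: inv_BijGroup restrict_def)
  have "carries (fst (inv\<^bsub>\<A>\<^esub> x)) w (inv_into UNIV \<phi> w)" for w
  proof (rule carries_inverse[OF plane.fst_in plane.fst_inv(1)[OF xc]])
    show "inv\<^bsub>\<A>\<^esub> x \<in> carrier \<A>" using xc by simp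
    show "carries (fst x) (inv_into UNIV \<phi> w) w"
      using x(2)[of "inv_into UNIV \<phi> w"] b by (simp add: bij_is_surj surj_f_inv_f)
  qed
  then show ?case unfolding realized_def i using kernel_stabilizer_inv[OF x(1)] by blast
next
  case (eng \<phi> \<psi>)
  have "\<phi> \<in> Bij UNIV" "\<psi> \<in> Bij UNIV"
    using eng.IH realized_bij by (auto simp: Bij_def extensional_def)
  then have c: "\<phi> \<otimes>\<^bsub>BijGroup UNIV\<^esub> \<psi> = \<phi> \<circ> \<psi>"
    by (auto simp: BijGroup_def restrict_def compose_def)
  obtain x y where x: "x \<in> kernel_stabilizer r m" "\<And>w. carries (fst x) w (\<phi> w)"
    and y: "y \<in> kernel_stabilizer r m" "\<And>w. carries (fst y) w (\<psi> w)"
    using eng.IH unfolding realized_def by blast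
  have "x \<in> carrier \<A>" using x by (simp add: kernel_stabilizer_def)
  then have "carries (fst (x \<otimes>\<^bsub>\<A>\<^esub> y)) w ((\<phi> \<circ> \<psi>) w)" for w
    using carries_comp[OF plane.fst_in y(2) x(2)] by (simp add: plane.fst_mult)
  then show ?case unfolding realized_def c using kernel_stabilizer_mult[OF x(1) y(1)] by blast
qed

lemma realized_Gamma:
  assumes "\<psi> \<in> Gamma r n"
  shows "realized (Slope r) \<lfloor>2 * n\<rfloor> \<psi>"
proof (rule realized_generate[OF _ assms[unfolded Gamma_def]])
  let ?R = "realized (Slope r) \<lfloor>2 * n\<rfloor>"
  have G: "?R (geodesic_reflection Slope_Infty v)" if "farey_edge Slope_Infty v" for v
    using farey_reflection_carried[OF that] reflection_stabilizes unfolding realized_def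
    by (metis fst_strip_elt)
  have C: "?R (parabolic_shift (Slope r) \<lfloor>2 * n\<rfloor>)"
  proof -
    obtain h where h: "h \<in> turn_normalizer" "carries (fst h) Slope_Infty (Slope r)"
      by (rule normalizer_slope)
    then have hc: "h \<in> carrier \<A>" by (simp add: turn_normalizer_def)
    obtain e :: int where "\<bar>e\<bar> = 1"
      "\<And>m w. carries (fst h \<circ> shear (e * m) \<circ> fst (inv\<^bsub>\<A>\<^esub> h)) w (parabolic_shift (Slope r) m w)"
      using parabolic_shift_carried[OF plane.fst_in[OF hc] h(2) plane.fst_in plane.fst_inv(2)[OF hc]]
        plane.loops.inv_closed[OF hc] by blast
    \<comment> \<open>The sign \<open>e\<close> comes from the determinant of the map of
      \<open>h\<close>; the shear parameter is still a multiple of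
      \<open>\<lfloor>2 * n\<rfloor>\<close>, as \<open>shear_conj_stabilizes\<close>
      demands.\<close>
    then show ?thesis
      using shear_conj_stabilizes[OF h, of "\<lfloor>2 * n\<rfloor>" "e * \<lfloor>2 * n\<rfloor>"]
      unfolding realized_def
      by (intro bexI[of _ "h \<otimes>\<^bsub>\<A>\<^esub> strip_elt (shear (e * \<lfloor>2 * n\<rfloor>)) \<otimes>\<^bsub>\<A>\<^esub> inv\<^bsub>\<A>\<^esub> h"])
        (simp_all only: plane.fst_mult fst_strip_elt dvd_triv_right simp_thms)
  qed
  show "?R \<phi>" if "\<phi> \<in> Gamma_infty \<union> C_shift (Slope r) \<lfloor>2 * n\<rfloor>" for \<phi>
    using that
  proof
    assume "\<phi> \<in> Gamma_infty"
    then show ?thesis unfolding Gamma_infty_def by (rule realized_generate[rotated]) (use G in auto)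
  next
    assume "\<phi> \<in> C_shift (Slope r) \<lfloor>2 * n\<rfloor>"
    then show ?thesis unfolding C_shift_def by (rule realized_generate[rotated]) (use C in auto)
  qed
qed

text \<open>An element that normalises the kernel and carries infinity to \<open>s\<close>
  conjugates the loops of slope \<open>s\<close> back to loops of slope infinity, which are
  relators.\<close>

lemma orbit_line_loops:
  assumes "s \<in> orbit_infty r n"
  shows "line_loops (of_int 2) s \<subseteq> loop_kernel (Slope r) \<lfloor>2 * n\<rfloor>"
proof
  fix y assume y: "y \<in> line_loops (of_int 2) s"
  obtain x where x: "x \<in> kernel_stabilizer (Slope r) \<lfloor>2 * n\<rfloor>" "carries (fst x) Slope_Infty s"
    using assms realized_Gamma unfolding orbit_infty_def realized_def by blast
  then have xc: "x \<in> carrier \<A>" by (simp add: kernel_stabilizer_def)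
  have ic: "inv\<^bsub>\<A>\<^esub> x \<in> carrier \<A>" using xc by simp
  have "carries (fst (inv\<^bsub>\<A>\<^esub> x)) s Slope_Infty"
    using carries_inverse[OF plane.fst_in[OF ic] plane.fst_inv(1)[OF xc] x(2)] .
  from line_loops_conj[OF ic this y]
  have "inv\<^bsub>\<A>\<^esub> x \<otimes>\<^bsub>\<A>\<^esub> y \<otimes>\<^bsub>\<A>\<^esub> x \<in> loop_kernel (Slope r) \<lfloor>2 * n\<rfloor>"
    using line_loops_kernel(1) xc by auto
  then have "x \<otimes>\<^bsub>\<A>\<^esub> (inv\<^bsub>\<A>\<^esub> x \<otimes>\<^bsub>\<A>\<^esub> y \<otimes>\<^bsub>\<A>\<^esub> x) \<otimes>\<^bsub>\<A>\<^esub> inv\<^bsub>\<A>\<^esub> x \<in> loop_kernel (Slope r) \<lfloor>2 * n\<rfloor>"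
    using x(1) by (simp add: kernel_stabilizer_def)
  moreover have "y \<in> carrier \<A>" using y line_loops_in by blast
  ultimately show "y \<in> loop_kernel (Slope r) \<lfloor>2 * n\<rfloor>"
    using xc by (simp add: plane.loops.word_simps)
qed

section \<open>Quotients and meridian pairs\<close>

lemma signed_loops_normal_pi1_O: "signed_loops 2 \<lhd> pi1_O"
  unfolding normal_pi1_O_iff
  by (intro conjI ballI subgroup_signed_loops signed_loops_2_subset signed_loops_conj[OF dvd_refl])
     (rule signed_loopsD)

text \<open>As \<open>m\<close> is even, the relators lie in the group of S. Elements of the group
  of O have linear part 1 or -1 and so preserve the line loops of each slope under conjugation;
  hence the closure in the group of S is already normal in that of O.\<close>

lemma normal_closure_pi1_S:
  assumes "2 dvd m"
  shows "normal_closure pi1_S (line_loops (of_int 2) Slope_Infty \<union> line_loops (of_int m) r)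
    = loop_kernel r m" (is "?K = _")
proof
  interpret S: group pi1_S by (rule group_pi1)
  note l2 = line_loops_signed[of 2 2 Slope_Infty, OF dvd_refl] line_loops_signed[OF assms, of r]
  have "line_loops (of_int 2) Slope_Infty \<union> line_loops (of_int m) r \<subseteq> carrier pi1_S"
    using l2 by (simp add: pi1_eq)
  note K = S.normal_closure_normal[OF this]
  have "loop_kernel r m \<subseteq> signed_loops 2"
    using l2 by (intro loop_kernel_least signed_loops_normal_pi1_O)
  then have "loop_kernel r m \<lhd> pi1_S"
    using loop_kernel_normal[of r m] signed_loops_2_subset
    unfolding normal_pi1_S_iff normal_pi1_O_iff by blast
  then show "?K \<subseteq> loop_kernel r m"
    using line_loops_kernel by (intro S.normal_closure_least) auto
  note K' = K(1)[unfolded normal_pi1_S_iff]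
  have "x \<otimes>\<^bsub>\<A>\<^esub> n \<otimes>\<^bsub>\<A>\<^esub> inv\<^bsub>\<A>\<^esub> x \<in> ?K" if x: "x \<in> signed_loops 1" and n: "n \<in> ?K" for x n
  proof -
    have xc: "x \<in> carrier \<A>" using x by (rule signed_loopsD)
    have sub: "line_loops (of_int k) t \<subseteq> {y \<in> signed_loops 2. x \<otimes>\<^bsub>\<A>\<^esub> y \<otimes>\<^bsub>\<A>\<^esub> inv\<^bsub>\<A>\<^esub> x \<in> ?K}"
      if "line_loops (of_int k) t \<subseteq> ?K" for k t
      using that K' line_loops_conj[OF xc signed_loops_carries[OF x]] by blast
    have "?K \<subseteq> {y \<in> signed_loops 2. x \<otimes>\<^bsub>\<A>\<^esub> y \<otimes>\<^bsub>\<A>\<^esub> inv\<^bsub>\<A>\<^esub> x \<in> ?K}"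
      by (rule S.normal_closure_least[OF normal_transport_pi1_S[OF K(1) xc]])
         (intro Un_least sub Un_subset_iff[THEN iffD1, OF K(2), THEN conjunct1]
           Un_subset_iff[THEN iffD1, OF K(2), THEN conjunct2])
    then show ?thesis using n by blast
  qed
  then have "?K \<lhd> pi1_O"
    using K' signed_loops_2_subset unfolding normal_pi1_O_iff by blast
  then show "loop_kernel r m \<subseteq> ?K"
    using K(2) by (intro loop_kernel_least) auto
qed

lemma link_kernel_eq:
  "link_kernel s = normal_closure pi1_S (line_loops (of_int 2) Slope_Infty \<union> line_loops (of_int 2) s)"
  by (simp only: link_kernel_def powers_in_pi1)

lemma odd_heckoid_kernel_eq: "m \<ge> 0 \<Longrightarrow> odd_heckoid_kernel r (nat m) = loop_kernel (Slope r) m"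
  by (simp add: odd_heckoid_kernel_def loop_kernel_def powers_in_pi1)

lemma even_heckoid_kernel_eq:
  "k \<ge> 0 \<Longrightarrow> even_heckoid_kernel r (nat k) = loop_kernel (Slope r) (2 * k)"
  using normal_closure_pi1_S[of "2 * k" "Slope r"]
  unfolding even_heckoid_kernel_def powers_in_pi1(2)
  unfolding powers_in_pi1(3) by simp

lemma r_coset_pi1: "K #>\<^bsub>pi1_O\<^esub> x = K #>\<^bsub>\<A>\<^esub> x" "K #>\<^bsub>pi1_S\<^esub> x = K #>\<^bsub>\<A>\<^esub> x"
  by (simp_all add: pi1_eq r_coset_def)

text \<open>For integral \<open>n\<close> the kernel is \<open>N\<close> by
  \<open>even_heckoid_kernel_eq\<close>, and the quotient of the group of S consists of the same
  cosets as its image in the quotient of the group of O. One argument then treats both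
  parities.\<close>

lemma heckoid_eq:
  fixes r n :: rat
  assumes n: "n > 1" "2 * n \<in> \<int>"
  defines "N \<equiv> loop_kernel (Slope r) \<lfloor>2 * n\<rfloor>"
  shows "heckoid_proj r n = (\<lambda>x. N #>\<^bsub>\<A>\<^esub> x)"
    "heckoid_group r n = (pi1_O Mod N)\<lparr>carrier := (\<lambda>x. N #>\<^bsub>\<A>\<^esub> x) ` signed_loops 2\<rparr>"
proof -
  have "heckoid_proj r n = (\<lambda>x. N #>\<^bsub>\<A>\<^esub> x) \<and>
    heckoid_group r n = (pi1_O Mod N)\<lparr>carrier := (\<lambda>x. N #>\<^bsub>\<A>\<^esub> x) ` signed_loops 2\<rparr>"
  proof (cases "n \<in> \<int>")
    case True
    then obtain k where k: "n = of_int k" by (auto elim: Ints_cases)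
    then have "k \<ge> 0" "\<lfloor>2 * n\<rfloor> = 2 * k" using n by (simp, linarith)
    then have e: "even_heckoid_kernel r (nat \<lfloor>n\<rfloor>) = N"
      using even_heckoid_kernel_eq k by (simp add: N_def)
    have "RCOSETS pi1_S N = (\<lambda>x. N #>\<^bsub>\<A>\<^esub> x) ` signed_loops 2"
      by (auto simp: RCOSETS_def r_coset_pi1 pi1_eq(2) simp flip: r_coset_pi1)
    moreover have "set_mult pi1_S = set_mult pi1_O"
      by (simp add: set_mult_def pi1_eq fun_eq_iff)
    ultimately show ?thesis
      using True e by (simp add: heckoid_proj_def heckoid_group_def r_coset_pi1 FactGroup_def fun_eq_iff)
  next
    case False
    have "\<lfloor>2 * n\<rfloor> \<ge> 0" using n by simp
    then have "odd_heckoid_kernel r (nat \<lfloor>2 * n\<rfloor>) = N"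
      unfolding N_def by (rule odd_heckoid_kernel_eq)
    then have p: "heckoid_proj r n = (\<lambda>x. N #>\<^bsub>\<A>\<^esub> x)"
      using False by (simp add: heckoid_proj_def r_coset_pi1 fun_eq_iff)
    show ?thesis
      using False \<open>odd_heckoid_kernel r (nat \<lfloor>2 * n\<rfloor>) = N\<close> unfolding p heckoid_group_def
      by (simp add: pi1_eq(2))
  qed
  then show "heckoid_proj r n = (\<lambda>x. N #>\<^bsub>\<A>\<^esub> x)"
    "heckoid_group r n = (pi1_O Mod N)\<lparr>carrier := (\<lambda>x. N #>\<^bsub>\<A>\<^esub> x) ` signed_loops 2\<rparr>" by auto
qed

section \<open>Epimorphisms from quotients and their effect on pair classes\<close>

lemma quotient_epi:
  assumes "group G" "group H" "K \<lhd> G" "\<theta> \<in> hom G H" "\<theta> ` carrier G = carrier H"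
    "\<And>k. k \<in> K \<Longrightarrow> \<theta> k = \<one>\<^bsub>H\<^esub>"
  obtains \<phi> where "\<phi> \<in> epi (G Mod K) H" "\<And>x. x \<in> carrier G \<Longrightarrow> \<phi> (K #>\<^bsub>G\<^esub> x) = \<theta> x"
proof -
  interpret G: group G by fact
  interpret H: group H by fact
  interpret K: normal K G by fact
  interpret T: group_hom G H \<theta> using assms by (simp add: group_hom_def group_hom_axioms_def)
  define \<phi> where "\<phi> = (\<lambda>C. \<theta> (SOME x. x \<in> C))"
  have \<phi>: "\<phi> (K #>\<^bsub>G\<^esub> x) = \<theta> x" if x: "x \<in> carrier G" for x
  proof -
    have "x \<in> K #>\<^bsub>G\<^esub> x" by (rule G.rcos_self[OF x K.is_subgroup])
    then have "(SOME y. y \<in> K #>\<^bsub>G\<^esub> x) \<in> K #>\<^bsub>G\<^esub> x" by (rule someI)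
    then obtain k where "k \<in> K" "(SOME y. y \<in> K #>\<^bsub>G\<^esub> x) = k \<otimes>\<^bsub>G\<^esub> x" by (auto simp: r_coset_def)
    then show ?thesis using x assms(6) by (simp add: \<phi>_def)
  qed
  have "\<phi> \<in> epi (G Mod K) H"
    unfolding epi_def mem_Collect_eq
  proof (intro conjI homI)
    show "\<phi> ` carrier (G Mod K) = carrier H"
      unfolding assms(5)[symmetric] by (force simp: FactGroup_def RCOSETS_def \<phi>)
    fix C assume C: "C \<in> carrier (G Mod K)"
    then obtain x where x: "x \<in> carrier G" "C = K #>\<^bsub>G\<^esub> x" by (auto simp: FactGroup_def RCOSETS_def)
    then show "\<phi> C \<in> carrier H" using \<phi> by simp
    fix D assume "D \<in> carrier (G Mod K)"
    then obtain y where y: "y \<in> carrier G" "D = K #>\<^bsub>G\<^esub> y" by (auto simp: FactGroup_def RCOSETS_def)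
    show "\<phi> (C \<otimes>\<^bsub>G Mod K\<^esub> D) = \<phi> C \<otimes>\<^bsub>H\<^esub> \<phi> D"
      using x y by (simp add: FactGroup_def K.rcos_sum \<phi>)
  qed
  then show thesis using that \<phi> by blast
qed

text \<open>Whichever sign occurs, \<open>\<phi>\<close> maps a generator and its inverse onto the
  given element and its inverse; surjectivity supplies all conjugating elements of
  \<open>H\<close>.\<close>

lemma pair_class_epi:
  assumes "group L" "group H" "\<phi> \<in> epi L H" "a \<in> carrier L" "b \<in> carrier L"
    "\<phi> a \<in> {a', inv\<^bsub>H\<^esub> a'}" "\<phi> b \<in> {b', inv\<^bsub>H\<^esub> b'}" "a' \<in> carrier H" "b' \<in> carrier H"
  shows "(\<lambda>P. \<phi> ` P) ` pair_class L a b = pair_class H a' b'"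
proof -
  interpret L: group L by fact
  interpret H: group H by fact
  interpret E: group_hom L H \<phi>
    using assms(3) by (simp add: group_hom_def group_hom_axioms_def epi_def L.is_group H.is_group)
  have im: "\<phi> ` {c, inv\<^bsub>L\<^esub> c} = {c', inv\<^bsub>H\<^esub> c'}"
    if "c \<in> carrier L" "c' \<in> carrier H" "\<phi> c \<in> {c', inv\<^bsub>H\<^esub> c'}" for c c'
    using that by auto
  note ab = im[OF assms(4,8,6)] im[OF assms(5,9,7)]
  have sub: "{a, inv\<^bsub>L\<^esub> a} \<subseteq> carrier L" "{b, inv\<^bsub>L\<^esub> b} \<subseteq> carrier L" using assms by auto
  have img: "\<phi> ` {g \<otimes>\<^bsub>L\<^esub> x \<otimes>\<^bsub>L\<^esub> inv\<^bsub>L\<^esub> g, g \<otimes>\<^bsub>L\<^esub> y \<otimes>\<^bsub>L\<^esub> inv\<^bsub>L\<^esub> g}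
      = {\<phi> g \<otimes>\<^bsub>H\<^esub> \<phi> x \<otimes>\<^bsub>H\<^esub> inv\<^bsub>H\<^esub> \<phi> g, \<phi> g \<otimes>\<^bsub>H\<^esub> \<phi> y \<otimes>\<^bsub>H\<^esub> inv\<^bsub>H\<^esub> \<phi> g}"
    if "g \<in> carrier L" "x \<in> {a, inv\<^bsub>L\<^esub> a}" "y \<in> {b, inv\<^bsub>L\<^esub> b}" for g x y
  proof -
    have "x \<in> carrier L" "y \<in> carrier L" using that sub by blast+
    then show ?thesis using that(1) by simp
  qed
  show ?thesis
  proof (intro subset_antisym subsetI)
    fix Q assume "Q \<in> (\<lambda>P. \<phi> ` P) ` pair_class L a b"
    then obtain g x y where g: "g \<in> carrier L" "x \<in> {a, inv\<^bsub>L\<^esub> a}" "y \<in> {b, inv\<^bsub>L\<^esub> b}"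
      and Q: "Q = \<phi> ` {g \<otimes>\<^bsub>L\<^esub> x \<otimes>\<^bsub>L\<^esub> inv\<^bsub>L\<^esub> g, g \<otimes>\<^bsub>L\<^esub> y \<otimes>\<^bsub>L\<^esub> inv\<^bsub>L\<^esub> g}"
      unfolding pair_class_def by blast
    moreover have "\<phi> x \<in> {a', inv\<^bsub>H\<^esub> a'}" "\<phi> y \<in> {b', inv\<^bsub>H\<^esub> b'}" using g ab by blast+
    ultimately show "Q \<in> pair_class H a' b'"
      unfolding pair_class_def Q img[OF g] using E.hom_closed[OF g(1)] by blast
  next
    fix Q assume "Q \<in> pair_class H a' b'"
    then obtain h x' y' where h: "h \<in> carrier H" "x' \<in> {a', inv\<^bsub>H\<^esub> a'}" "y' \<in> {b', inv\<^bsub>H\<^esub> b'}"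
      and Q: "Q = {h \<otimes>\<^bsub>H\<^esub> x' \<otimes>\<^bsub>H\<^esub> inv\<^bsub>H\<^esub> h, h \<otimes>\<^bsub>H\<^esub> y' \<otimes>\<^bsub>H\<^esub> inv\<^bsub>H\<^esub> h}"
      unfolding pair_class_def by blast
    have "h \<in> \<phi> ` carrier L" using h(1) assms(3) by (simp add: epi_def)
    then obtain g where g: "g \<in> carrier L" "h = \<phi> g" by blast
    have "x' \<in> \<phi> ` {a, inv\<^bsub>L\<^esub> a}" "y' \<in> \<phi> ` {b, inv\<^bsub>L\<^esub> b}" unfolding ab by (rule h)+
    then obtain x y where xy: "x \<in> {a, inv\<^bsub>L\<^esub> a}" "y \<in> {b, inv\<^bsub>L\<^esub> b}" "x' = \<phi> x" "y' = \<phi> y"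
      by (elim imageE) blast
    show "Q \<in> (\<lambda>P. \<phi> ` P) ` pair_class L a b"
      unfolding Q g(2) xy(3,4) img[OF g(1) xy(1,2), symmetric] pair_class_def using g(1) xy(1,2) by blast
  qed
qed

section \<open>The upper meridians as products of half-turns\<close>

lemma half_turn_integer: "half_turn (of_int i, of_int j) = rotation (2 * i) (2 * j)"
  by (auto simp: half_turn_def fun_eq_iff)

text \<open>The first two factors give the downward unit translation, which composed with the
  half-turn about (0, 1/2) is the half-turn about the origin. The slit strip moved down by 1 has its
  gap between (0, -1) and (0, 0), where the path of \<open>meridian_a\<close> crosses x = 0.\<close>

lemma meridian_a_eq: "meridian_a = turn 0 \<otimes>\<^bsub>\<A>\<^esub> turn 1 \<otimes>\<^bsub>\<A>\<^esub> side_turn"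
proof -
  let ?T = "translation 0 (-1)" and ?W = "translation 0 (-1) ` slit_strip"
  have T: "?T \<in> Aff" by (rule affine_map_in_Aff) simp
  have "z \<in> ?W \<longleftrightarrow> \<bar>fst z\<bar> < 1 \<and> (fst z = 0 \<longrightarrow> - 1 < snd z \<and> snd z < 0)" for z
  proof
    assume *: "\<bar>fst z\<bar> < 1 \<and> (fst z = 0 \<longrightarrow> - 1 < snd z \<and> snd z < 0)"
    have "z = ?T (fst z, snd z + 1)" by simp
    moreover have "(fst z, snd z + 1) \<in> slit_strip" using * by (auto simp: slit_strip_def)
    ultimately show "z \<in> ?W" by blast
  qed (auto simp: slit_strip_def)
  then have W: "?W = {z. \<bar>fst z\<bar> < 1 \<and> (fst z = 0 \<longrightarrow> - 1 < snd z \<and> snd z < 0)}" by blast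
  have base: "base \<in> ?W" unfolding W by (simp add: base_def)
  have dW: "plane.domain_at_base ?W"
    by (rule domain_image[OF T simply_connected_slit_strip slit_strip_subset base])
  have VW: "vertical_strip \<subseteq> ?W" unfolding W by (auto simp: vertical_strip_def)
  have Tb: "?T base \<in> vertical_strip" by (simp add: base_def vertical_strip_def)
  have "turn 0 \<otimes>\<^bsub>\<A>\<^esub> turn 1 = plane.elt vertical_strip ?T"
    by (simp add: turn_turn vertical_loop_def)
  also have "\<dots> = plane.elt ?W ?T"
    by (rule plane.elt_mono[OF domain_vertical_strip dW VW]) (rule Tb)
  finally have "turn 0 \<otimes>\<^bsub>\<A>\<^esub> turn 1 \<otimes>\<^bsub>\<A>\<^esub> side_turn = plane.elt ?W (?T \<circ> rotation 0 1)"
    unfolding side_turn_def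
    using plane.elt_mult[OF dW domain_slit_strip T rotation_Aff subsetD[OF VW Tb]
        rotation_slit_strip[OF base_in_slit_strip]] by simp
  also have "?T \<circ> rotation 0 1 = half_turn (0, 0)"
    using half_turn_integer[of 0 0] by (simp add: affine_map_comp)
  also have "plane.elt ?W (half_turn (0, 0)) = meridian_a"
    unfolding meridian_a_def
  proof (rule plane.elt_eq[OF dW])
    have "closed_segment base (1/2, -1/4) \<subseteq> ?W" "closed_segment (1/2, -1/4) (-1/2, -1/4) \<subseteq> ?W"
      unfolding W base_def by (auto simp: in_segment field_simps) (linarith+)?
    then show "path_image (linepath base (1/2, -1/4) +++ linepath (1/2, -1/4) (-1/2, -1/4)) \<subseteq> ?W"
      by (simp add: path_image_join)
  qed (auto simp: half_turn_def base_def)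
  finally show ?thesis by simp
qed

text \<open>The half-turn about (1/2, 0) moves the gap of the slit strip to the one between (1, -1)
  and (1, 0), where the path of \<open>meridian_b\<close> crosses x = 1.\<close>

lemma meridian_b_eq: "meridian_b = turn 0 \<otimes>\<^bsub>\<A>\<^esub> side_turn \<otimes>\<^bsub>\<A>\<^esub> turn 1"
proof -
  let ?T = "rotation 1 0" and ?W = "rotation 1 0 ` slit_strip"
  have T: "?T \<in> Aff" by (rule rotation_Aff)
  have "z \<in> ?W \<longleftrightarrow> \<bar>1 - fst z\<bar> < 1 \<and> (fst z = 1 \<longrightarrow> - 1 < snd z \<and> snd z < 0)" for z
  proof
    assume *: "\<bar>1 - fst z\<bar> < 1 \<and> (fst z = 1 \<longrightarrow> - 1 < snd z \<and> snd z < 0)"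
    have "z = ?T (1 - fst z, - snd z)" by simp
    moreover have "(1 - fst z, - snd z) \<in> slit_strip" using * by (auto simp: slit_strip_def)
    ultimately show "z \<in> ?W" by blast
  qed (auto simp: slit_strip_def)
  then have W: "?W = {z. \<bar>1 - fst z\<bar> < 1 \<and> (fst z = 1 \<longrightarrow> - 1 < snd z \<and> snd z < 0)}" by blast
  have base: "base \<in> ?W" unfolding W by (simp add: base_def)
  have dW: "plane.domain_at_base ?W"
    by (rule domain_image[OF T simply_connected_slit_strip slit_strip_subset base])
  have VW: "vertical_strip \<subseteq> ?W" unfolding W by (auto simp: vertical_strip_def)
  have Tb: "?T base \<in> vertical_strip" by (simp add: base_def vertical_strip_def)
  have "turn 0 = plane.elt ?W ?T"
    unfolding turn_def strip_elt_def
    by (rule plane.elt_mono[OF domain_vertical_strip dW VW]) (rule Tb)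
  then have "turn 0 \<otimes>\<^bsub>\<A>\<^esub> side_turn = plane.elt ?W (?T \<circ> rotation 0 1)"
    unfolding side_turn_def
    using plane.elt_mult[OF dW domain_slit_strip T rotation_Aff subsetD[OF VW Tb]
        rotation_slit_strip[OF base_in_slit_strip]] by simp
  also have "?T \<circ> rotation 0 1 = translation 1 (-1)" by (simp add: affine_map_comp)
  finally have "turn 0 \<otimes>\<^bsub>\<A>\<^esub> side_turn \<otimes>\<^bsub>\<A>\<^esub> turn 1
      = plane.elt ?W (translation 1 (-1)) \<otimes>\<^bsub>\<A>\<^esub> plane.elt vertical_strip (rotation 1 1)"
    by (simp add: turn_def strip_elt_def)
  also have "\<dots> = plane.elt ?W (translation 1 (-1) \<circ> rotation 1 1)"
  proof (rule plane.elt_mult[OF dW domain_vertical_strip _ rotation_Aff])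
    show "translation 1 (-1) \<in> Aff" by (rule affine_map_in_Aff) simp
    show "translation 1 (-1) base \<in> ?W" "rotation 1 1 base \<in> vertical_strip"
      unfolding W by (simp_all add: base_def vertical_strip_def)
    show "translation 1 (-1) ` vertical_strip \<subseteq> ?W"
      unfolding W by (auto simp: vertical_strip_def)
  qed
  also have "translation 1 (-1) \<circ> rotation 1 1 = half_turn (1, 0)"
    using half_turn_integer[of 1 0] by (simp add: affine_map_comp)
  also have "plane.elt ?W (half_turn (1, 0)) = meridian_b"
    unfolding meridian_b_def
  proof (rule plane.elt_eq[OF dW])
    have "closed_segment base (1/2, -1/4) \<subseteq> ?W" "closed_segment (1/2, -1/4) (3/2, -1/4) \<subseteq> ?W"
      unfolding W base_def by (auto simp: in_segment field_simps) (linarith+)?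
    then show "path_image (linepath base (1/2, -1/4) +++ linepath (1/2, -1/4) (3/2, -1/4)) \<subseteq> ?W"
      by (simp add: path_image_join)
  qed (auto simp: half_turn_def base_def)
  finally show ?thesis by simp
qed

lemma meridians_signed: "meridian_a \<in> signed_loops 2" "meridian_b \<in> signed_loops 2"
proof -
  have "half_turn (of_int i, of_int j) \<in> signed_translations 2" for i j
    unfolding half_turn_integer signed_translations_def by blast
  from this[of 0 0] this[of 1 0]
  have "fst meridian_a \<in> signed_translations 2" "fst meridian_b \<in> signed_translations 2"
    by (simp_all add: meridian_a_def meridian_b_def orb_class_def)
  moreover have "meridian_a \<in> carrier \<A>" "meridian_b \<in> carrier \<A>"
    unfolding meridian_a_eq meridian_b_eq by (simp_all add: turn_in side_turn_in)
  ultimately show "meridian_a \<in> signed_loops 2" "meridian_b \<in> signed_loops 2"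
    by (simp_all add: signed_loops_def)
qed

lemma side_turn_inv: "inv\<^bsub>\<A>\<^esub> side_turn = side_turn"
proof (intro plane.loops.inv_equality side_turn_in)
  have "side_turn \<otimes>\<^bsub>\<A>\<^esub> side_turn = plane.elt slit_strip (rotation 0 1 \<circ> rotation 0 1)"
    unfolding side_turn_def
    using rotation_slit_strip
    by (intro plane.elt_mult[OF domain_slit_strip domain_slit_strip rotation_Aff rotation_Aff
        rotation_slit_strip[OF base_in_slit_strip] rotation_slit_strip[OF base_in_slit_strip]]) auto
  also have "rotation 0 1 \<circ> rotation 0 1 = id" by (simp add: affine_map_comp affine_map_id)
  also have "plane.elt slit_strip id = \<one>\<^bsub>\<A>\<^esub>" by (rule plane.elt_id[OF domain_slit_strip])
  finally show "side_turn \<otimes>\<^bsub>\<A>\<^esub> side_turn = \<one>\<^bsub>\<A>\<^esub>" .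
qed

lemma shear_turn: "strip_elt (shear 1) \<otimes>\<^bsub>\<A>\<^esub> turn j \<otimes>\<^bsub>\<A>\<^esub> inv\<^bsub>\<A>\<^esub> strip_elt (shear 1) = turn (j + 1)"
  using strip_elt_turn[of 1 1 0 j]
  by (intro plane.loops.conj_eqI shear_in turn_in) (simp add: add.commute)

lemma shear_side_turn:
  "strip_elt (shear 1) \<otimes>\<^bsub>\<A>\<^esub> side_turn \<otimes>\<^bsub>\<A>\<^esub> inv\<^bsub>\<A>\<^esub> strip_elt (shear 1) = side_turn"
  using strip_elt_side_turn[of 0 1 1]
  by (intro plane.loops.conj_eqI shear_in side_turn_in) simp

text \<open>The shear raises the index of each \<open>turn\<close> by 1, and the product of two
  turns depends only on the difference of their indices.\<close>

lemma shear_meridian_a: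
  "strip_elt (shear 1) \<otimes>\<^bsub>\<A>\<^esub> meridian_a \<otimes>\<^bsub>\<A>\<^esub> inv\<^bsub>\<A>\<^esub> strip_elt (shear 1) = meridian_a"
  unfolding meridian_a_eq
  by (simp add: plane.loops.conj_mult shear_in turn_in side_turn_in shear_turn shear_side_turn)
     (simp add: turn_turn)

text \<open>The shear gives \<open>\<rho>\<^sub>1 \<sigma> \<rho>\<^sub>2\<close>, while the inverse
  of \<open>meridian_b\<close> is \<open>\<rho>\<^sub>1 \<sigma> \<rho>\<^sub>0\<close>; they differ
  by the factor \<open>\<rho>\<^sub>0 \<rho>\<^sub>2\<close>.\<close>

lemma shear_meridian_b:
  "strip_elt (shear 1) \<otimes>\<^bsub>\<A>\<^esub> meridian_b \<otimes>\<^bsub>\<A>\<^esub> inv\<^bsub>\<A>\<^esub> strip_elt (shear 1)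
    = inv\<^bsub>\<A>\<^esub> meridian_b \<otimes>\<^bsub>\<A>\<^esub> vertical_loop (-2)"
proof -
  have "strip_elt (shear 1) \<otimes>\<^bsub>\<A>\<^esub> meridian_b \<otimes>\<^bsub>\<A>\<^esub> inv\<^bsub>\<A>\<^esub> strip_elt (shear 1)
      = turn 1 \<otimes>\<^bsub>\<A>\<^esub> side_turn \<otimes>\<^bsub>\<A>\<^esub> turn 2"
    unfolding meridian_b_eq
    by (simp add: plane.loops.conj_mult shear_in turn_in side_turn_in shear_turn shear_side_turn)
  also have "\<dots> = turn 1 \<otimes>\<^bsub>\<A>\<^esub> side_turn \<otimes>\<^bsub>\<A>\<^esub> turn 0 \<otimes>\<^bsub>\<A>\<^esub> (turn 0 \<otimes>\<^bsub>\<A>\<^esub> turn 2)"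
    using plane.loops.mult_inv_cancel_left[OF turn_in turn_in, of 0 2]
    by (simp add: turn_inv plane.loops.m_assoc turn_in side_turn_in)
  also have "turn 0 \<otimes>\<^bsub>\<A>\<^esub> turn 2 = vertical_loop (-2)" by (simp add: turn_turn)
  also have "turn 1 \<otimes>\<^bsub>\<A>\<^esub> side_turn \<otimes>\<^bsub>\<A>\<^esub> turn 0 = inv\<^bsub>\<A>\<^esub> meridian_b"
    unfolding meridian_b_eq
    by (simp add: plane.loops.inv_mult_group turn_inv side_turn_inv turn_in side_turn_in plane.loops.m_assoc)
  finally show ?thesis .
qed

text \<open>The epimorphism is induced by conjugation with \<open>y\<close>: the identity if \<open>s\<close> is in the orbit,
  and the shear if \<open>s + 1\<close> is.\<close>

lemma heckoid_epi:
  fixes r n :: rat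
  assumes n: "n > 1" "2 * n \<in> \<int>"
  defines "N \<equiv> loop_kernel (Slope r) \<lfloor>2 * n\<rfloor>"
  assumes y: "y \<in> carrier \<A>" "carries (fst y) Slope_Infty Slope_Infty" "carries (fst y) s t"
    and t: "line_loops (of_int 2) t \<subseteq> N"
    and a: "y \<otimes>\<^bsub>\<A>\<^esub> meridian_a \<otimes>\<^bsub>\<A>\<^esub> inv\<^bsub>\<A>\<^esub> y = meridian_a"
    and b: "N #>\<^bsub>\<A>\<^esub> (y \<otimes>\<^bsub>\<A>\<^esub> meridian_b \<otimes>\<^bsub>\<A>\<^esub> inv\<^bsub>\<A>\<^esub> y) \<in> {N #>\<^bsub>\<A>\<^esub> meridian_b, N #>\<^bsub>\<A>\<^esub> inv\<^bsub>\<A>\<^esub> meridian_b}"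
  shows "\<exists>\<phi> \<in> epi (link_group s) (heckoid_group r n). upper_meridian_pair_preserving s r n \<phi>"
proof -
  let ?H = "heckoid_group r n" and ?\<pi> = "\<lambda>x. N #>\<^bsub>\<A>\<^esub> x"
  interpret O: group pi1_O by (rule group_pi1)
  interpret S: group pi1_S by (rule group_pi1)
  have N: "N \<lhd> pi1_O" unfolding N_def by (rule loop_kernel_normal)
  interpret N: normal N pi1_O by (rule N)
  note N' = N[unfolded normal_pi1_O_iff]
  note H = heckoid_eq[OF n, of r, folded N_def]
  have Q: "group (pi1_O Mod N)" by (rule N.factorgroup_is_group)
  have \<pi>O: "?\<pi> \<in> hom pi1_O (pi1_O Mod N)"
    using N.r_coset_hom_Mod by (simp add: r_coset_pi1)
  have S_O: "subgroup (signed_loops 2) pi1_O" using signed_loops_normal_pi1_O by (rule normal_imp_subgroup)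
  interpret P: group_hom pi1_O "pi1_O Mod N" ?\<pi>
    using Q \<pi>O by (simp add: group_hom_def group_hom_axioms_def O.is_group)
  have "subgroup (?\<pi> ` signed_loops 2) (pi1_O Mod N)"
    by (rule P.subgroup_img_is_subgroup[OF S_O])
  then have gH: "group ?H" unfolding H(2) by (rule group.subgroup_imp_group[OF Q])
  have \<pi>S: "?\<pi> \<in> hom pi1_S ?H"
  proof (rule homI)
    fix x z assume xz: "x \<in> carrier pi1_S" "z \<in> carrier pi1_S"
    then show "?\<pi> x \<in> carrier ?H" by (simp add: H(2) pi1_eq)
    have "x \<in> carrier pi1_O" "z \<in> carrier pi1_O" using xz signed_loops_2_subset by (auto simp: pi1_eq)
    then show "?\<pi> (x \<otimes>\<^bsub>pi1_S\<^esub> z) = ?\<pi> x \<otimes>\<^bsub>?H\<^esub> ?\<pi> z"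
      using hom_mult[OF \<pi>O] by (simp add: H(2) pi1_eq)
  qed
  have yc: "y \<otimes>\<^bsub>\<A>\<^esub> x \<otimes>\<^bsub>\<A>\<^esub> inv\<^bsub>\<A>\<^esub> y \<in> signed_loops 2" if "x \<in> signed_loops 2" for x
    using signed_loops_conj[OF _ y(1) that] by simp
  define \<theta> where "\<theta> = (\<lambda>x. ?\<pi> (y \<otimes>\<^bsub>\<A>\<^esub> x \<otimes>\<^bsub>\<A>\<^esub> inv\<^bsub>\<A>\<^esub> y))"
  have \<theta>: "\<theta> \<in> hom pi1_S ?H"
  proof (rule homI)
    fix x z assume xz: "x \<in> carrier pi1_S" "z \<in> carrier pi1_S"
    then have xz': "x \<in> signed_loops 2" "z \<in> signed_loops 2" by (simp_all add: pi1_eq)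
    then show "\<theta> x \<in> carrier ?H" using yc by (simp add: H(2) \<theta>_def)
    have "y \<otimes>\<^bsub>\<A>\<^esub> (x \<otimes>\<^bsub>\<A>\<^esub> z) \<otimes>\<^bsub>\<A>\<^esub> inv\<^bsub>\<A>\<^esub> y
        = (y \<otimes>\<^bsub>\<A>\<^esub> x \<otimes>\<^bsub>\<A>\<^esub> inv\<^bsub>\<A>\<^esub> y) \<otimes>\<^bsub>\<A>\<^esub> (y \<otimes>\<^bsub>\<A>\<^esub> z \<otimes>\<^bsub>\<A>\<^esub> inv\<^bsub>\<A>\<^esub> y)"
      by (rule plane.loops.conj_mult[OF y(1) signed_loopsD[OF xz'(1)] signed_loopsD[OF xz'(2)]])
    then show "\<theta> (x \<otimes>\<^bsub>pi1_S\<^esub> z) = \<theta> x \<otimes>\<^bsub>?H\<^esub> \<theta> z"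
      using hom_mult[OF \<pi>S] yc[OF xz'(1)] yc[OF xz'(2)] by (simp add: \<theta>_def pi1_eq)
  qed
  have surj: "\<theta> ` carrier pi1_S = carrier ?H"
  proof
    show "\<theta> ` carrier pi1_S \<subseteq> carrier ?H" using \<theta> by (auto simp: hom_def)
    have "?\<pi> x \<in> \<theta> ` signed_loops 2" if x: "x \<in> signed_loops 2" for x
    proof -
      have xc: "x \<in> carrier \<A>" using x by (rule signed_loopsD)
      have "inv\<^bsub>\<A>\<^esub> y \<otimes>\<^bsub>\<A>\<^esub> x \<otimes>\<^bsub>\<A>\<^esub> inv\<^bsub>\<A>\<^esub> (inv\<^bsub>\<A>\<^esub> y) \<in> signed_loops 2"
        using signed_loops_conj[OF _ plane.loops.inv_closed[OF y(1)] x] by simp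
      moreover have "?\<pi> x = \<theta> (inv\<^bsub>\<A>\<^esub> y \<otimes>\<^bsub>\<A>\<^esub> x \<otimes>\<^bsub>\<A>\<^esub> inv\<^bsub>\<A>\<^esub> (inv\<^bsub>\<A>\<^esub> y))"
        using xc y(1) by (simp add: \<theta>_def plane.loops.word_simps)
      ultimately show ?thesis by blast
    qed
    then show "carrier ?H \<subseteq> \<theta> ` carrier pi1_S" by (auto simp: H(2) pi1_eq)
  qed
  have K: "link_kernel s \<lhd> pi1_S" "link_kernel s \<subseteq> {x \<in> signed_loops 2. y \<otimes>\<^bsub>\<A>\<^esub> x \<otimes>\<^bsub>\<A>\<^esub> inv\<^bsub>\<A>\<^esub> y \<in> N}"
  proof -
    have l: "line_loops (of_int 2) Slope_Infty \<subseteq> signed_loops 2" "line_loops (of_int 2) s \<subseteq> signed_loops 2"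
      by (rule line_loops_signed[OF dvd_refl])+
    then show "link_kernel s \<lhd> pi1_S"
      unfolding link_kernel_eq by (intro S.normal_closure_normal) (simp add: pi1_eq)
    \<comment> \<open>In the odd case \<open>N\<close> need not lie in the group of S, so it is
      intersected with that group before being pulled back.\<close>
    have "N \<inter> signed_loops 2 \<lhd> pi1_S"
      unfolding normal_pi1_S_iff
    proof (intro conjI ballI)
      show "subgroup (N \<inter> signed_loops 2) \<A>"
        using N' subgroup_signed_loops by (intro plane.loops.subgroups_Inter_pair) auto
      fix x z assume x: "x \<in> signed_loops 2" and z: "z \<in> N \<inter> signed_loops 2"
      have "x \<in> signed_loops 1" using x signed_loops_2_subset by (rule rev_subsetD)
      then have "x \<otimes>\<^bsub>\<A>\<^esub> z \<otimes>\<^bsub>\<A>\<^esub> inv\<^bsub>\<A>\<^esub> x \<in> N" using N' z by blast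
      moreover have "x \<otimes>\<^bsub>\<A>\<^esub> z \<otimes>\<^bsub>\<A>\<^esub> inv\<^bsub>\<A>\<^esub> x \<in> signed_loops 2"
        using z by (intro signed_loops_conj[OF dvd_refl signed_loopsD[OF x]]) blast
      ultimately show "x \<otimes>\<^bsub>\<A>\<^esub> z \<otimes>\<^bsub>\<A>\<^esub> inv\<^bsub>\<A>\<^esub> x \<in> N \<inter> signed_loops 2" by blast
    qed blast
    from normal_transport_pi1_S[OF this y(1)]
    have "link_kernel s \<subseteq> {x \<in> signed_loops 2. y \<otimes>\<^bsub>\<A>\<^esub> x \<otimes>\<^bsub>\<A>\<^esub> inv\<^bsub>\<A>\<^esub> y \<in> N \<inter> signed_loops 2}"
      unfolding link_kernel_eq
    proof (rule S.normal_closure_least)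
      have "line_loops (of_int 2) Slope_Infty \<subseteq> N" unfolding N_def by (rule line_loops_kernel)
      \<comment> \<open>\<open>y\<close> fixes the slope infinity and takes \<open>s\<close> to
        \<open>t\<close>, so both kinds of relators go to line loops in \<open>N\<close>.\<close>
      then show "line_loops (of_int 2) Slope_Infty \<union> line_loops (of_int 2) s
          \<subseteq> {x \<in> signed_loops 2. y \<otimes>\<^bsub>\<A>\<^esub> x \<otimes>\<^bsub>\<A>\<^esub> inv\<^bsub>\<A>\<^esub> y \<in> N \<inter> signed_loops 2}"
        using l t yc line_loops_conj[OF y(1) y(2)] line_loops_conj[OF y(1) y(3)] by blast
    qed
    then show "link_kernel s \<subseteq> {x \<in> signed_loops 2. y \<otimes>\<^bsub>\<A>\<^esub> x \<otimes>\<^bsub>\<A>\<^esub> inv\<^bsub>\<A>\<^esub> y \<in> N}" by blast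
  qed
  have "\<theta> k = \<one>\<^bsub>?H\<^esub>" if "k \<in> link_kernel s" for k
  proof -
    have "y \<otimes>\<^bsub>\<A>\<^esub> k \<otimes>\<^bsub>\<A>\<^esub> inv\<^bsub>\<A>\<^esub> y \<in> N" using that K(2) by blast
    moreover from this have "y \<otimes>\<^bsub>\<A>\<^esub> k \<otimes>\<^bsub>\<A>\<^esub> inv\<^bsub>\<A>\<^esub> y \<in> carrier \<A>"
      unfolding N_def by (rule loop_kernel_in)
    ultimately have "N #>\<^bsub>\<A>\<^esub> (y \<otimes>\<^bsub>\<A>\<^esub> k \<otimes>\<^bsub>\<A>\<^esub> inv\<^bsub>\<A>\<^esub> y) = N"
      using N' by (intro plane.loops.coset_join2) auto
    then show ?thesis by (simp add: \<theta>_def H(2) FactGroup_def)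
  qed
  then obtain \<phi> where \<phi>: "\<phi> \<in> epi (pi1_S Mod link_kernel s) ?H"
    "\<And>x. x \<in> carrier pi1_S \<Longrightarrow> \<phi> (link_kernel s #>\<^bsub>pi1_S\<^esub> x) = \<theta> x"
    using quotient_epi[OF S.is_group gH K(1) \<theta> surj] by blast
  have m: "meridian_a \<in> carrier pi1_S" "meridian_b \<in> carrier pi1_S"
    using meridians_signed by (simp_all add: pi1_eq)
  interpret PS: group_hom pi1_S ?H ?\<pi>
    using \<pi>S gH by (simp add: group_hom_def group_hom_axioms_def S.is_group)
  have inv_b: "?\<pi> (inv\<^bsub>\<A>\<^esub> meridian_b) = inv\<^bsub>?H\<^esub> (?\<pi> meridian_b)"
    using PS.hom_inv[OF m(2)] inv_pi1(2) m(2) by (simp add: pi1_eq)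
  have gL: "group (pi1_S Mod link_kernel s)" using K(1) by (rule normal.factorgroup_is_group)
  have "upper_meridian_pair_preserving s r n \<phi>"
    unfolding upper_meridian_pair_preserving_def link_upper_meridian_pair_def
      heckoid_upper_meridian_pair_def link_group_def link_proj_def H(1)
  proof (rule pair_class_epi[OF gL gH \<phi>(1)])
    show "link_kernel s #>\<^bsub>pi1_S\<^esub> meridian_a \<in> carrier (pi1_S Mod link_kernel s)"
      "link_kernel s #>\<^bsub>pi1_S\<^esub> meridian_b \<in> carrier (pi1_S Mod link_kernel s)"
      using m by (auto simp: FactGroup_def RCOSETS_def)
    show "\<phi> (link_kernel s #>\<^bsub>pi1_S\<^esub> meridian_a) \<in> {?\<pi> meridian_a, inv\<^bsub>?H\<^esub> ?\<pi> meridian_a}"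
      unfolding \<phi>(2)[OF m(1)] \<theta>_def a by simp
    show "\<phi> (link_kernel s #>\<^bsub>pi1_S\<^esub> meridian_b) \<in> {?\<pi> meridian_b, inv\<^bsub>?H\<^esub> ?\<pi> meridian_b}"
      unfolding \<phi>(2)[OF m(2)] \<theta>_def inv_b[symmetric] by (rule b)
  qed (use m PS.hom_closed in auto)
  then show ?thesis using \<phi>(1) unfolding link_group_def by blast
qed

theorem theorem4p1:
  fixes r n :: rat and s :: slope
  assumes "n > 1" and "2 * n \<in> \<int>"
    and "s \<in> orbit_infty r n \<or> slope_plus_one s \<in> orbit_infty r n"
  shows "\<exists>\<phi> \<in> epi (link_group s) (heckoid_group r n). upper_meridian_pair_preserving s r n \<phi>"
  using assms(3)
proof
  assume s: "s \<in> orbit_infty r n"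
  have 1: "carries (fst \<one>\<^bsub>\<A>\<^esub>) t t" for t by (simp add: plane.fst_one carries_def lin_id)
  show ?thesis
    by (rule heckoid_epi[OF assms(1,2) plane.loops.one_closed 1 1 orbit_line_loops[OF s]])
       (use meridians_signed signed_loopsD in auto)
next
  assume s: "slope_plus_one s \<in> orbit_infty r n"
  let ?N = "loop_kernel (Slope r) \<lfloor>2 * n\<rfloor>"
  note N' = loop_kernel_normal[of "Slope r" "\<lfloor>2 * n\<rfloor>", unfolded normal_pi1_O_iff]
  have carry: "carries (fst (strip_elt (shear 1))) s (slope_plus_one s)"
  proof (cases s)
    case (Slope x)
    obtain p q where pq: "slope_vec s = (p, q)" by fastforce
    have "slope_of (1 * p + 0 * q, 1 * p + 1 * q) = slope_plus_one s"
      using slope_vec_Slope[of x p q] pq Slope by (simp add: add_divide_distrib)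
    then show ?thesis using carries_slope_of[of 1 1 0 1 s p q 0 0, OF _ pq] by simp
  qed (simp add: carries_def slope_dir_infty lin_affine_map)
  have infty: "carries (fst (strip_elt (shear 1))) Slope_Infty Slope_Infty"
    by (simp add: carries_def slope_dir_infty lin_affine_map)
  have b: "meridian_b \<in> carrier \<A>" using meridians_signed signed_loopsD by blast
  have ib: "inv\<^bsub>\<A>\<^esub> meridian_b \<in> signed_loops 1"
    using meridians_signed(2) signed_loops_2_subset subgroup.m_inv_closed[OF subgroup_signed_loops] by blast
  have "vertical_loop (-2) \<in> ?N"
    using vertical_loop_multiple[of ?N 2 "-1"] N' vertical_loop_line_loop[of 2] line_loops_kernel(1)
    by fastforce
  \<comment> \<open>Conjugation by the inverse of \<open>meridian_b\<close> lets the surplus factor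
    from \<open>shear_meridian_b\<close> move to the front, where the coset of the kernel absorbs
    it.\<close>
  then have n: "inv\<^bsub>\<A>\<^esub> meridian_b \<otimes>\<^bsub>\<A>\<^esub> vertical_loop (-2) \<otimes>\<^bsub>\<A>\<^esub> inv\<^bsub>\<A>\<^esub> (inv\<^bsub>\<A>\<^esub> meridian_b) \<in> ?N" (is "?n \<in> _")
    using N' ib by blast
  have "inv\<^bsub>\<A>\<^esub> meridian_b \<otimes>\<^bsub>\<A>\<^esub> vertical_loop (-2) = ?n \<otimes>\<^bsub>\<A>\<^esub> inv\<^bsub>\<A>\<^esub> meridian_b"
    using b by (simp add: plane.loops.m_assoc vertical_loop_in)
  moreover have "?N #>\<^bsub>\<A>\<^esub> (?n \<otimes>\<^bsub>\<A>\<^esub> inv\<^bsub>\<A>\<^esub> meridian_b) = ?N #>\<^bsub>\<A>\<^esub> inv\<^bsub>\<A>\<^esub> meridian_b"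
    using plane.loops.coset_mult_assoc[of ?N ?n "inv\<^bsub>\<A>\<^esub> meridian_b"] plane.loops.coset_join2[of ?n ?N]
      N' n b vertical_loop_in subgroup.subset[of ?N \<A>] by auto
  ultimately have "?N #>\<^bsub>\<A>\<^esub> (inv\<^bsub>\<A>\<^esub> meridian_b \<otimes>\<^bsub>\<A>\<^esub> vertical_loop (-2)) = ?N #>\<^bsub>\<A>\<^esub> inv\<^bsub>\<A>\<^esub> meridian_b"
    by simp
  then show ?thesis
    by (intro heckoid_epi[OF assms(1,2) shear_in infty carry orbit_line_loops[OF s]] shear_meridian_a)
       (simp add: shear_meridian_b)
qed

end
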